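(* For every outerplanar graph $G$ we have $i(G) > \partial_4(G)$.
   Context: All graphs are simple and finite and have at least one vertex. A graph is outerplanar if it is planar and has an embedding in the plane such that all vertices belong to the boundary of its outer face (it need not be connected). An independent set of $G$ is a (possibly empty) set of pairwise nonadjacent vertices; $i(G)$ denotes the number of independent sets of $G$. For an integer $k\ge 1$, a $k$-dominating set of $G$ is a subset $D\subseteq V(G)$ such that every vertex of $V(G)\setminus D$ is adjacent to at least $k$ vertices of $D$; $\partial_k(G)$ denotes the number of $k$-dominating sets of $G$. *)

theory Defs
  imports "HOL-Analysis.Analysis" "Graph_Theory.Pair_Digraph"
begin

text \<open>
  Finite simple graphs are represented by the locale \<^locale>\<open>pair_graph\<close>: a finite vertex set
  with a symmetric, irreflexive set of ordered pairs of vertices as adjacency relation.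
\<close>

definition independent_set :: "'a pair_pre_digraph \<Rightarrow> 'a set \<Rightarrow> bool" where
  "independent_set G S \<longleftrightarrow>
     S \<subseteq> pverts G \<and> (\<forall>u\<in>S. \<forall>v\<in>S. (u, v) \<notin> parcs G)"

definition num_independent_sets :: "'a pair_pre_digraph \<Rightarrow> nat" where
  "num_independent_sets G = card {S. independent_set G S}"

definition dominating_set :: "nat \<Rightarrow> 'a pair_pre_digraph \<Rightarrow> 'a set \<Rightarrow> bool" where
  "dominating_set k G D \<longleftrightarrow>
     D \<subseteq> pverts G \<and> (\<forall>v \<in> pverts G - D. k \<le> card {u \<in> D. (v, u) \<in> parcs G})"

definition num_dominating_sets :: "nat \<Rightarrow> 'a pair_pre_digraph \<Rightarrow> nat" where
  "num_dominating_sets k G = card {D. dominating_set k G D}"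

text \<open>
  The plane is \<^typ>\<open>complex\<close>. The vertex \<open>v\<close> is drawn as the point \<open>p v\<close>. The curves are indexed
  by unordered pairs, so that the two orientations of an edge share one curve, whose own
  orientation is irrelevant.
\<close>

definition plane_embedding ::
    "'a pair_pre_digraph \<Rightarrow> ('a \<Rightarrow> complex) \<Rightarrow> ('a set \<Rightarrow> real \<Rightarrow> complex) \<Rightarrow> bool" where
  "plane_embedding G p c \<longleftrightarrow>
     inj_on p (pverts G) \<and>
     (\<forall>(u, v) \<in> parcs G.
        arc (c {u, v}) \<and>
        {pathstart (c {u, v}), pathfinish (c {u, v})} = {p u, p v} \<and>
        path_image (c {u, v}) \<inter> p ` pverts G = {p u, p v}) \<and>
     (\<forall>(u, v) \<in> parcs G. \<forall>(x, y) \<in> parcs G. {u, v} \<noteq> {x, y} \<longrightarrow>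
        path_image (c {u, v}) \<inter> path_image (c {x, y}) \<subseteq> p ` pverts G)"

definition drawing ::
    "'a pair_pre_digraph \<Rightarrow> ('a \<Rightarrow> complex) \<Rightarrow> ('a set \<Rightarrow> real \<Rightarrow> complex) \<Rightarrow> complex set" where
  "drawing G p c = p ` pverts G \<union> (\<Union>(u, v) \<in> parcs G. path_image (c {u, v}))"

text \<open>
  The drawing of a finite graph is compact, so its complement has exactly one unbounded
  component. This is the outer face, and \<^const>\<open>outside\<close> yields it.
\<close>

definition outerplanar :: "'a pair_pre_digraph \<Rightarrow> bool" where
  "outerplanar G \<longleftrightarrow>
     (\<exists>p c. plane_embedding G p c \<and> p ` pverts G \<subseteq> frontier (outside (drawing G p c)))"

end

theory Submission
  imports Defs
begin

text \<open>
  An outerplanar drawing admits neither three internally disjoint paths with inner vertices between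
  two vertices, nor a cycle with two crossing chords: by the Jordan curve theorem, after an inversion
  if necessary, some vertex would be cut off from the outer face. Hence the vertices can be placed on
  a circle without crossing edges, and adding edges one may take the graph to be a triangulated polygon.

  The complement of a 4-dominating set is a set all of whose members have at least four neighbours
  outside it. In a triangulated polygon such sets are compared with independent sets by removing
  leaf triangles one at a time. Removing a vertex changes the demands on its two neighbours, which
  is absorbed by multiplicative vertex weights on the independent sets, powers of the square root of
  2. The weighted inequality, which carries a factor 2 already for the single root edge, survives each
  removal, so that twice the number of 4-dominating sets is at most the number of independent sets.
\<close>

section \<open>Triangulations and non-crossing orders\<close>

text \<open>The scale \<open>sqrt 2\<close> is forced by the cheapest removal. A leaf of weight 1
  contributes the factors 2, 1, 1 to the independent sets that miss both its neighbours, contain the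
  one, or contain the other; multiplying both neighbour weights by r instead gives r^2, 1, 1. The
  obstacle is a leaf with two removed neighbours outside the set: it may itself be used, but only if
  both remaining neighbours are kept out. Hence the induction carries, besides the counts
  \<open>e\<close> of removed outside neighbours and the weights \<open>l\<close>, a set
  \<open>X\<close> of forced vertices whose weights may drop below 1. This is paid for by
  \<open>credit\<close>, the number of forced children, each worth a factor \<open>sqrt 2\<close>.
  If the parent of such a leaf is too light to pay, it is removed together with all its children,
  which causes the two large numerical case analyses. The constant 7/6 fits into the slack 2 sqrt 2
  + 1/(2 sqrt 2) - 2 left by leaves with \<open>e\<close> at least 3. On the geometric side an arc
  may run outside a closed curve as well as inside; inversion at an inner point turns the former
  situation into the latter, so one splitting statement about insides serves for both.\<close>

text \<open>Each interior vertex \<open>x\<close> is the apex of one triangle with base from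
  \<open>lo x\<close> to \<open>hi x\<close>. The disjunction makes this base the outer edge or a
  side of another triangle, whose apex is then \<open>lo x\<close> or \<open>hi x\<close>; the
  second clause forbids two triangles on one base, and the last one lets the triangulation contain
  all edges of \<open>R\<close>.\<close>

definition triangulates ::
    "(nat \<Rightarrow> nat \<Rightarrow> bool) \<Rightarrow> nat \<Rightarrow> nat \<Rightarrow> (nat \<Rightarrow> nat) \<Rightarrow> (nat \<Rightarrow> nat) \<Rightarrow> bool" where
  "triangulates R i j lo hi \<longleftrightarrow>
     (\<forall>x. i < x \<and> x < j \<longrightarrow> i \<le> lo x \<and> lo x < x \<and> x < hi x \<and> hi x \<le> j \<and>
        (lo x = i \<and> hi x = j \<or> i < lo x \<and> hi (lo x) = hi x \<or> hi x < j \<and> lo (hi x) = lo x)) \<and>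
     (\<forall>x y. i < x \<and> x < j \<and> i < y \<and> y < j \<and> lo x = lo y \<and> hi x = hi y \<longrightarrow> x = y) \<and>
     (\<forall>x y. i \<le> x \<and> x < y \<and> y \<le> j \<and> R x y \<longrightarrow>
        x = i \<and> y = j \<or> i < y \<and> y < j \<and> x = lo y \<or> i < x \<and> x < j \<and> y = hi x)"

lemma triangulatesD:
  assumes "triangulates R i j lo hi"
  shows "i < x \<Longrightarrow> x < j \<Longrightarrow> i \<le> lo x \<and> lo x < x \<and> x < hi x \<and> hi x \<le> j"
    and "i < x \<Longrightarrow> x < j \<Longrightarrow>
      lo x = i \<and> hi x = j \<or> i < lo x \<and> hi (lo x) = hi x \<or> hi x < j \<and> lo (hi x) = lo x"
    and "i < x \<Longrightarrow> x < j \<Longrightarrow> i < y \<Longrightarrow> y < j \<Longrightarrow> lo x = lo y \<Longrightarrow> hi x = hi y \<Longrightarrow> x = y"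
    and "i \<le> x \<Longrightarrow> x < y \<Longrightarrow> y \<le> j \<Longrightarrow> R x y \<Longrightarrow>
      x = i \<and> y = j \<or> i < y \<and> y < j \<and> x = lo y \<or> i < x \<and> x < j \<and> y = hi x"
  using assms unfolding triangulates_def by meson+

text \<open>Split at the farthest neighbour \<open>k\<close> of \<open>i\<close> before
  \<open>j\<close>. No edge of \<open>R\<close> passes over \<open>k\<close> except possibly the one
  from \<open>i\<close> to \<open>j\<close>: an edge starting strictly between \<open>i\<close> and
  \<open>k\<close> would cross the edge from \<open>i\<close> to \<open>k\<close>, and one starting
  at \<open>i\<close> would contradict the choice of \<open>k\<close>. The triangle on
  \<open>i\<close>, \<open>k\<close>, \<open>j\<close> joins the triangulations of the two
  halves.\<close>

lemma triangulation_exists: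
  assumes nc: "\<And>a b c d. a < b \<Longrightarrow> b < c \<Longrightarrow> c < d \<Longrightarrow> R a c \<Longrightarrow> \<not> R b d"
    and "i < j"
  shows "\<exists>lo hi. triangulates R i j lo hi"
  using \<open>i < j\<close>
proof (induction "j - i" arbitrary: i j rule: less_induct)
  case less
  show ?case
  proof (cases "j = Suc i")
    case True
    then have "triangulates R i j id id"
      by (auto simp: triangulates_def)
    then show ?thesis
      by blast
  next
    case False
    \<comment> \<open>The default \<open>Suc i\<close> makes the left half a single edge, so no
      vertex lies strictly between \<open>i\<close> and \<open>k\<close>.\<close>
    define k where "k = (if \<exists>y. i < y \<and> y < j \<and> R i y then Max {y. i < y \<and> y < j \<and> R i y} else Suc i)"
    let ?S = "{y. i < y \<and> y < j \<and> R i y}"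
    have fin: "finite ?S"
      by simp
    have k: "i < k" "k < j" and kmax: "\<And>y. k < y \<Longrightarrow> y < j \<Longrightarrow> \<not> R i y" and kR: "k = Suc i \<or> R i k"
    proof -
      have "k \<in> ?S \<or> ?S = {} \<and> k = Suc i"
        using Max_in[OF fin] unfolding k_def by (metis (no_types, lifting) empty_Collect_eq)
      then show "i < k" "k < j" "k = Suc i \<or> R i k"
        using less.prems False by auto
      show "\<not> R i y" if "k < y" "y < j" for y
      proof
        assume "R i y"
        then have y: "y \<in> ?S"
          using that \<open>i < k\<close> by auto
        then have "\<exists>y. i < y \<and> y < j \<and> R i y"
          by blast
        then have "k = Max ?S"
          by (simp only: k_def if_True)
        then show False
          using Max_ge[OF fin y] that by simp
      qed
    qed
    obtain lo1 hi1 where "triangulates R i k lo1 hi1"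
      using less.hyps[OF _ k(1)] k by (metis diff_less_mono less_imp_le_nat)
    note L = triangulatesD[OF this]
    obtain lo2 hi2 where "triangulates R k j lo2 hi2"
      using less.hyps[OF _ k(2)] k by (metis diff_less_mono2 less_trans)
    note U = triangulatesD[OF this]
    define lo where "lo = (\<lambda>x. if x < k then lo1 x else if x = k then i else lo2 x)"
    define hi where "hi = (\<lambda>x. if x < k then hi1 x else if x = k then j else hi2 x)"
    have left: "lo x = lo1 x" "hi x = hi1 x" if "x < k" for x
      using that by (simp_all add: lo_def hi_def)
    have mid: "lo k = i" "hi k = j"
      by (simp_all add: lo_def hi_def)
    have right: "lo x = lo2 x" "hi x = hi2 x" if "k < x" for x
      using that by (simp_all add: lo_def hi_def)
    have bounds: "i \<le> lo x \<and> lo x < x \<and> x < hi x \<and> hi x \<le> j" if "i < x" "x < j" for x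
      using L(1)[of x] U(1)[of x] left[of x] right[of x] mid that k
      by (cases x k rule: linorder_cases) auto
    have adj: "lo x = i \<and> hi x = j \<or> i < lo x \<and> hi (lo x) = hi x \<or> hi x < j \<and> lo (hi x) = lo x"
      if "i < x" "x < j" for x
    proof (cases x k rule: linorder_cases)
      case less
      have "hi1 x \<le> k" "lo1 x < x"
        using L(1)[of x] that less by auto
      then show ?thesis
        using L(2)[of x] left[of x] left[of "lo1 x"] left[of "hi1 x"] mid that less k
        by (cases "hi1 x = k") auto
    next
      case greater
      have "k \<le> lo2 x" "x < hi2 x"
        using U(1)[of x] that greater by auto
      then show ?thesis
        using U(2)[of x] right[of x] right[of "lo2 x"] right[of "hi2 x"] mid that greater k
        by (cases "lo2 x = k") auto
    qed (use mid in auto)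
    \<comment> \<open>The base of a vertex alone tells on which side of \<open>k\<close> the vertex
      lies; this rules out equal bases in different halves.\<close>
    have loc: "lo x \<ge> k \<longleftrightarrow> k < x" "hi x \<le> k \<longleftrightarrow> x < k" if "i < x" "x < j" for x
      using L(1)[of x] U(1)[of x] left[of x] right[of x] mid that k
      by (cases x k rule: linorder_cases; auto)+
    have inj: "x = y" if "i < x" "x < j" "i < y" "y < j" "lo x = lo y" "hi x = hi y" for x y
    proof (cases x k rule: linorder_cases)
      case less
      then have "y < k"
        using loc(2)[of x] loc(2)[of y] that by simp
      then show ?thesis
        using L(3)[of x y] left that less by simp
    next
      case equal
      have "k < x \<longleftrightarrow> k < y" "x < k \<longleftrightarrow> y < k"
        using loc[OF that(1,2)] loc[OF that(3,4)] unfolding that(5,6) by blast+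
      then show ?thesis
        using equal by linarith
    next
      case greater
      then have "k < y"
        using loc(1)[of x] loc(1)[of y] that by simp
      then show ?thesis
        using U(3)[of x y] right that greater by simp
    qed
    have cover: "x = i \<and> y = j \<or> i < y \<and> y < j \<and> x = lo y \<or> i < x \<and> x < j \<and> y = hi x"
      if xy: "i \<le> x" "x < y" "y \<le> j" "R x y" for x y
    proof -
      consider "y \<le> k" | "k \<le> x" | "x < k" "k < y"
        by linarith
      then show ?thesis
      proof cases
        case 1
        then show ?thesis
          using L(4)[of x y] left[of x] left[of y] mid xy k by auto
      next
        case 2
        then show ?thesis
          using U(4)[of x y] right[of x] right[of y] mid xy k by auto
      next
        case 3
        have "x = i"
        proof (rule ccontr)
          assume "x \<noteq> i"
          then have "i < x" "R i k"
            using xy 3 kR by auto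
          then show False
            using nc[of i x k y] 3 xy by blast
        qed
        then show ?thesis
          using kmax[of y] 3 xy by (cases "y = j") auto
      qed
    qed
    have "triangulates R i j lo hi"
      unfolding triangulates_def using bounds adj inj cover by blast
    then show ?thesis
      by blast
  qed
qed

section \<open>Non-crossing orders under rotation and gluing\<close>

definition noncrossing :: "('a \<Rightarrow> 'a \<Rightarrow> bool) \<Rightarrow> 'a set \<Rightarrow> ('a \<Rightarrow> nat) \<Rightarrow> bool" where
  "noncrossing E V pos \<longleftrightarrow> inj_on pos V \<and>
     (\<forall>a\<in>V. \<forall>b\<in>V. \<forall>c\<in>V. \<forall>d\<in>V.
        pos a < pos b \<and> pos b < pos c \<and> pos c < pos d \<longrightarrow> \<not> (E a c \<and> E b d))"

lemma noncrossingD: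
  assumes "noncrossing E V pos"
  shows "inj_on pos V"
    and "a \<in> V \<Longrightarrow> b \<in> V \<Longrightarrow> c \<in> V \<Longrightarrow> d \<in> V \<Longrightarrow> pos a < pos b \<Longrightarrow> pos b < pos c \<Longrightarrow> pos c < pos d \<Longrightarrow>
      E a c \<Longrightarrow> E b d \<Longrightarrow> False"
  using assms unfolding noncrossing_def by blast+

text \<open>Whether two chords cross depends only on the cyclic order of their ends, so a cyclic
  shift of the positions is harmless. Symmetry of \<open>E\<close> enters because the shift may
  exchange the ends of an edge.\<close>

lemma noncrossing_rotate:
  assumes nc: "noncrossing E V pos" and fin: "finite V" and c: "c \<in> V"
    and sym: "\<And>x y. E x y \<Longrightarrow> E y x"
  obtains pos' where "noncrossing E V pos'" "pos' c = 0"
proof -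
  define M where "M = Suc (Max (pos ` V))"
  have M: "pos x < M" if "x \<in> V" for x
    unfolding M_def using fin that by (simp add: le_imp_less_Suc)
  define pos' where "pos' = (\<lambda>x. if pos c \<le> pos x then pos x - pos c else pos x + M - pos c)"
  have less: "pos' x < pos' y \<longleftrightarrow>
      (if pos c \<le> pos x then (if pos c \<le> pos y then pos x < pos y else True)
       else (if pos c \<le> pos y then False else pos x < pos y))" if "x \<in> V" "y \<in> V" for x y
    using M[OF that(1)] M[OF that(2)] M[OF c] by (auto simp: pos'_def)
  have "inj_on pos' V"
  proof (rule inj_onI)
    fix x y assume xy: "x \<in> V" "y \<in> V" "pos' x = pos' y"
    then have "pos x = pos y"
      using less[of x y] less[of y x] by (simp split: if_splits)
    then show "x = y"
      using noncrossingD(1)[OF nc] xy by (auto dest: inj_onD)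
  qed
  moreover have False
    if q: "a \<in> V" "b \<in> V" "x \<in> V" "d \<in> V" "pos' a < pos' b" "pos' b < pos' x" "pos' x < pos' d" "E a x" "E b d"
    for a b x d
  proof -
    note N = noncrossingD(2)[OF nc]
    have l: "if pos c \<le> pos a then (pos c \<le> pos b \<longrightarrow> pos a < pos b) else \<not> pos c \<le> pos b \<and> pos a < pos b"
      "if pos c \<le> pos b then (pos c \<le> pos x \<longrightarrow> pos b < pos x) else \<not> pos c \<le> pos x \<and> pos b < pos x"
      "if pos c \<le> pos x then (pos c \<le> pos d \<longrightarrow> pos x < pos d) else \<not> pos c \<le> pos d \<and> pos x < pos d"
      using q less[of a b] less[of b x] less[of x d] by (simp_all split: if_splits)
    have "pos a < pos b \<and> pos b < pos x \<and> pos x < pos d \<or> pos d < pos a \<and> pos a < pos b \<and> pos b < pos x \<or>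
      pos x < pos d \<and> pos d < pos a \<and> pos a < pos b \<or> pos b < pos x \<and> pos x < pos d \<and> pos d < pos a"
      using l by (cases "pos c \<le> pos a"; cases "pos c \<le> pos b"; cases "pos c \<le> pos x"; cases "pos c \<le> pos d") simp_all
    then show False
      using N[of a b x d] N[of d a b x] N[of x d a b] N[of b x d a] q(1-4,8,9) sym[OF q(8)] sym[OF q(9)] by blast
  qed
  ultimately have "noncrossing E V pos'"
    unfolding noncrossing_def by blast
  moreover have "pos' c = 0"
    by (simp add: pos'_def)
  ultimately show thesis
    by (rule that)
qed

text \<open>Once \<open>c\<close> is rotated to the first place in both orders, they are
  concatenated as \<open>c\<close>, \<open>A\<close>, \<open>B\<close>. Since no edge joins
  \<open>A\<close> to \<open>B\<close>, the four ends of a crossing pair would all lie in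
  \<open>insert c A\<close> or all in \<open>insert c B\<close>.\<close>

lemma noncrossing_glue:
  assumes A: "noncrossing E (insert c A) posA" and B: "noncrossing E (insert c B) posB"
    and fin: "finite A" "finite B" and disj: "A \<inter> B = {}" "c \<notin> A" "c \<notin> B"
    and cut: "\<And>x y. x \<in> A \<Longrightarrow> y \<in> B \<Longrightarrow> \<not> E x y"
    and sym: "\<And>x y. E x y \<Longrightarrow> E y x"
  obtains pos where "noncrossing E (insert c (A \<union> B)) pos"
proof -
  obtain f where f: "noncrossing E (insert c A) f" "f c = 0"
    using noncrossing_rotate[OF A _ _ sym] fin by blast
  obtain g where g: "noncrossing E (insert c B) g" "g c = 0"
    using noncrossing_rotate[OF B _ _ sym] fin by blast
  note F = noncrossingD[OF f(1)] and G = noncrossingD[OF g(1)]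
  define K where "K = Max (f ` insert c A)"
  have K: "f x \<le> K" if "x \<in> insert c A" for x
    unfolding K_def using fin that by (intro Max_ge) auto
  have f0: "0 < f x" if "x \<in> A" for x
    using F(1) f(2) that disj by (metis gr0I inj_onD insertI1 insertI2)
  have g0: "0 < g x" if "x \<in> B" for x
    using G(1) g(2) that disj by (metis gr0I inj_onD insertI1 insertI2)
  define pos where "pos = (\<lambda>x. if x \<in> B then g x + K else f x)"
  have posA: "pos x = f x" if "x \<in> insert c A" for x
    using that disj by (auto simp: pos_def)
  have posB: "pos x = g x + K" if "x \<in> B" for x
    using that by (simp add: pos_def)
  have AB: "pos x < pos y" if "x \<in> insert c A" "y \<in> B" for x y
    using K[OF that(1)] g0[OF that(2)] posA[OF that(1)] posB[OF that(2)] by linarith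
  have BB: "pos x < pos y \<longleftrightarrow> g x < g y" if "x \<in> insert c B" "y \<in> B" for x y
    using that AB[of c y] g0[OF that(2)] g(2) posB by auto
  have BB': "pos x < pos y \<Longrightarrow> y \<in> insert c B \<Longrightarrow> y \<in> B" if "x \<in> insert c (A \<union> B)" for x y
    using posA[of c] f(2) by auto
  have nadj: "\<not> E x y" if "x \<in> A \<and> y \<in> B \<or> x \<in> B \<and> y \<in> A" for x y
    using cut sym that by blast
  have "inj_on pos (insert c (A \<union> B))"
  proof (rule inj_onI)
    fix x y assume xy: "x \<in> insert c (A \<union> B)" "y \<in> insert c (A \<union> B)" "pos x = pos y"
    consider "x \<in> insert c A" "y \<in> insert c A" | "x \<in> B" "y \<in> B" | "x \<in> insert c A" "y \<in> B" | "x \<in> B" "y \<in> insert c A"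
      using xy by blast
    then show "x = y"
    proof cases
      case 1
      then show ?thesis
        using inj_onD[OF F(1), of x y] posA xy(3) by simp
    next
      case 2
      then show ?thesis
        using inj_onD[OF G(1), of x y] posB xy(3) by simp
    qed (use AB xy(3) in force)+
  qed
  moreover have False
    if q: "a \<in> insert c (A \<union> B)" "b \<in> insert c (A \<union> B)" "x \<in> insert c (A \<union> B)" "d \<in> insert c (A \<union> B)"
      "pos a < pos b" "pos b < pos x" "pos x < pos d" "E a x" "E b d" for a b x d
  proof -
    have nc: "b \<noteq> c" "x \<noteq> c" "d \<noteq> c"
      using q(5-7) posA[of c] f(2) by auto
    have order: "u \<in> A \<Longrightarrow> v \<in> A" if "pos v < pos u" "v \<in> insert c (A \<union> B)" "v \<noteq> c" for u v
      using that AB[of u v] by force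
    show False
    proof (cases "x \<in> A")
      case True
      have "b \<in> A" "a \<in> insert c A"
        using order[OF q(6,2) nc(1) True] order[of a x] q True by (auto dest: less_trans)
      moreover have "d \<in> A"
        using nadj[of b d] \<open>b \<in> A\<close> q(4,9) nc by blast
      ultimately show False
        using F(2)[of a b x d] q(5-9) posA True by auto
    next
      case False
      then have x: "x \<in> B"
        using q nc by auto
      have "a \<in> insert c B"
        using nadj[of a x] q x by blast
      have "d \<in> B"
        using AB[of d x] q x nc by force
      then have "b \<in> B"
        using nadj[of b d] q nc by blast
      then show False
        using G(2)[of a b x d] q(5-9) BB[of a b] BB[of b x] BB[of x d] \<open>a \<in> insert c B\<close> x \<open>d \<in> B\<close> by auto
    qed
  qed
  ultimately have "noncrossing E (insert c (A \<union> B)) pos"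
    unfolding noncrossing_def by blast
  then show thesis
    by (rule that)
qed

section \<open>Forbidden configurations and Hamiltonian cycles\<close>

text \<open>The excluded configuration is a subdivision of the complete bipartite graph on 2 and 3
  vertices.\<close>

definition theta_free :: "('a \<Rightarrow> 'a \<Rightarrow> bool) \<Rightarrow> 'a set \<Rightarrow> bool" where
  "theta_free E V \<longleftrightarrow> (\<forall>a b P Q R.
     P \<noteq> [] \<and> Q \<noteq> [] \<and> R \<noteq> [] \<and> distinct (a # b # P @ Q @ R) \<and> set (a # b # P @ Q @ R) \<subseteq> V \<longrightarrow>
     \<not> (successively E (a # P @ [b]) \<and> successively E (a # Q @ [b]) \<and> successively E (a # R @ [b])))"

text \<open>The excluded configuration is a subdivision of the complete graph on four vertices. The
  crossing chords are single edges because they will be compared with a Hamiltonian cycle.\<close>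

definition crossing_free :: "('a \<Rightarrow> 'a \<Rightarrow> bool) \<Rightarrow> 'a set \<Rightarrow> bool" where
  "crossing_free E V \<longleftrightarrow> (\<forall>a b c d A B C D.
     distinct (a # A @ b # B @ c # C @ d # D) \<and> set (a # A @ b # B @ c # C @ d # D) \<subseteq> V \<and>
     successively E (a # A @ b # B @ c # C @ d # D @ [a]) \<longrightarrow> \<not> (E a c \<and> E b d))"

definition is_cycle :: "('a \<Rightarrow> 'a \<Rightarrow> bool) \<Rightarrow> 'a list \<Rightarrow> bool" where
  "is_cycle E xs \<longleftrightarrow> 3 \<le> length xs \<and> distinct xs \<and> successively E xs \<and> E (last xs) (hd xs)"

text \<open>Besides cut vertices this covers disconnected graphs. On at least three vertices, the
  absence of every separation therefore means 2-connectedness.\<close>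

definition separates :: "('a \<Rightarrow> 'a \<Rightarrow> bool) \<Rightarrow> 'a set \<Rightarrow> 'a \<Rightarrow> 'a set \<Rightarrow> 'a set \<Rightarrow> bool" where
  "separates E V c A B \<longleftrightarrow> A \<noteq> {} \<and> B \<noteq> {} \<and> A \<inter> B = {} \<and> c \<notin> A \<and> c \<notin> B \<and>
     V = insert c (A \<union> B) \<and> (\<forall>x\<in>A. \<forall>y\<in>B. \<not> E x y)"

lemma is_cycle_rotate:
  assumes "is_cycle E (xs @ ys)"
  shows "is_cycle E (ys @ xs)"
proof (cases "xs = [] \<or> ys = []")
  case True
  then show ?thesis
    using assms by auto
next
  case False
  then show ?thesis
    using assms by (auto simp: is_cycle_def successively_append_iff)
qed

lemma is_cycle_close: "is_cycle E (x # xs) \<Longrightarrow> successively E ((x # xs) @ [x])"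
  unfolding is_cycle_def successively_append_iff by simp

lemma is_cycle_rotate_to:
  assumes "is_cycle E xs" "a \<in> set xs"
  obtains ys where "is_cycle E (a # ys)" "set (a # ys) = set xs" "length (a # ys) = length xs"
proof -
  obtain us vs where xs: "xs = us @ a # vs"
    using split_list[OF assms(2)] by blast
  then have "is_cycle E (a # vs @ us)"
    using is_cycle_rotate[of E us "a # vs"] assms(1) by simp
  then show thesis
    by (rule that) (auto simp: xs)
qed

text \<open>One more step either adds a new vertex or returns to a vertex of the path, which is then
  cut back to it, so distinctness survives.\<close>

lemma path_exists:
  assumes "(x, y) \<in> {(u, v). u \<in> R \<and> v \<in> R \<and> E u v}\<^sup>*" "x \<in> R"
  obtains xs where "xs \<noteq> []" "hd xs = x" "last xs = y" "distinct xs" "set xs \<subseteq> R" "successively E xs"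
proof -
  have "\<exists>xs. xs \<noteq> [] \<and> hd xs = x \<and> last xs = y \<and> distinct xs \<and> set xs \<subseteq> R \<and> successively E xs"
    using assms(1)
  proof (induction rule: rtrancl_induct)
    case base
    show ?case
      by (rule exI[of _ "[x]"]) (use assms(2) in auto)
  next
    case (step y z)
    then obtain xs where xs: "xs \<noteq> []" "hd xs = x" "last xs = y" "distinct xs" "set xs \<subseteq> R" "successively E xs"
      by blast
    show ?case
    proof (cases "z \<in> set xs")
      case False
      then show ?thesis
        using xs step by (intro exI[of _ "xs @ [z]"]) (auto simp: successively_append_iff)
    next
      case True
      then obtain us vs where us: "xs = us @ z # vs"
        using split_list by metis
      then have "successively E (us @ [z])"
        using xs(6) successively_append_iff[of E "us @ [z]" vs] by simp
      then show ?thesis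
        using xs us by (intro exI[of _ "us @ [z]"]) (cases us; auto)
    qed
  qed
  then show thesis
    using that by blast
qed

text \<open>All neighbours of the first vertex \<open>x\<close> of a longest path lie on that path.
  If \<open>x\<close> had no neighbour except the second vertex, that vertex would separate
  \<open>x\<close> from the rest; any other neighbour closes a cycle.\<close>

lemma cycle_exists:
  assumes fin: "finite V" and V: "3 \<le> card V"
    and nosep: "\<And>c A B. \<not> separates E V c A B" and sym: "\<And>x y. E x y \<Longrightarrow> E y x"
    and irrefl: "\<And>x. \<not> E x x"
  obtains xs where "is_cycle E xs" "set xs \<subseteq> V"
proof -
  let ?P = "\<lambda>xs. distinct xs \<and> set xs \<subseteq> V \<and> successively E xs \<and> xs \<noteq> []"
  have "V \<noteq> {}"
    using V by auto
  then obtain v0 where "?P [v0]"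
    by auto
  moreover have "length xs < Suc (card V)" if "?P xs" for xs
    using that fin card_mono[of V "set xs"] by (auto simp: distinct_card le_imp_less_Suc)
  ultimately obtain xs where xs: "?P xs" and max: "\<And>ys. ?P ys \<Longrightarrow> length ys \<le> length xs"
    using ex_has_greatest_nat[of ?P "[v0]" length "Suc (card V)"] by blast
  obtain x rest where x: "xs = x # rest"
    using xs by (cases xs) auto
  have nbr: "y \<in> set rest" if "E x y" "y \<in> V" for y
  proof (rule ccontr)
    assume "y \<notin> set rest"
    then have "?P (y # xs)"
      using that xs x irrefl sym by (auto simp: successively_Cons)
    then show False
      using max[of "y # xs"] by simp
  qed
  have xV: "x \<in> V"
    using xs x by auto
  have "\<not> V \<subseteq> {x}"
    using V card_mono[of "{x}" V] by auto
  then obtain c0 where c0: "c0 \<in> V" "c0 \<noteq> x"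
    by blast
  \<comment> \<open>For a path with a single vertex, any other vertex takes the role of the
    separating one.\<close>
  define c where "c = (if rest = [] then c0 else hd rest)"
  have c: "c \<in> V" "c \<noteq> x"
    using c0 xs x unfolding c_def by (cases rest; auto)+
  have "\<exists>y. E x y \<and> y \<in> V \<and> y \<noteq> c"
  proof (rule ccontr)
    assume neg: "\<not> (\<exists>y. E x y \<and> y \<in> V \<and> y \<noteq> c)"
    have "card {x, c} < card V"
      using V c by simp
    then have "\<not> V \<subseteq> {x, c}"
      using card_mono[of "{x, c}" V] by auto
    then have "V - {x, c} \<noteq> {}"
      by blast
    moreover have "\<not> E x z" if "z \<in> V - {x, c}" for z
      using neg that by blast
    ultimately have "separates E V c {x} (V - {x, c})"
      unfolding separates_def using c xV by blast
    then show False
      using nosep by blast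
  qed
  then obtain y where y: "E x y" "y \<in> V" "y \<noteq> c"
    by blast
  then have "y \<in> set rest"
    using nbr by blast
  then obtain us vs where rest: "rest = us @ y # vs"
    using split_list by metis
  have "us \<noteq> []"
    using y(3) rest by (auto simp: c_def)
  then have "1 \<le> length us"
    by (cases us) auto
  moreover have "successively E (x # us @ [y])" "distinct (x # us @ [y])"
    using xs x rest successively_append_iff[of E "x # us @ [y]" vs] by auto
  ultimately have "is_cycle E (x # us @ [y])"
    using sym[OF y(1)] by (simp add: is_cycle_def)
  moreover have "set (x # us @ [y]) \<subseteq> V"
    using xs x rest by auto
  ultimately show thesis
    by (rule that)
qed

text \<open>Suppose a longest cycle misses \<open>w\<close>. The component of \<open>w\<close> off
  the cycle has neighbours at two different cycle vertices, as otherwise one vertex would separate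
  it. The ear through the component between these two vertices lengthens the cycle if they are
  consecutive, and otherwise forms a theta with the two arcs of the cycle.\<close>

lemma hamiltonian_cycle:
  assumes fin: "finite V" and V: "3 \<le> card V"
    and nosep: "\<And>c A B. \<not> separates E V c A B" and sym: "\<And>x y. E x y \<Longrightarrow> E y x"
    and irrefl: "\<And>x. \<not> E x x" and theta: "theta_free E V"
  obtains xs where "is_cycle E xs" "set xs = V"
proof -
  let ?P = "\<lambda>xs. is_cycle E xs \<and> set xs \<subseteq> V"
  obtain xs0 where "?P xs0"
    using cycle_exists[OF fin V nosep sym irrefl] by metis
  moreover have "length xs < Suc (card V)" if "?P xs" for xs
    using that fin card_mono[of V "set xs"] by (auto simp: is_cycle_def distinct_card le_imp_less_Suc)
  ultimately obtain cs where cs: "?P cs" and max: "\<And>ys. ?P ys \<Longrightarrow> length ys \<le> length cs"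
    using ex_has_greatest_nat[of ?P xs0 length "Suc (card V)"] by blast
  have "set cs = V"
  proof (rule ccontr)
    assume "set cs \<noteq> V"
    then obtain w where w: "w \<in> V" "w \<notin> set cs"
      using cs by blast
    define W where "W = V - set cs"
    define S where "S = {(u, v). u \<in> W \<and> v \<in> W \<and> E u v}"
    define R where "R = {v \<in> W. (w, v) \<in> S\<^sup>*}"
    have wR: "w \<in> R"
      using w by (auto simp: R_def W_def)
    have RW: "R \<subseteq> W"
      by (auto simp: R_def)
    have closed: "v \<in> R" if "u \<in> R" "E u v" "v \<in> W" for u v
    proof -
      have "(u, v) \<in> S"
        using that RW by (auto simp: S_def)
      then show ?thesis
        using that by (auto simp: R_def intro: rtrancl_into_rtrancl)
    qed
    have len: "3 \<le> length cs" and dcs: "distinct cs"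
      using cs by (auto simp: is_cycle_def)
    have "\<exists>b\<in>set cs. b \<noteq> a \<and> (\<exists>r\<in>R. E r b)" if a: "a \<in> set cs" for a
    proof (rule ccontr)
      assume neg: "\<not> ?thesis"
      have "card (set cs) = length cs"
        using dcs by (rule distinct_card)
      then have "\<not> set cs \<subseteq> {a}"
        using len card_mono[of "{a}" "set cs"] by auto
      then have "V - R - {a} \<noteq> {}"
        using cs RW by (auto simp: W_def)
      moreover have "\<not> E u v" if "u \<in> R" "v \<in> V - R - {a}" for u v
        using that neg closed[of u v] by (auto simp: W_def)
      ultimately have "separates E V a R (V - R - {a})"
        unfolding separates_def using wR RW a cs by (auto simp: W_def)
      then show False
        using nosep by blast
    qed
    note attach = this
    obtain a0 where "a0 \<in> set cs"
      using len by (cases cs) auto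
    then obtain a ra where a: "a \<in> set cs" "ra \<in> R" "E ra a"
      using attach by blast
    then obtain b rb where b: "b \<in> set cs" "b \<noteq> a" "rb \<in> R" "E rb b"
      using attach by blast
    have "(ra, w) \<in> S\<^sup>*"
    proof -
      have "sym S"
        using sym by (auto simp: S_def intro: symI)
      then show ?thesis
        using a(2) by (auto simp: R_def dest: symD[OF sym_rtrancl])
    qed
    then have "(ra, rb) \<in> S\<^sup>*"
      using b(3) by (auto simp: R_def)
    then obtain ws where ws: "ws \<noteq> []" "hd ws = ra" "last ws = rb" "distinct ws" "set ws \<subseteq> W" "successively E ws"
      using path_exists[of ra rb W E] a(2) RW unfolding S_def by blast
    obtain cs' where cs': "is_cycle E (a # cs')" "set (a # cs') = set cs" "length (a # cs') = length cs"
      using is_cycle_rotate_to[of E cs a] cs a(1) by blast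
    have "b \<in> set cs'"
      using b cs'(2) by auto
    then obtain L M where LM: "cs' = L @ b # M"
      using split_list by metis
    have disj: "set ws \<inter> set (a # cs') = {}"
      using ws(5) cs'(2) by (auto simp: W_def)
    have dist: "distinct (a # L @ b # M @ ws)"
      using cs'(1) ws(4) disj LM by (auto simp: is_cycle_def)
    have sub: "set (a # L @ b # M @ ws) \<subseteq> V"
      using cs'(2) cs ws(5) LM by (auto simp: W_def)
    have succ: "successively E (a # L @ b # M)" "E (last (a # L @ b # M)) a"
      using cs'(1) LM by (auto simp: is_cycle_def)
    have lenLM: "length cs = 2 + length L + length M"
      using cs'(3) LM by simp
    have ear: "successively E (a # ws @ [b])"
      using ws a b sym by (auto simp: successively_append_iff successively_Cons)
    have ear': "successively E (b # rev ws @ [a])"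
    proof -
      have "successively (\<lambda>x y. E y x) (a # ws @ [b])"
        using ear sym by (metis (mono_tags, lifting) successively_mono)
      then have "successively E (rev (a # ws @ [b]))"
        by (simp only: successively_rev)
      moreover have "rev (a # ws @ [b]) = b # rev ws @ [a]"
        by simp
      ultimately show ?thesis
        by (simp only:)
    qed
    have wslen: "1 \<le> length ws"
      using ws(1) by (cases ws) auto
    show False
    \<comment> \<open>\<open>L\<close> and \<open>M\<close> are the inner vertices of the two arcs
      of the cycle between \<open>a\<close> and \<open>b\<close>; an arc without inner vertices can
      be replaced by the ear.\<close>
    proof (cases "L = []")
      case True
      have M: "M = [] \<or> E b (hd M)" "successively E M"
        using succ(1) True by (auto simp: successively_Cons)
      have "successively E ((a # ws @ [b]) @ M)"
        unfolding successively_append_iff[of E "a # ws @ [b]" M] using ear M by simp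
      then have "is_cycle E (a # ws @ b # M)"
        using succ(2) dist True wslen by (auto simp: is_cycle_def)
      moreover have "set (a # ws @ b # M) \<subseteq> V"
        using sub by auto
      ultimately show False
        using max[of "a # ws @ b # M"] lenLM True wslen by simp
    next
      case L: False
      show False
      proof (cases "M = []")
        case True
        have "is_cycle E ((a # L @ [b]) @ rev ws)"
          using ear' succ dist True L wslen
          by (auto simp: is_cycle_def successively_append_iff successively_Cons last_rev)
        moreover have "set ((a # L @ [b]) @ rev ws) \<subseteq> V"
          using sub by auto
        ultimately show False
          using max[of "(a # L @ [b]) @ rev ws"] lenLM True wslen by simp
      next
        case False
        have "successively E (b # M)" "E (last (b # M)) a"
          using succ successively_append_iff[of E "a # L" "b # M"] by simp_all
        then have "successively E ((b # M) @ [a])"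
          unfolding successively_append_iff[of E "b # M" "[a]"] by simp
        then have "successively (\<lambda>x y. E y x) (b # M @ [a])"
          using sym by (metis (mono_tags, lifting) append_Cons successively_mono)
        then have "successively E (rev (b # M @ [a]))"
          by (simp only: successively_rev)
        moreover have "rev (b # M @ [a]) = a # rev M @ [b]"
          by simp
        ultimately have "successively E (a # rev M @ [b])"
          by (simp only:)
        moreover have "successively E (a # L @ [b])"
          using succ(1) successively_append_iff[of E "a # L @ [b]" M] by simp
        moreover have "distinct (a # b # ws @ L @ rev M)" "set (a # b # ws @ L @ rev M) \<subseteq> V"
          using dist sub by auto
        ultimately show False
          using theta ear ws(1) L False unfolding theta_free_def by (metis rev_is_Nil_conv)
      qed
    qed
  qed
  then show thesis
    using cs that by blast
qed

text \<open>In the order along a Hamiltonian cycle, a violation of the non-crossing property is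
  exactly a pair of crossing chords of this cycle.\<close>

lemma noncrossing_cycle:
  assumes cyc: "is_cycle E xs" "set xs = V" and cross: "crossing_free E V"
  shows "\<exists>pos. noncrossing E V pos"
proof -
  have dist: "distinct xs"
    using cyc by (simp add: is_cycle_def)
  define pos where "pos = (\<lambda>x. THE i. i < length xs \<and> xs ! i = x)"
  have pos: "pos (xs ! i) = i" if "i < length xs" for i
    unfolding pos_def using that dist by (intro the_equality) (auto simp: nth_eq_iff_index_eq)
  have idx: "pos x < length xs \<and> xs ! pos x = x" if "x \<in> V" for x
    using that cyc(2) pos by (metis in_set_conv_nth)
  have "inj_on pos V"
    by (rule inj_onI) (metis idx)
  moreover have "\<not> (E a c \<and> E b d)"
    if q: "a \<in> V" "b \<in> V" "c \<in> V" "d \<in> V" "pos a < pos b" "pos b < pos c" "pos c < pos d" for a b c d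
  proof -
    have s1: "xs = take (pos a) xs @ a # drop (Suc (pos a)) xs"
      using idx[OF q(1)] id_take_nth_drop[of "pos a" xs] by simp
    have "\<exists>A D0. xs = D0 @ a # A @ b # drop (Suc (pos b)) xs"
    proof -
      have "xs = take (pos b) xs @ b # drop (Suc (pos b)) xs"
        using idx[OF q(2)] id_take_nth_drop[of "pos b" xs] by simp
      moreover have "take (pos b) xs = take (pos a) (take (pos b) xs) @ a # drop (Suc (pos a)) (take (pos b) xs)"
        using idx[OF q(1)] idx[OF q(2)] q(5) id_take_nth_drop[of "pos a" "take (pos b) xs"] by simp
      ultimately show ?thesis
        by (metis append_Cons append_assoc)
    qed
    then obtain A D0 where 1: "xs = D0 @ a # A @ b # drop (Suc (pos b)) xs"
      by blast
    let ?ys = "drop (Suc (pos b)) xs"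
    let ?c = "pos c - Suc (pos b)" and ?d = "pos d - Suc (pos b)"
    have c: "?c < length ?ys" "?ys ! ?c = c" and d: "?d < length ?ys" "?ys ! ?d = d" and cd: "?c < ?d"
      using idx[OF q(3)] idx[OF q(4)] idx[OF q(2)] q(6,7) by auto
    have 2: "?ys = take ?d ?ys @ d # drop (Suc ?d) ?ys"
      using id_take_nth_drop[OF d(1)] d(2) by simp
    have 3: "take ?d ?ys = take ?c (take ?d ?ys) @ c # drop (Suc ?c) (take ?d ?ys)"
      using id_take_nth_drop[of ?c "take ?d ?ys"] c d cd by simp
    obtain B C D where "?ys = B @ c # C @ d # D"
      using 2 3 by (metis append_Cons append_assoc)
    then have xs: "xs = D0 @ (a # A @ b # B @ c # C @ d # D)"
      using 1 by simp
    \<comment> \<open>Moving the part \<open>D0\<close> before \<open>a\<close> to the end makes the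
      cycle start at \<open>a\<close>, as \<open>crossing_free\<close> expects.\<close>
    have "is_cycle E ((a # A @ b # B @ c # C @ d # D) @ D0)"
      using cyc(1) is_cycle_rotate[of E D0] unfolding xs by blast
    then have cyc': "is_cycle E (a # (A @ b # B @ c # C @ d # (D @ D0)))"
      by (simp only: append_Cons append_assoc)
    then have "distinct (a # A @ b # B @ c # C @ d # (D @ D0))"
      unfolding is_cycle_def by blast
    moreover note is_cycle_close[OF cyc']
    moreover have "set (a # A @ b # B @ c # C @ d # (D @ D0)) \<subseteq> V"
      using cyc(2) unfolding xs by auto
    ultimately show ?thesis
      using cross[unfolded crossing_free_def, rule_format, of a A b B c C d "D @ D0"] by simp
  qed
  ultimately show ?thesis
    unfolding noncrossing_def by blast
qed

lemma noncrossing_small: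
  assumes "finite V" "card V \<le> 3"
  shows "\<exists>pos. noncrossing E V pos"
proof -
  obtain pos :: "'a \<Rightarrow> nat" where inj: "inj_on pos V"
    using finite_imp_inj_to_nat_seg[OF assms(1)] by blast
  have False if "a \<in> V" "b \<in> V" "c \<in> V" "d \<in> V" "pos a < pos b" "pos b < pos c" "pos c < pos d" for a b c d
  proof -
    have "card {a, b, c, d} \<le> card V"
      using assms(1) that by (intro card_mono) auto
    moreover have "card {a, b, c, d} = 4"
      using that by (auto simp: card_insert_if)
    ultimately show False
      using assms(2) by simp
  qed
  then show ?thesis
    using inj unfolding noncrossing_def by blast
qed

text \<open>Both conditions pass to subsets of \<open>V\<close>, so a separable set is glued from
  the orders of two smaller sets; an inseparable set with more than three vertices has a Hamiltonian
  cycle to order it by.\<close>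

theorem noncrossing_exists:
  assumes "finite V" "\<And>x y. E x y \<Longrightarrow> E y x" "\<And>x. \<not> E x x" "theta_free E V" "crossing_free E V"
  shows "\<exists>pos. noncrossing E V pos"
  using assms(1,4,5)
proof (induction "card V" arbitrary: V rule: less_induct)
  case less
  show ?case
  proof (cases "card V \<le> 3")
    case True
    then show ?thesis
      using noncrossing_small less.prems by blast
  next
    case big: False
    show ?thesis
    proof (cases "\<exists>c A B. separates E V c A B")
      case True
      then obtain c A B where sep: "A \<noteq> {}" "B \<noteq> {}" "A \<inter> B = {}" "c \<notin> A" "c \<notin> B"
        "V = insert c (A \<union> B)" "\<And>x y. x \<in> A \<Longrightarrow> y \<in> B \<Longrightarrow> \<not> E x y"
        unfolding separates_def by blast
      have sub: "\<exists>pos. noncrossing E W pos" if "W \<subset> V" for W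
      proof (rule less.hyps)
        show "card W < card V"
          using that less.prems(1) by (rule psubset_card_mono[rotated])
        show "finite W"
          using that less.prems(1) by (auto intro: finite_subset)
        show "theta_free E W"
          using less.prems(2) that unfolding theta_free_def by (meson psubset_imp_subset subset_trans)
        show "crossing_free E W"
          using less.prems(3) that unfolding crossing_free_def by (meson psubset_imp_subset subset_trans)
      qed
      have "insert c A \<subset> V" "insert c B \<subset> V"
        using sep(1-6) by auto
      then obtain pA pB where "noncrossing E (insert c A) pA" "noncrossing E (insert c B) pB"
        using sub by metis
      moreover have "finite A" "finite B"
        using less.prems(1) sep(6) by auto
      ultimately show ?thesis
        using noncrossing_glue[of E c A pA B pB] sep assms(2) by metis
    next
      case False
      then obtain xs where "is_cycle E xs" "set xs = V"
        using hamiltonian_cycle[of V E] less.prems big assms(2,3) by (metis le_cases)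
      then show ?thesis
        using noncrossing_cycle less.prems(3) by blast
    qed
  qed
qed

section \<open>Weighted counts\<close>

text \<open>The exponents are integers because forced vertices are measured by negative
  powers.\<close>

definition wp :: "int \<Rightarrow> real" where
  "wp k = sqrt 2 powi k"

lemma wp_pos [simp]: "0 < wp k"
  by (simp add: wp_def)

lemma wp_nonneg [simp]: "0 \<le> wp k"
  using less_imp_le wp_pos by blast

lemma wp_add: "wp (i + j) = wp i * wp j"
  by (simp add: wp_def power_int_add)

lemma wp_0 [simp]: "wp 0 = 1"
  by (simp add: wp_def)

lemma wp_minus: "wp (- k) = inverse (wp k)"
  by (simp add: wp_def power_int_minus)

lemma wp_mono: "i \<le> j \<Longrightarrow> wp i \<le> wp j"
  unfolding wp_def by (rule power_int_increasing) auto

lemma wp_numerals: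
  "wp 1 = sqrt 2" "wp 2 = 2" "wp 3 = 2 * sqrt 2" "wp 4 = 4" "wp 6 = 8"
  "wp (- 1) = sqrt 2 / 2" "wp (- 2) = 1 / 2"
proof -
  show 1: "wp 1 = sqrt 2"
    by (simp add: wp_def)
  show 2: "wp 2 = 2"
    by (simp add: wp_def)
  show "wp 3 = 2 * sqrt 2"
    using wp_add[of 2 1] 1 2 by simp
  show 4: "wp 4 = 4"
    using wp_add[of 2 2] 2 by simp
  show "wp 6 = 8"
    using wp_add[of 4 2] 2 4 by simp
  show "wp (- 1) = sqrt 2 / 2"
    using 1 by (simp add: wp_minus real_div_sqrt inverse_eq_divide field_simps)
  show "wp (- 2) = 1 / 2"
    using wp_minus[of 2] 2 by simp
qed

lemma sqrt_2_bounds: "1.4142 \<le> sqrt 2" "sqrt 2 \<le> (1.4143 :: real)"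
  by (rule real_le_rsqrt, simp add: power2_eq_square) (rule real_le_lsqrt, simp_all add: power2_eq_square)

text \<open>\<open>U\<close> stands for the complement of a 4-dominating set, \<open>e u\<close> for
  the neighbours of \<open>u\<close> that have been removed while lying outside \<open>U\<close>,
  and \<open>X\<close> for the vertices that earlier choices exclude from \<open>U\<close>.\<close>

definition restricted_family ::
    "('a \<Rightarrow> 'a \<Rightarrow> bool) \<Rightarrow> 'a set \<Rightarrow> ('a \<Rightarrow> int) \<Rightarrow> 'a set \<Rightarrow> 'a set set" where
  "restricted_family E A e X =
     {U. U \<subseteq> A - X \<and> (\<forall>u\<in>U. 4 \<le> e u + int (card {w \<in> A - U. E u w}))}"

definition indep_family :: "('a \<Rightarrow> 'a \<Rightarrow> bool) \<Rightarrow> 'a set \<Rightarrow> 'a set set" where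
  "indep_family E A = {I. I \<subseteq> A \<and> (\<forall>u\<in>I. \<forall>v\<in>I. \<not> E u v)}"

text \<open>With this normalisation, scaling both ends of an edge by r leaves the independent sets
  containing one end unchanged and multiplies those missing both by r^2. For constant weight 1 the
  sum over independent sets is their number.\<close>

definition weight :: "'a set \<Rightarrow> ('a \<Rightarrow> real) \<Rightarrow> 'a set \<Rightarrow> real" where
  "weight A l I = (\<Prod>x\<in>A. if x \<in> I then 1 / l x else l x)"

definition weighted_count :: "('a \<Rightarrow> 'a \<Rightarrow> bool) \<Rightarrow> 'a set \<Rightarrow> ('a \<Rightarrow> real) \<Rightarrow> real" where
  "weighted_count E A l = (\<Sum>I\<in>indep_family E A. weight A l I)"

abbreviation num_restricted ::
    "('a \<Rightarrow> 'a \<Rightarrow> bool) \<Rightarrow> 'a set \<Rightarrow> ('a \<Rightarrow> int) \<Rightarrow> 'a set \<Rightarrow> nat" where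
  "num_restricted E A e X \<equiv> card (restricted_family E A e X)"

text \<open>Along an edge \<open>a b\<close> the weighted count is the sum of this quantity and of
  \<open>weight_in\<close> at \<open>a\<close> and at \<open>b\<close>. These nonnegative numbers,
  called N, P and Z below, are the coordinates in which the bounds are compared coefficient by
  coefficient.\<close>

definition weight_out :: "('a \<Rightarrow> 'a \<Rightarrow> bool) \<Rightarrow> 'a set \<Rightarrow> ('a \<Rightarrow> real) \<Rightarrow> 'a \<Rightarrow> 'a \<Rightarrow> real" where
  "weight_out E A l a b = (\<Sum>I\<in>{I \<in> indep_family E A. a \<notin> I \<and> b \<notin> I}. weight A l I)"

definition weight_in :: "('a \<Rightarrow> 'a \<Rightarrow> bool) \<Rightarrow> 'a set \<Rightarrow> ('a \<Rightarrow> real) \<Rightarrow> 'a \<Rightarrow> real" where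
  "weight_in E A l a = (\<Sum>I\<in>{I \<in> indep_family E A. a \<in> I}. weight A l I)"

definition shift2 :: "('a \<Rightarrow> int) \<Rightarrow> 'a \<Rightarrow> int \<Rightarrow> 'a \<Rightarrow> int \<Rightarrow> 'a \<Rightarrow> int" where
  "shift2 e a i b j = (\<lambda>x. e x + (if x = a then i else 0) + (if x = b then j else 0))"

definition scale2 :: "('a \<Rightarrow> real) \<Rightarrow> 'a \<Rightarrow> real \<Rightarrow> 'a \<Rightarrow> real \<Rightarrow> 'a \<Rightarrow> real" where
  "scale2 l a r b s = (\<lambda>x. l x * (if x = a then r else 1) * (if x = b then s else 1))"

lemma weight_nonneg: "\<forall>x\<in>A. 0 < l x \<Longrightarrow> 0 \<le> weight A l I"
  unfolding weight_def by (rule prod_nonneg) (auto intro: less_imp_le)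

lemma weight_out_nonneg: "\<forall>x\<in>A. 0 < l x \<Longrightarrow> 0 \<le> weight_out E A l a b"
  unfolding weight_out_def by (simp add: sum_nonneg weight_nonneg)

lemma weight_in_nonneg: "\<forall>x\<in>A. 0 < l x \<Longrightarrow> 0 \<le> weight_in E A l a"
  unfolding weight_in_def by (simp add: sum_nonneg weight_nonneg)

lemma finite_indep_family: "finite A \<Longrightarrow> finite (indep_family E A)"
  unfolding indep_family_def by (rule finite_subset[of _ "Pow A"]) auto

lemma finite_restricted_family: "finite A \<Longrightarrow> finite (restricted_family E A e X)"
  unfolding restricted_family_def by (rule finite_subset[of _ "Pow A"]) auto

lemma sum_indep_split:
  assumes "finite A" "E a b"
  shows "(\<Sum>I\<in>indep_family E A. weight A l I *
           (if a \<in> I then ca else if b \<in> I then cb else cn)) =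
         cn * weight_out E A l a b + ca * weight_in E A l a + cb * weight_in E A l b"
proof -
  let ?F = "indep_family E A"
  let ?g = "\<lambda>I. weight A l I * (if a \<in> I then ca else if b \<in> I then cb else cn)"
  let ?O = "{I \<in> ?F. a \<notin> I \<and> b \<notin> I}" and ?A = "{I \<in> ?F. a \<in> I}" and ?B = "{I \<in> ?F. b \<in> I}"
  have fin: "finite ?F"
    by (rule finite_indep_family) fact
  have disj: "I \<in> ?F \<Longrightarrow> a \<in> I \<Longrightarrow> b \<in> I \<Longrightarrow> False" for I
    using assms(2) by (auto simp: indep_family_def)
  have "?F = ?O \<union> ?A \<union> ?B"
    by auto
  then have "sum ?g ?F = sum ?g (?O \<union> ?A \<union> ?B)"
    by simp
  also have "\<dots> = sum ?g (?O \<union> ?A) + sum ?g ?B"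
  proof (rule sum.union_disjoint)
    show "(?O \<union> ?A) \<inter> ?B = {}"
      using disj by blast
  qed (use fin in simp_all)
  also have "sum ?g (?O \<union> ?A) = sum ?g ?O + sum ?g ?A"
    by (rule sum.union_disjoint) (use fin in auto)
  also have "sum ?g ?O = cn * weight_out E A l a b"
    unfolding weight_out_def sum_distrib_left by (rule sum.cong) auto
  also have "sum ?g ?A = ca * weight_in E A l a"
    unfolding weight_in_def sum_distrib_left by (rule sum.cong) auto
  also have "sum ?g ?B = cb * weight_in E A l b"
    unfolding weight_in_def sum_distrib_left using disj by (intro sum.cong) auto
  finally show ?thesis .
qed

lemma weighted_count_split:
  assumes "finite A" "E a b"
  shows "weighted_count E A l = weight_out E A l a b + weight_in E A l a + weight_in E A l b"
  using sum_indep_split[where E = E and l = l and ca = 1 and cb = 1 and cn = 1, OF assms]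
  unfolding weighted_count_def if_cancel by simp

lemma weight_scale2:
  assumes "finite A" "a \<in> A" "b \<in> A"
  shows "weight A (scale2 l a r b s) I =
    weight A l I * ((if a \<in> I then 1 / r else r) * (if b \<in> I then 1 / s else s))"
proof -
  let ?s = "\<lambda>x k. if x \<in> I then 1 / k else k :: real"
  have "weight A (scale2 l a r b s) I =
      (\<Prod>x\<in>A. ?s x (l x) * (if x = a then ?s a r else 1) * (if x = b then ?s b s else 1))"
    unfolding weight_def scale2_def by (intro prod.cong) auto
  also have "\<dots> = weight A l I * ?s a r * ?s b s"
    using assms by (simp add: prod.distrib weight_def)
  finally show ?thesis
    by simp
qed

lemma weighted_count_scale2:
  assumes "finite A" "a \<in> A" "b \<in> A" "E a b"
  shows "weighted_count E A (scale2 l a r b s) =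
    r * s * weight_out E A l a b + s / r * weight_in E A l a + r / s * weight_in E A l b"
proof -
  have "weighted_count E A (scale2 l a r b s) =
      (\<Sum>I\<in>indep_family E A. weight A l I *
        (if a \<in> I then s / r else if b \<in> I then r / s else r * s))"
    unfolding weighted_count_def weight_scale2[OF assms(1-3)]
    using assms(4) by (intro sum.cong) (auto simp: indep_family_def)
  then show ?thesis
    using sum_indep_split[where E = E, OF assms(1,4)] by simp
qed

text \<open>Deleting \<open>a\<close> is injective on the independent sets containing
  \<open>a\<close>, leads to sets missing both \<open>a\<close> and its neighbour \<open>b\<close>,
  and multiplies the weight by the square of \<open>l a\<close>. A heavy end thus has a small share
  in the weighted count.\<close>

lemma weight_in_le_out:
  assumes "finite A" "a \<in> A" "b \<in> A" "E a b" "0 < k" "k \<le> l a" "\<forall>x\<in>A. 0 < l x"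
  shows "weight_in E A l a \<le> 1 / k\<^sup>2 * weight_out E A l a b"
proof -
  let ?A = "{I \<in> indep_family E A. a \<in> I}" and ?O = "{I \<in> indep_family E A. a \<notin> I \<and> b \<notin> I}"
  have *: "weight A l I \<le> 1 / k\<^sup>2 * weight A l (I - {a})" if "a \<in> I" for I
  proof -
    let ?r = "\<Prod>x\<in>A - {a}. if x \<in> I then 1 / l x else l x"
    have r: "(\<Prod>x\<in>A - {a}. if x \<in> I - {a} then 1 / l x else l x) = ?r"
      by (rule prod.cong) auto
    have "0 \<le> ?r"
      using assms(7) by (intro prod_nonneg) (auto intro: less_imp_le)
    have "k\<^sup>2 \<le> l a * l a"
      unfolding power2_eq_square using assms by (intro mult_mono) auto
    moreover have "0 < l a" "0 < k\<^sup>2"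
      using assms by auto
    ultimately have le: "1 / l a \<le> 1 / k\<^sup>2 * l a"
      by (simp add: pos_divide_le_eq pos_le_divide_eq)
    have "weight A l I = 1 / l a * ?r"
      unfolding weight_def using assms(1,2) that by (subst prod.remove[of _ a]) auto
    also have "\<dots> \<le> 1 / k\<^sup>2 * l a * ?r"
      using le \<open>0 \<le> ?r\<close> by (rule mult_right_mono)
    also have "\<dots> = 1 / k\<^sup>2 * weight A l (I - {a})"
      unfolding weight_def using assms(1,2) by (subst prod.remove[of A a]) (auto simp: r)
    finally show ?thesis .
  qed
  have "weight_in E A l a \<le> (\<Sum>I\<in>?A. 1 / k\<^sup>2 * weight A l (I - {a}))"
    unfolding weight_in_def by (rule sum_mono) (use * in auto)
  also have "\<dots> = (\<Sum>I\<in>(\<lambda>I. I - {a}) ` ?A. 1 / k\<^sup>2 * weight A l I)"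
  proof (rule sum.reindex_cong[symmetric, where l = "\<lambda>I. I - {a}"])
    show "inj_on (\<lambda>I. I - {a}) ?A"
      by (rule inj_onI) (metis (no_types, lifting) insert_Diff mem_Collect_eq)
  qed simp_all
  also have "\<dots> \<le> (\<Sum>I\<in>?O. 1 / k\<^sup>2 * weight A l I)"
  proof (rule sum_mono2)
    show "finite ?O"
      using finite_indep_family[OF assms(1)] by simp
    show "(\<lambda>I. I - {a}) ` ?A \<subseteq> ?O"
      using assms(4) by (auto simp: indep_family_def)
    show "0 \<le> 1 / k\<^sup>2 * weight A l I" for I
      using weight_nonneg[OF assms(7)] by simp
  qed
  finally show ?thesis
    by (simp add: weight_out_def sum_distrib_left)
qed

section \<open>Removing a vertex of degree two\<close>

text \<open>\<open>A\<close> is the vertex set that remains after the removal of \<open>v\<close>.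
  That \<open>a\<close> and \<open>b\<close> are adjacent is stated separately where it
  matters.\<close>

definition leaf_at :: "('a \<Rightarrow> 'a \<Rightarrow> bool) \<Rightarrow> 'a set \<Rightarrow> 'a \<Rightarrow> 'a \<Rightarrow> 'a \<Rightarrow> bool" where
  "leaf_at E A v a b \<longleftrightarrow> finite A \<and> v \<notin> A \<and> a \<in> A \<and> b \<in> A \<and> a \<noteq> b \<and> \<not> E v v \<and>
     (\<forall>x\<in>A. E v x \<longleftrightarrow> x = a \<or> x = b) \<and> (\<forall>x\<in>A. E x v \<longleftrightarrow> x = a \<or> x = b)"

lemma indep_family_leaf:
  assumes "leaf_at E A v a b"
  shows "indep_family E (insert v A) =
    indep_family E A \<union> insert v ` {I \<in> indep_family E A. a \<notin> I \<and> b \<notin> I}" (is "?L = ?R")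
proof
  show "?L \<subseteq> ?R"
  proof
    fix I assume I: "I \<in> ?L"
    show "I \<in> ?R"
    proof (cases "v \<in> I")
      case True
      then have "I = insert v (I - {v})"
        by auto
      moreover have "I - {v} \<in> {I \<in> indep_family E A. a \<notin> I \<and> b \<notin> I}"
        using I True assms by (auto simp: indep_family_def leaf_at_def)
      ultimately show ?thesis
        by blast
    next
      case False
      then show ?thesis
        using I by (auto simp: indep_family_def)
    qed
  qed
  show "?R \<subseteq> ?L"
  proof (intro Un_least image_subsetI subsetI)
    fix I assume "I \<in> indep_family E A"
    then show "I \<in> ?L"
      unfolding indep_family_def by blast
  next
    fix I assume I: "I \<in> {I \<in> indep_family E A. a \<notin> I \<and> b \<notin> I}"
    then have "I \<subseteq> A" and ind: "\<And>x y. x \<in> I \<Longrightarrow> y \<in> I \<Longrightarrow> \<not> E x y"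
      by (auto simp: indep_family_def)
    moreover have "\<not> E v v" and "\<And>x. x \<in> I \<Longrightarrow> \<not> E v x" "\<And>x. x \<in> I \<Longrightarrow> \<not> E x v"
      using I \<open>I \<subseteq> A\<close> assms by (auto simp: leaf_at_def)
    ultimately show "insert v I \<in> ?L"
      by (auto simp: indep_family_def)
  qed
qed

text \<open>A set containing \<open>v\<close> is a set of \<open>A\<close> missing both neighbours,
  enlarged by \<open>v\<close>. The arbitrary factor \<open>h\<close> allows the identity to be
  iterated when several vertices are removed in succession.\<close>

lemma sum_indep_leaf:
  assumes "leaf_at E A v a b"
  shows "(\<Sum>I\<in>indep_family E (insert v A). weight (insert v A) l I * h I) =
    (\<Sum>I\<in>indep_family E A. weight A l I *
       (l v * h I + (if a \<notin> I \<and> b \<notin> I then 1 / l v * h (insert v I) else 0)))"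
proof -
  let ?O = "{I \<in> indep_family E A. a \<notin> I \<and> b \<notin> I}"
  let ?g = "\<lambda>I. weight (insert v A) l I * h I"
  have A: "finite A" "v \<notin> A"
    using assms by (auto simp: leaf_at_def)
  have fin: "finite (indep_family E A)"
    by (rule finite_indep_family) fact
  have notin: "v \<notin> I" if "I \<in> indep_family E A" for I
    using that A(2) by (auto simp: indep_family_def)
  have "sum ?g (indep_family E (insert v A)) =
      sum ?g (indep_family E A) + sum ?g (insert v ` ?O)"
    unfolding indep_family_leaf[OF assms]
  proof (rule sum.union_disjoint)
    show "indep_family E A \<inter> insert v ` ?O = {}"
      using notin by blast
  qed (use fin in simp_all)
  also have "sum ?g (insert v ` ?O) = (\<Sum>I\<in>?O. ?g (insert v I))"
  proof (rule sum.reindex_cong[where l = "insert v"])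
    show "inj_on (insert v) ?O"
      by (rule inj_onI) (metis (no_types, lifting) insert_ident mem_Collect_eq notin)
  qed simp_all
  also have "\<dots> = (\<Sum>I\<in>?O. weight A l I * (1 / l v * h (insert v I)))"
  proof (rule sum.cong)
    fix I assume "I \<in> ?O"
    have "(\<Prod>x\<in>A. if x \<in> insert v I then 1 / l x else l x) = weight A l I"
      unfolding weight_def using A(2) by (intro prod.cong) auto
    then show "?g (insert v I) = weight A l I * (1 / l v * h (insert v I))"
      unfolding weight_def[of "insert v A"] using A by simp
  qed simp
  also have "\<dots> = (\<Sum>I\<in>indep_family E A. weight A l I *
      (if a \<notin> I \<and> b \<notin> I then 1 / l v * h (insert v I) else 0))"
    unfolding sum.inter_filter[OF fin] by (rule sum.cong) auto
  also have "sum ?g (indep_family E A) = (\<Sum>I\<in>indep_family E A. weight A l I * (l v * h I))"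
  proof (rule sum.cong)
    fix I assume "I \<in> indep_family E A"
    then show "?g I = weight A l I * (l v * h I)"
      using notin[of I] A by (simp add: weight_def)
  qed simp
  finally show ?thesis
    by (simp add: sum.distrib distrib_left)
qed

lemma weighted_count_leaf:
  assumes "leaf_at E A v a b" "E a b"
  shows "weighted_count E (insert v A) l =
    (l v + 1 / l v) * weight_out E A l a b + l v * weight_in E A l a + l v * weight_in E A l b"
proof -
  have "finite A"
    using assms by (simp add: leaf_at_def)
  have "weighted_count E (insert v A) l = (\<Sum>I\<in>indep_family E A. weight A l I *
      (l v * 1 + (if a \<notin> I \<and> b \<notin> I then 1 / l v * 1 else 0)))"
    unfolding weighted_count_def using sum_indep_leaf[OF assms(1), of l "\<lambda>_. 1"] by simp
  also have "\<dots> = (\<Sum>I\<in>indep_family E A. weight A l I *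
      (if a \<in> I then l v else if b \<in> I then l v else l v + 1 / l v))"
    by (rule sum.cong) auto
  finally have "weighted_count E (insert v A) l = \<dots>" .
  then show ?thesis
    using sum_indep_split[where E = E, OF \<open>finite A\<close> assms(2)] by simp
qed

definition leaf_used ::
    "('a \<Rightarrow> 'a \<Rightarrow> bool) \<Rightarrow> 'a set \<Rightarrow> ('a \<Rightarrow> int) \<Rightarrow> 'a set \<Rightarrow> 'a \<Rightarrow> 'a set set" where
  "leaf_used E A e X v = {U \<in> restricted_family E (insert v A) e X. v \<in> U}"

text \<open>If \<open>v\<close> is not in the set, it is an outside neighbour of \<open>a\<close>
  and of \<open>b\<close>; after its removal this is remembered by raising \<open>e\<close> at
  both.\<close>

lemma num_restricted_leaf:
  assumes "leaf_at E A v a b"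
  shows "num_restricted E (insert v A) e X \<le>
    num_restricted E A (shift2 e a 1 b 1) X + card (leaf_used E A e X v)"
proof -
  have A: "finite A" "v \<notin> A" "a \<noteq> b" "\<And>x. x \<in> A \<Longrightarrow> E x v \<longleftrightarrow> x = a \<or> x = b"
    using assms by (auto simp: leaf_at_def)
  have "restricted_family E (insert v A) e X \<subseteq>
      restricted_family E A (shift2 e a 1 b 1) X \<union> leaf_used E A e X v"
  proof
    fix U assume U: "U \<in> restricted_family E (insert v A) e X"
    show "U \<in> restricted_family E A (shift2 e a 1 b 1) X \<union> leaf_used E A e X v"
    proof (cases "v \<in> U")
      case True
      then show ?thesis
        using U by (simp add: leaf_used_def)
    next
      case False
      have "U \<subseteq> A - X"
        using U False by (auto simp: restricted_family_def)
      moreover have "4 \<le> shift2 e a 1 b 1 u + int (card {w \<in> A - U. E u w})" if "u \<in> U" for u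
      proof -
        have "u \<in> A"
          using \<open>U \<subseteq> A - X\<close> that by auto
        have "{w \<in> insert v A - U. E u w} =
            (if u = a \<or> u = b then insert v {w \<in> A - U. E u w} else {w \<in> A - U. E u w})"
          using A(4)[OF \<open>u \<in> A\<close>] False by auto
        then have "int (card {w \<in> insert v A - U. E u w}) =
            (if u = a \<or> u = b then 1 else 0) + int (card {w \<in> A - U. E u w})"
          using A(1,2) by simp
        moreover have "4 \<le> e u + int (card {w \<in> insert v A - U. E u w})"
          using U that by (auto simp: restricted_family_def)
        ultimately show ?thesis
          using A(3) by (auto simp: shift2_def split: if_splits)
      qed
      ultimately show ?thesis
        by (auto simp: restricted_family_def)
    qed
  qed
  then have "num_restricted E (insert v A) e X \<le>
      card (restricted_family E A (shift2 e a 1 b 1) X \<union> leaf_used E A e X v)"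
    using A(1) by (intro card_mono) (auto simp: finite_restricted_family leaf_used_def)
  also have "\<dots> \<le> num_restricted E A (shift2 e a 1 b 1) X + card (leaf_used E A e X v)"
    by (rule card_Un_le)
  finally show ?thesis .
qed

lemma leaf_used_props:
  assumes "leaf_at E A v a b" "U \<in> leaf_used E A e X v"
  shows "U - {v} \<in> restricted_family E A e X" "v \<notin> X"
    and "4 \<le> e v + int (card ({a, b} - U))"
proof -
  have A: "finite A" "v \<notin> A" "a \<noteq> b" "a \<in> A" "b \<in> A" "\<not> E v v"
    "\<And>x. x \<in> A \<Longrightarrow> E v x \<longleftrightarrow> x = a \<or> x = b"
    using assms(1) by (auto simp: leaf_at_def)
  have U: "v \<in> U" "U \<subseteq> insert v A - X"
    "\<And>u. u \<in> U \<Longrightarrow> 4 \<le> e u + int (card {w \<in> insert v A - U. E u w})"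
    using assms(2) unfolding leaf_used_def restricted_family_def by blast+
  have eq: "{w \<in> A - (U - {v}). E u w} = {w \<in> insert v A - U. E u w}" for u
    using U(1) A(2) by auto
  have "4 \<le> e u + int (card {w \<in> A - (U - {v}). E u w})" if "u \<in> U" for u
    unfolding eq using U(3)[OF that] .
  then show "U - {v} \<in> restricted_family E A e X"
    unfolding restricted_family_def using U(2) by auto
  show "v \<notin> X"
    using U by auto
  have "{w \<in> insert v A - U. E v w} = {a, b} - U"
    using A U(1) by auto
  then show "4 \<le> e v + int (card ({a, b} - U))"
    using U(3)[OF U(1)] by simp
qed

text \<open>A member of the set is nobody's outside neighbour, so deleting \<open>v\<close> keeps
  all conditions at the other members with the same \<open>e\<close>.\<close>

lemma card_leaf_used_le:
  assumes "leaf_at E A v a b"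
  shows "card (leaf_used E A e X v) \<le> num_restricted E A e X"
proof (rule card_inj_on_le[where f = "\<lambda>U. U - {v}"])
  show "inj_on (\<lambda>U. U - {v}) (leaf_used E A e X v)"
    by (auto simp: inj_on_def leaf_used_def)
  show "(\<lambda>U. U - {v}) ` leaf_used E A e X v \<subseteq> restricted_family E A e X"
    using leaf_used_props[OF assms] by auto
  show "finite (restricted_family E A e X)"
    using assms by (simp add: leaf_at_def finite_restricted_family)
qed

text \<open>Two neighbours and \<open>e v\<close> at most 1 cannot add up to four.\<close>

lemma card_leaf_used_eq_0:
  assumes "leaf_at E A v a b" "v \<in> X \<or> e v \<le> 1"
  shows "card (leaf_used E A e X v) = 0"
proof -
  have "U \<notin> leaf_used E A e X v" for U
  proof
    assume U: "U \<in> leaf_used E A e X v"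
    have "card ({a, b} - U) \<le> card {a, b}"
      by (rule card_mono) auto
    also have "\<dots> \<le> 2"
      by (simp add: card_insert_if)
    finally show False
      using leaf_used_props(2,3)[OF assms(1) U] assms(2) by linarith
  qed
  then have "leaf_used E A e X v = {}"
    by blast
  then show ?thesis
    by simp
qed

text \<open>With \<open>e v\<close> at most 2, both neighbours of a used \<open>v\<close> have to be
  outside the set, so they can be recorded as forced.\<close>

lemma card_leaf_used_le_forced:
  assumes "leaf_at E A v a b" "e v \<le> 2"
  shows "card (leaf_used E A e X v) \<le> num_restricted E A e (X \<union> {a, b})"
proof (rule card_inj_on_le[where f = "\<lambda>U. U - {v}"])
  show "inj_on (\<lambda>U. U - {v}) (leaf_used E A e X v)"
    by (auto simp: inj_on_def leaf_used_def)
  show "finite (restricted_family E A e (X \<union> {a, b}))"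
    using assms by (simp add: leaf_at_def finite_restricted_family)
  show "(\<lambda>U. U - {v}) ` leaf_used E A e X v \<subseteq> restricted_family E A e (X \<union> {a, b})"
  proof (rule image_subsetI)
    fix U assume U: "U \<in> leaf_used E A e X v"
    have "2 \<le> card ({a, b} - U)"
      using leaf_used_props(3)[OF assms(1) U] assms(2) by simp
    moreover have "card {a, b} \<le> 2"
      by (simp add: card_insert_if)
    ultimately have "{a, b} - U = {a, b}"
      using card_mono[of "{a, b}" "{a, b} - U"] by (intro card_subset_eq) auto
    then show "U - {v} \<in> restricted_family E A e (X \<union> {a, b})"
      using leaf_used_props(1)[OF assms(1) U] by (auto simp: restricted_family_def)
  qed
qed

section \<open>Leaf elimination in a triangulated polygon\<close>

text \<open>These are the clauses of \<open>triangulates\<close> about the triangles alone, on the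
  interval from 0 to \<open>m\<close>; the covered edges enter again only when the graph is compared
  with \<open>adj\<close>.\<close>

locale triangulation =
  fixes m :: nat and lo hi :: "nat \<Rightarrow> nat"
  assumes m_pos: "0 < m"
    and lo_less: "0 < x \<Longrightarrow> x < m \<Longrightarrow> lo x < x"
    and hi_gt: "0 < x \<Longrightarrow> x < m \<Longrightarrow> x < hi x"
    and hi_le: "0 < x \<Longrightarrow> x < m \<Longrightarrow> hi x \<le> m"
    and base_edge: "0 < x \<Longrightarrow> x < m \<Longrightarrow>
      lo x = 0 \<and> hi x = m \<or> 0 < lo x \<and> hi (lo x) = hi x \<or> hi x < m \<and> lo (hi x) = lo x"
    and base_inj: "0 < x \<Longrightarrow> x < m \<Longrightarrow> 0 < y \<Longrightarrow> y < m \<Longrightarrow> lo x = lo y \<Longrightarrow> hi x = hi y \<Longrightarrow> x = y"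
begin

text \<open>Edges are oriented from an apex to the ends of its base. The root edge is oriented from
  0 to \<open>m\<close>, so that of any two adjacent vertices one is a child of the other and can
  give it credit.\<close>

definition child :: "nat \<Rightarrow> nat \<Rightarrow> bool" where
  "child c y \<longleftrightarrow> 0 < c \<and> c < m \<and> (y = lo c \<or> y = hi c) \<or> c = 0 \<and> y = m"

definition adj :: "nat \<Rightarrow> nat \<Rightarrow> bool" where
  "adj x y \<longleftrightarrow> child x y \<or> child y x"

definition closed_set :: "nat set \<Rightarrow> bool" where
  "closed_set A \<longleftrightarrow> A \<subseteq> {0..m} \<and> 0 \<in> A \<and> m \<in> A \<and>
     (\<forall>x\<in>A. 0 < x \<and> x < m \<longrightarrow> lo x \<in> A \<and> hi x \<in> A)"

definition credit :: "nat set \<Rightarrow> nat set \<Rightarrow> nat \<Rightarrow> int" where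
  "credit A X y = int (card {c \<in> A \<inter> X. child c y})"

text \<open>An unforced vertex carries a factor \<open>sqrt 2\<close> for every unit of
  \<open>e\<close>; a forced one may drop below 1 by a factor \<open>sqrt 2\<close> for every forced
  child. The witness \<open>t\<close> guarantees that a leaf with positive \<open>e\<close> has a
  neighbour that is forced or clearly heavier than 1. For leaves with \<open>e\<close> at least 3
  this saves one of two scalings by 7/6, and for pairs of leaves it limits the share of the sets
  containing a neighbour.\<close>

definition admissible :: "nat set \<Rightarrow> (nat \<Rightarrow> int) \<Rightarrow> (nat \<Rightarrow> real) \<Rightarrow> nat set \<Rightarrow> bool" where
  "admissible A e l X \<longleftrightarrow>
     (\<forall>y\<in>A - X. 0 \<le> e y \<and> wp (e y) \<le> l y \<and>
        (1 \<le> e y \<longrightarrow> (\<exists>t\<in>A. adj y t \<and> (t \<in> X \<or> 7 / 6 \<le> l t)))) \<and>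
     (\<forall>y\<in>A \<inter> X. wp (- credit A X y) \<le> l y)"

definition bounded_by_weight :: "nat set \<Rightarrow> bool" where
  "bounded_by_weight A \<longleftrightarrow>
     (\<forall>e l X. admissible A e l X \<longrightarrow> 2 * real (num_restricted adj A e X) \<le> weighted_count adj A l)"

lemma adj_sym: "adj x y \<Longrightarrow> adj y x"
  by (auto simp: adj_def)

lemma child_neq: "child c y \<Longrightarrow> c \<noteq> y"
  using m_pos lo_less[of c] hi_gt[of c] by (auto simp: child_def)

lemma adj_neq: "adj x y \<Longrightarrow> x \<noteq> y"
  using child_neq by (auto simp: adj_def)

lemma adj_lo_hi:
  assumes "0 < x" "x < m"
  shows "adj (lo x) (hi x)"
  using base_edge[OF assms] lo_less[OF assms] hi_gt[OF assms] assms
  by (auto simp: adj_def child_def)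

lemma closed_finite: "closed_set A \<Longrightarrow> finite A"
  by (auto simp: closed_set_def intro: finite_subset)

lemma credit_mono:
  assumes "finite A'" "\<And>c. c \<in> A \<Longrightarrow> c \<in> X \<Longrightarrow> child c y \<Longrightarrow> c \<in> A' \<and> c \<in> X'"
  shows "credit A X y \<le> credit A' X' y"
  unfolding credit_def of_nat_le_iff using assms by (intro card_mono) auto

lemma credit_mono_insert:
  assumes "finite A'" "\<And>c. c \<in> A \<Longrightarrow> c \<in> X \<Longrightarrow> child c y \<Longrightarrow> c \<in> A' \<and> c \<in> X'"
    and "d \<in> A'" "d \<in> X'" "d \<notin> X" "child d y"
  shows "credit A X y + 1 \<le> credit A' X' y"
proof -
  have fin: "finite {c \<in> A \<inter> X. child c y}"
    by (rule finite_subset[of _ A']) (use assms in auto)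
  have "card (insert d {c \<in> A \<inter> X. child c y}) \<le> card {c \<in> A' \<inter> X'. child c y}"
    using assms by (intro card_mono) auto
  then show ?thesis
    using fin assms(5) by (simp add: credit_def)
qed

lemma credit_insert_le:
  assumes "finite A"
  shows "credit (insert v A) X y \<le> credit A X y + 1"
proof -
  have "card {c \<in> insert v A \<inter> X. child c y} \<le> card (insert v {c \<in> A \<inter> X. child c y})"
    using assms by (intro card_mono) auto
  also have "\<dots> \<le> Suc (card {c \<in> A \<inter> X. child c y})"
    by (rule card_insert_le_m1) auto
  finally show ?thesis
    by (simp add: credit_def)
qed

lemma admissible_pos:
  assumes "admissible A e l X" "y \<in> A"
  shows "0 < l y"
proof (cases "y \<in> X")
  case True
  then have "wp (- credit A X y) \<le> l y"
    using assms by (auto simp: admissible_def)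
  then show ?thesis
    using wp_pos[of "- credit A X y"] by linarith
next
  case False
  then have "wp (e y) \<le> l y"
    using assms by (auto simp: admissible_def)
  then show ?thesis
    using wp_pos[of "e y"] by linarith
qed

lemma admissible_unforced:
  assumes "admissible A e l X" "y \<in> A" "y \<notin> X"
  shows "0 \<le> e y" "wp (e y) \<le> l y" "1 \<le> l y"
proof -
  show "0 \<le> e y" "wp (e y) \<le> l y"
    using assms by (auto simp: admissible_def)
  then show "1 \<le> l y"
    using wp_mono[of 0 "e y"] by simp
qed

lemma admissible_forced:
  "admissible A e l X \<Longrightarrow> y \<in> A \<Longrightarrow> y \<in> X \<Longrightarrow> wp (- credit A X y) \<le> l y"
  by (auto simp: admissible_def)

text \<open>Vertices other than \<open>a\<close> and \<open>b\<close> lose no neighbour and keep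
  \<open>e\<close>, weight and status, hence also their witness and their credit. The ends of the
  edge \<open>a b\<close>, each forced or of weight at least 7/6, serve as witnesses for each
  other.\<close>

lemma admissible_restrict:
  assumes adm: "admissible A e l X" and A': "A' \<subseteq> A" "finite A'"
    and ab: "a \<in> A'" "b \<in> A'" "adj a b"
    and near: "\<And>y r. y \<in> A' \<Longrightarrow> r \<in> A \<Longrightarrow> r \<notin> A' \<Longrightarrow> adj y r \<Longrightarrow> y = a \<or> y = b"
    and X': "\<And>y. y \<in> A' \<Longrightarrow> y \<in> X \<Longrightarrow> y \<in> X'" "\<And>y. y \<in> A' \<Longrightarrow> y \<in> X' \<Longrightarrow> y \<in> X \<or> y = a \<or> y = b"
    and e': "\<And>y. y \<in> A' \<Longrightarrow> y \<noteq> a \<Longrightarrow> y \<noteq> b \<Longrightarrow> e' y = e y"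
    and l': "\<And>y. y \<in> A' \<Longrightarrow> y \<noteq> a \<Longrightarrow> y \<noteq> b \<Longrightarrow> l' y = l y"
    and a: "a \<in> X' \<Longrightarrow> wp (- credit A' X' a) \<le> l' a"
      "a \<notin> X' \<Longrightarrow> 0 \<le> e' a \<and> wp (e' a) \<le> l' a \<and> 7 / 6 \<le> l' a"
    and b: "b \<in> X' \<Longrightarrow> wp (- credit A' X' b) \<le> l' b"
      "b \<notin> X' \<Longrightarrow> 0 \<le> e' b \<and> wp (e' b) \<le> l' b \<and> 7 / 6 \<le> l' b"
  shows "admissible A' e' l' X'"
  unfolding admissible_def
proof (intro conjI ballI)
  fix y assume y: "y \<in> A' - X'"
  show "0 \<le> e' y" "wp (e' y) \<le> l' y"
    using adm A' X'(1)[of y] y e'[of y] l'[of y] a(2) b(2)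
    by (cases "y = a \<or> y = b"; auto simp: admissible_def)+
  show "1 \<le> e' y \<longrightarrow> (\<exists>t\<in>A'. adj y t \<and> (t \<in> X' \<or> 7 / 6 \<le> l' t))"
  proof (intro impI)
    assume 1: "1 \<le> e' y"
    consider "y = a" | "y = b" | "y \<noteq> a" "y \<noteq> b"
      by blast
    then show "\<exists>t\<in>A'. adj y t \<and> (t \<in> X' \<or> 7 / 6 \<le> l' t)"
    proof cases
      case 1
      then show ?thesis
        using b(2) ab by blast
    next
      case 2
      then show ?thesis
        using a(2) ab adj_sym by blast
    next
      case 3
      then have "y \<in> A - X" "e' y = e y"
        using y A' X' e' by auto
      then obtain t where t: "t \<in> A" "adj y t" "t \<in> X \<or> 7 / 6 \<le> l t"
        using adm 1 by (auto simp: admissible_def)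
      have "t \<in> A'"
        using near[of y t] t 3 y by auto
      moreover have "t \<in> X' \<or> 7 / 6 \<le> l' t"
        using a(2) b(2) l'[of t] X'(1)[of t] t(3) \<open>t \<in> A'\<close> by (cases "t = a \<or> t = b") auto
      ultimately show ?thesis
        using t(2) by blast
    qed
  qed
next
  fix y assume y: "y \<in> A' \<inter> X'"
  show "wp (- credit A' X' y) \<le> l' y"
  proof (cases "y = a \<or> y = b")
    case True
    then show ?thesis
      using a(1) b(1) y by auto
  next
    case False
    then have "y \<in> A \<inter> X" "l' y = l y"
      using y A' X' l' by auto
    then have "wp (- credit A X y) \<le> l' y"
      using adm by (auto simp: admissible_def)
    moreover have "credit A X y \<le> credit A' X' y"
    proof (rule credit_mono)
      fix c assume c: "c \<in> A" "c \<in> X" "child c y"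
      then have "c \<in> A'"
        using near[of y c] False y by (auto simp: adj_def)
      then show "c \<in> A' \<and> c \<in> X'"
        using X'(1) c by auto
    qed fact
    then have "wp (- credit A' X' y) \<le> wp (- credit A X y)"
      by (intro wp_mono) auto
    ultimately show ?thesis
      by linarith
  qed
qed

text \<open>This is the form in which the induction hypothesis is used: it is applied to
  \<open>A'\<close> with the weights of \<open>a\<close> and \<open>b\<close> multiplied by
  \<open>r\<close> and \<open>s\<close>, and the result is expressed in the unscaled
  weights.\<close>

lemma bound_restrict:
  assumes B: "bounded_by_weight A'"
    and adm: "admissible A e l X" and A': "A' \<subseteq> A" "finite A'"
    and ab: "a \<in> A'" "b \<in> A'" "adj a b"
    and near: "\<And>y r. y \<in> A' \<Longrightarrow> r \<in> A \<Longrightarrow> r \<notin> A' \<Longrightarrow> adj y r \<Longrightarrow> y = a \<or> y = b"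
    and X': "\<And>y. y \<in> A' \<Longrightarrow> y \<in> X \<Longrightarrow> y \<in> X'" "\<And>y. y \<in> A' \<Longrightarrow> y \<in> X' \<Longrightarrow> y \<in> X \<or> y = a \<or> y = b"
    and e': "\<And>y. y \<in> A' \<Longrightarrow> y \<noteq> a \<Longrightarrow> y \<noteq> b \<Longrightarrow> e' y = e y"
    and a: "a \<in> X' \<Longrightarrow> wp (- credit A' X' a) \<le> l a * r"
      "a \<notin> X' \<Longrightarrow> 0 \<le> e' a \<and> wp (e' a) \<le> l a * r \<and> 7 / 6 \<le> l a * r"
    and b: "b \<in> X' \<Longrightarrow> wp (- credit A' X' b) \<le> l b * s"
      "b \<notin> X' \<Longrightarrow> 0 \<le> e' b \<and> wp (e' b) \<le> l b * s \<and> 7 / 6 \<le> l b * s"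
  shows "2 * real (num_restricted adj A' e' X') \<le>
    r * s * weight_out adj A' l a b + s / r * weight_in adj A' l a + r / s * weight_in adj A' l b"
proof -
  have neq: "a \<noteq> b"
    using ab adj_neq by blast
  have "admissible A' e' (scale2 l a r b s) X'"
    by (rule admissible_restrict[OF adm A' ab near X' e'])
      (use a b neq in \<open>auto simp: scale2_def\<close>)
  then have "2 * real (num_restricted adj A' e' X') \<le> weighted_count adj A' (scale2 l a r b s)"
    using B by (auto simp: bounded_by_weight_def)
  then show ?thesis
    using weighted_count_scale2[where E = adj, OF A'(2) ab(1,2) ab(3)] by simp
qed

lemma leaf_facts:
  assumes A: "closed_set A" and v: "v \<in> A" "0 < v" "v < m" and leaf: "\<forall>c\<in>A. \<not> child c v"
  shows "closed_set (A - {v})" "leaf_at adj (A - {v}) v (lo v) (hi v)"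
proof -
  have "lo x \<noteq> v \<and> hi x \<noteq> v" if "x \<in> A" "0 < x" "x < m" for x
    using leaf that unfolding child_def by blast
  then show "closed_set (A - {v})"
    using A v unfolding closed_set_def by blast
  have child: "child v x \<longleftrightarrow> x = lo v \<or> x = hi v" for x
    using v by (auto simp: child_def)
  have "adj v x \<longleftrightarrow> x = lo v \<or> x = hi v" "adj x v \<longleftrightarrow> x = lo v \<or> x = hi v" if "x \<in> A" for x
    using leaf that unfolding adj_def child by blast+
  moreover have "lo v \<in> A" "hi v \<in> A"
    using A v unfolding closed_set_def by blast+
  moreover have "lo v \<noteq> v" "hi v \<noteq> v" "lo v \<noteq> hi v"
    using lo_less[OF v(2,3)] hi_gt[OF v(2,3)] by auto
  moreover have "finite (A - {v})" "\<not> adj v v"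
    using closed_finite[OF A] adj_neq[of v v] by auto
  ultimately show "leaf_at adj (A - {v}) v (lo v) (hi v)"
    unfolding leaf_at_def by simp
qed

lemma leaf_near:
  assumes "leaf_at adj A' v a b" "y \<in> A'" "r \<in> insert v A'" "r \<notin> A'" "adj y r"
  shows "y = a \<or> y = b"
  using assms by (auto simp: leaf_at_def)

end

lemma three_term_mono:
  fixes N P Z :: real
  assumes "x \<le> cN * N + cP * P + cZ * Z" "0 \<le> N" "0 \<le> P" "0 \<le> Z" "cN \<le> dN" "cP \<le> dP" "cZ \<le> dZ"
  shows "x \<le> dN * N + dP * P + dZ * Z"
proof -
  have "cN * N + cP * P + cZ * Z \<le> dN * N + dP * P + dZ * Z"
    using assms by (intro add_mono mult_right_mono)
  then show ?thesis
    using assms(1) by linarith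
qed

lemma add_inverse_ge:
  fixes x :: real
  assumes "2 \<le> x"
  shows "5 / 2 \<le> x + 1 / x"
proof -
  have "0 \<le> (x - 2) * (x - 1 / 2)"
    using assms by (intro mult_nonneg_nonneg) auto
  also have "\<dots> = x * (x + 1 / x - 5 / 2)"
    using assms by (simp add: field_simps)
  finally show ?thesis
    using assms by (simp add: zero_le_mult_iff)
qed

lemma add_scaled_inverse_mono:
  fixes m m0 :: real
  assumes "0 \<le> d" "d \<le> c" "1 \<le> m0" "m0 \<le> m"
  shows "c * m0 + d / m0 \<le> c * m + d / m"
proof -
  have "d / m0 - d / m = d * (m - m0) / (m0 * m)"
    using assms by (simp add: field_simps)
  also have "\<dots> \<le> d * (m - m0) / 1"
    using assms mult_mono[of 1 m0 1 m] by (intro divide_left_mono mult_nonneg_nonneg) auto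
  also have "\<dots> \<le> c * (m - m0)"
    using assms by (simp add: mult_right_mono)
  finally show ?thesis
    by (simp add: algebra_simps)
qed

lemma wp_Suc: "wp (k + 1) = wp k * sqrt 2"
  by (simp add: wp_add wp_numerals)

lemma wp_le_1: "k \<le> 0 \<Longrightarrow> wp k \<le> 1"
  using wp_mono[of k 0] by simp

context triangulation
begin

lemma credit_nonneg [simp]: "0 \<le> credit A X y"
  by (simp add: credit_def)

lemma credit_drop:
  assumes "finite A'" "\<And>c. c \<in> A \<Longrightarrow> c \<in> X \<Longrightarrow> c \<in> A' \<or> c = d"
  shows "credit A X y \<le> credit A' X y + 1"
proof -
  have "credit A X y \<le> credit (insert d A') X y"
    using assms by (intro credit_mono) auto
  then show ?thesis
    using credit_insert_le[OF assms(1), of d X y] by linarith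
qed

text \<open>Losing one forced child costs at most one unit of credit, which the factor
  \<open>sqrt 2\<close> makes up for.\<close>

lemma forced_scale:
  assumes "admissible A e l X" "y \<in> A" "y \<in> X" "finite A'"
    and "\<And>c. c \<in> A \<Longrightarrow> c \<in> X \<Longrightarrow> c \<in> A' \<or> c = d" "\<And>c. c \<in> X \<Longrightarrow> c \<in> X'"
  shows "wp (- credit A' X' y) \<le> l y * sqrt 2"
proof -
  have "credit A X y \<le> credit A' X y + 1"
    using assms(4,5) by (rule credit_drop)
  moreover have "credit A' X y \<le> credit A' X' y"
    using assms by (intro credit_mono) auto
  ultimately have "wp (- credit A' X' y) \<le> wp (- credit A X y + 1)"
    by (intro wp_mono) auto
  also have "\<dots> \<le> l y * sqrt 2"
    unfolding wp_Suc using admissible_forced[OF assms(1-3)] by (intro mult_right_mono) auto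
  finally show ?thesis .
qed

lemma newly_forced_scale:
  assumes "admissible A e l X" "y \<in> A" "y \<notin> X" "1 \<le> l y * r"
  shows "wp (- credit A' X' y) \<le> l y * r"
proof -
  have "wp (- credit A' X' y) \<le> 1"
    by (rule wp_le_1) simp
  then show ?thesis
    using assms(4) by linarith
qed

lemma unforced_scale:
  assumes "admissible A e l X" "y \<in> A" "y \<notin> X"
  shows "0 \<le> e y + 1 \<and> wp (e y + 1) \<le> l y * sqrt 2 \<and> 7 / 6 \<le> l y * sqrt 2"
    and "0 \<le> e y + 2 \<and> wp (e y + 2) \<le> l y * 2 \<and> 7 / 6 \<le> l y * 2"
proof -
  note u = admissible_unforced[OF assms]
  have "7 / 6 \<le> 1 * sqrt 2"
    using sqrt_2_bounds by simp
  also have "\<dots> \<le> l y * sqrt 2"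
    using u(3) by (intro mult_right_mono) auto
  finally show "0 \<le> e y + 1 \<and> wp (e y + 1) \<le> l y * sqrt 2 \<and> 7 / 6 \<le> l y * sqrt 2"
    using u by (auto simp: wp_Suc)
  show "0 \<le> e y + 2 \<and> wp (e y + 2) \<le> l y * 2 \<and> 7 / 6 \<le> l y * 2"
    using u by (auto simp: wp_add wp_numerals)
qed

section \<open>Removing a single leaf\<close>

text \<open>If \<open>v\<close> cannot be used, scaling both ends by \<open>sqrt 2\<close> gives the
  coefficients 2, 1, 1, which weight at least 1 at \<open>v\<close> provides. If \<open>e v\<close>
  is at least 3, the leaf may be used without forcing a neighbour; this costs a second application
  of the induction hypothesis, paid for by the weight of \<open>v\<close>, which is at least 2 sqrt
  2.\<close>

lemma easy_leaf_bound:
  assumes B: "bounded_by_weight A'" and leaf: "leaf_at adj A' v a b" and ab: "adj a b"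
    and adm: "admissible (insert v A') e l X"
    and nochild: "\<forall>c\<in>insert v A'. \<not> child c v"
    and easy: "v \<in> X \<or> e v \<noteq> 2"
  shows "2 * real (num_restricted adj (insert v A') e X) \<le> weighted_count adj (insert v A') l"
proof -
  let ?N = "weight_out adj A' l a b" and ?P = "weight_in adj A' l a" and ?Z = "weight_in adj A' l b"
  have A': "finite A'" "v \<notin> A'" "a \<in> A'" "b \<in> A'" "a \<noteq> b"
    using leaf by (auto simp: leaf_at_def)
  have pos: "\<forall>x\<in>A'. 0 < l x"
    using admissible_pos[OF adm] by auto
  have nn: "0 \<le> ?N" "0 \<le> ?P" "0 \<le> ?Z"
    using pos by (simp_all add: weight_out_nonneg weight_in_nonneg)
  have near: "y \<in> A' \<Longrightarrow> r \<in> insert v A' \<Longrightarrow> r \<notin> A' \<Longrightarrow> adj y r \<Longrightarrow> y = a \<or> y = b" for y r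
    using leaf_near[OF leaf] by blast
  have b1: "2 * real (num_restricted adj A' (shift2 e a 1 b 1) X) \<le>
      sqrt 2 * sqrt 2 * ?N + sqrt 2 / sqrt 2 * ?P + sqrt 2 / sqrt 2 * ?Z"
    by (rule bound_restrict[OF B adm _ A'(1,3,4) ab near])
      (use A' unforced_scale(1)[OF adm] forced_scale[OF adm _ _ A'(1), of _ v X] in \<open>auto simp: shift2_def\<close>)
  then have b1: "2 * real (num_restricted adj A' (shift2 e a 1 b 1) X) \<le> 2 * ?N + 1 * ?P + 1 * ?Z"
    by simp
  have rec: "num_restricted adj (insert v A') e X \<le>
      num_restricted adj A' (shift2 e a 1 b 1) X + card (leaf_used adj A' e X v)"
    by (rule num_restricted_leaf) fact
  have wc: "weighted_count adj (insert v A') l = (l v + 1 / l v) * ?N + l v * ?P + l v * ?Z"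
    by (rule weighted_count_leaf) fact+
  have lv: "1 \<le> l v"
  proof (cases "v \<in> X")
    case True
    have "{c \<in> insert v A' \<inter> X. child c v} = {}"
      using nochild by blast
    then have "credit (insert v A') X v = 0"
      unfolding credit_def by (simp only: card.empty of_nat_0)
    then show ?thesis
      using admissible_forced[OF adm _ True] by simp
  next
    case False
    then show ?thesis
      using admissible_unforced[OF adm] by simp
  qed
  show ?thesis
  proof (cases "v \<in> X \<or> e v \<le> 1")
    case True
    then have "card (leaf_used adj A' e X v) = 0"
      using card_leaf_used_eq_0[OF leaf] by blast
    then have x: "2 * real (num_restricted adj (insert v A') e X) \<le> 2 * ?N + 1 * ?P + 1 * ?Z"
      using rec b1 by linarith
    have "2 \<le> l v + 1 / l v"
      using add_scaled_inverse_mono[of 1 1 1 "l v"] lv by simp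
    then show ?thesis
      unfolding wc using lv by (intro three_term_mono[OF x nn])
  next
    case False
    then have v: "v \<notin> X" "3 \<le> e v"
      using easy by auto
    have "2.8284 \<le> wp 3"
      using sqrt_2_bounds by (simp add: wp_numerals)
    also have "wp 3 \<le> l v"
      using admissible_unforced(2)[OF adm _ v(1)] wp_mono[OF v(2)] by simp
    finally have lv: "2.8284 \<le> l v" .
    \<comment> \<open>Since 2.8284 + 1/2.8284 exceeds 19/6, at least 7/6 of each coefficient is left
      after spending 2, 1, 1 on the sets without \<open>v\<close>.\<close>
    have w: "2 + 7 / 6 \<le> l v + 1 / l v" "1 + 7 / 6 \<le> l v"
      using add_scaled_inverse_mono[of 1 1 "2.8284" "l v"] lv by auto
    have "\<exists>t\<in>insert v A'. adj v t \<and> (t \<in> X \<or> 7 / 6 \<le> l t)"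
      using adm v by (auto simp: admissible_def)
    then have t: "a \<in> X \<or> 7 / 6 \<le> l a \<or> b \<in> X \<or> 7 / 6 \<le> l b"
      using leaf by (auto simp: leaf_at_def)
    have cr: "credit (insert v A') X y \<le> credit A' X y" for y
      using v(1) A' by (intro credit_mono) auto
    have forced: "wp (- credit A' X y) \<le> l y" "wp (- credit A' X y) \<le> l y * (7 / 6)" if "y \<in> A'" "y \<in> X" for y
    proof -
      have "wp (- credit A' X y) \<le> wp (- credit (insert v A') X y)"
        using cr by (intro wp_mono) auto
      also have "\<dots> \<le> l y"
        using admissible_forced[OF adm] that by auto
      finally show "wp (- credit A' X y) \<le> l y" .
      then show "wp (- credit A' X y) \<le> l y * (7 / 6)"
        using pos that by auto
    qed
    have unf: "0 \<le> e y" "wp (e y) \<le> l y" "1 \<le> l y" "wp (e y) \<le> l y * (7 / 6)"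
      if "y \<in> A'" "y \<notin> X" for y
      using admissible_unforced[OF adm, of y] that by auto
    \<comment> \<open>The removed \<open>v\<close> may have been the witness for \<open>a\<close> or
      \<open>b\<close>, so both ends should be forced or of weight at least 7/6. The witness of
      \<open>v\<close> shows this for one end, and only the other is scaled by 7/6; scaling both
      would cost 49/36 at N, more than is left.\<close>
    have b2: "2 * real (num_restricted adj A' e X) \<le> 7 / 6 * ?N + 7 / 6 * ?P + 7 / 6 * ?Z"
    proof (cases "a \<in> X \<or> 7 / 6 \<le> l a")
      case True
      have "2 * real (num_restricted adj A' e X) \<le> 1 * (7 / 6) * ?N + (7 / 6) / 1 * ?P + 1 / (7 / 6) * ?Z"
        by (rule bound_restrict[OF B adm _ A'(1,3,4) ab near])
          (use True A' forced unf in \<open>auto simp: shift2_def\<close>)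
      then show ?thesis
        by (rule three_term_mono[OF _ nn]) auto
    next
      case False
      then have b: "b \<in> X \<or> 7 / 6 \<le> l b"
        using t by blast
      have "2 * real (num_restricted adj A' e X) \<le> (7 / 6) * 1 * ?N + 1 / (7 / 6) * ?P + (7 / 6) / 1 * ?Z"
        by (rule bound_restrict[OF B adm _ A'(1,3,4) ab near])
          (use b A' forced unf in \<open>auto simp: shift2_def\<close>)
      then show ?thesis
        by (rule three_term_mono[OF _ nn]) auto
    qed
    have "card (leaf_used adj A' e X v) \<le> num_restricted adj A' e X"
      by (rule card_leaf_used_le) fact
    then have x: "2 * real (num_restricted adj (insert v A') e X) \<le>
        (2 + 7 / 6) * ?N + (1 + 7 / 6) * ?P + (1 + 7 / 6) * ?Z"
      using rec b1 b2 by (simp add: algebra_simps)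
    show ?thesis
      unfolding wc using w by (intro three_term_mono[OF x nn])
  qed
qed

text \<open>Of the coefficients 5/2, 2, 2 provided by \<open>v\<close>, the sets without
  \<open>v\<close> take 2, 1, 1. The remaining 1/2, 1, 1 suffice for the sets with \<open>v\<close>
  if both ends, now forced, can be scaled down by \<open>sqrt 2\<close>: the weight of
  \<open>q\<close> permits it at \<open>q\<close>, and the credit from the forced child
  \<open>q\<close> permits it at \<open>b\<close>.\<close>

lemma heavy_parent_bound:
  assumes B: "bounded_by_weight A'" and leaf: "leaf_at adj A' v q b" and qb: "child q b"
    and adm: "admissible (insert v A') e l X"
    and v: "v \<notin> X" "e v = 2" and lq: "sqrt 2 \<le> l q"
  shows "2 * real (num_restricted adj (insert v A') e X) \<le> weighted_count adj (insert v A') l"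
proof -
  let ?N = "weight_out adj A' l q b" and ?P = "weight_in adj A' l q" and ?Z = "weight_in adj A' l b"
  have A': "finite A'" "v \<notin> A'" "q \<in> A'" "b \<in> A'" "q \<noteq> b"
    using leaf by (auto simp: leaf_at_def)
  have ab: "adj q b"
    using qb by (simp add: adj_def)
  have pos: "\<forall>x\<in>A'. 0 < l x"
    using admissible_pos[OF adm] by auto
  have nn: "0 \<le> ?N" "0 \<le> ?P" "0 \<le> ?Z"
    using pos by (simp_all add: weight_out_nonneg weight_in_nonneg)
  have near: "y \<in> A' \<Longrightarrow> r \<in> insert v A' \<Longrightarrow> r \<notin> A' \<Longrightarrow> adj y r \<Longrightarrow> y = q \<or> y = b" for y r
    using leaf_near[OF leaf] by blast
  have rec: "num_restricted adj (insert v A') e X \<le>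
      num_restricted adj A' (shift2 e q 1 b 1) X + card (leaf_used adj A' e X v)"
    by (rule num_restricted_leaf) fact
  have used: "card (leaf_used adj A' e X v) \<le> num_restricted adj A' e (X \<union> {q, b})"
    by (rule card_leaf_used_le_forced) (use leaf v in auto)
  have wc: "weighted_count adj (insert v A') l = (l v + 1 / l v) * ?N + l v * ?P + l v * ?Z"
    by (rule weighted_count_leaf) fact+
  have lv: "2 \<le> l v"
    using admissible_unforced(2)[OF adm _ v(1)] v(2) by (simp add: wp_numerals)
  have x: "2 * real (num_restricted adj (insert v A') e X) \<le> 5 / 2 * ?N + 2 * ?P + 2 * ?Z"
  proof (cases "q \<in> X \<and> b \<in> X")
    case True
    have forced: "wp (- credit A' X y) \<le> l y" if "y \<in> A'" "y \<in> X" for y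
    proof -
      have "credit (insert v A') X y \<le> credit A' X y"
        using v(1) A' by (intro credit_mono) auto
      then have "wp (- credit A' X y) \<le> wp (- credit (insert v A') X y)"
        by (intro wp_mono) auto
      also have "\<dots> \<le> l y"
        using admissible_forced[OF adm] that by auto
      finally show ?thesis .
    qed
    \<comment> \<open>Both ends are forced already, so their values of \<open>e\<close> do not
      affect admissibility, and the unscaled bound serves for both families.\<close>
    have b: "2 * real (num_restricted adj A' e' X) \<le> 1 * 1 * ?N + 1 / 1 * ?P + 1 / 1 * ?Z"
      if "\<And>y. y \<noteq> q \<Longrightarrow> y \<noteq> b \<Longrightarrow> e' y = e y" for e'
      by (rule bound_restrict[OF B adm _ A'(1,3,4) ab near]) (use True A' forced that in auto)
    have "X \<union> {q, b} = X"
      using True by auto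
    then have "real (num_restricted adj (insert v A') e X) \<le>
        real (num_restricted adj A' (shift2 e q 1 b 1) X) + real (num_restricted adj A' e X)"
      using rec used by simp
    moreover have "2 * real (num_restricted adj A' e X) \<le> ?N + ?P + ?Z"
      using b[of e] by simp
    moreover have "2 * real (num_restricted adj A' (shift2 e q 1 b 1) X) \<le> ?N + ?P + ?Z"
      using b[of "shift2 e q 1 b 1"] by (simp add: shift2_def)
    ultimately have "2 * real (num_restricted adj (insert v A') e X) \<le> 2 * ?N + 2 * ?P + 2 * ?Z"
      by linarith
    then show ?thesis
      by (rule three_term_mono[OF _ nn]) auto
  next
    case False
    let ?s = "1 / sqrt 2" and ?X = "X \<union> {q, b}"
    have b1: "2 * real (num_restricted adj A' (shift2 e q 1 b 1) X) \<le>
        sqrt 2 * sqrt 2 * ?N + sqrt 2 / sqrt 2 * ?P + sqrt 2 / sqrt 2 * ?Z"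
      by (rule bound_restrict[OF B adm _ A'(1,3,4) ab near])
        (use A' unforced_scale(1)[OF adm] forced_scale[OF adm _ _ A'(1), of _ v X] in \<open>auto simp: shift2_def\<close>)
    have q: "wp (- credit A' ?X q) \<le> l q * ?s"
    proof -
      have "wp (- credit A' ?X q) \<le> 1"
        by (rule wp_le_1) simp
      also have "1 \<le> l q * ?s"
        using lq by (simp add: field_simps)
      finally show ?thesis .
    qed
    have b: "wp (- credit A' ?X b) \<le> l b * ?s"
    proof -
      have sub: "credit A' X b + (if q \<in> X then 0 else 1) \<le> credit A' ?X b"
        using credit_mono_insert[of A' A' X b ?X q] credit_mono[of A' A' X b ?X] A' qb by auto
      have "wp (- credit A' ?X b + 1) \<le> l b"
      proof (cases "b \<in> X")
        case True
        have "credit (insert v A') X b \<le> credit A' X b"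
          using v(1) A'(1) by (intro credit_mono) auto
        \<comment> \<open>The two ends are not both forced and \<open>b\<close> is, so
          \<open>q\<close> becomes forced only now and adds a unit of credit.\<close>
        then have "credit (insert v A') X b + 1 \<le> credit A' ?X b"
          using sub False True by auto
        then have "wp (- credit A' ?X b + 1) \<le> wp (- credit (insert v A') X b)"
          by (intro wp_mono) auto
        then show ?thesis
          using admissible_forced[OF adm _ True] A'(4) by (meson insertI2 order_trans)
      next
        case b: False
        have "1 \<le> credit A' ?X b"
          using credit_mono_insert[of A' A' "{}" b ?X q] A' qb by (simp add: credit_def[of _ "{}"])
        then have "wp (- credit A' ?X b + 1) \<le> 1"
          by (intro wp_le_1) auto
        then show ?thesis
          using admissible_unforced(3)[OF adm _ b] A' by auto
      qed
      then show ?thesis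
        unfolding wp_Suc by (simp add: field_simps)
    qed
    have b2: "2 * real (num_restricted adj A' e ?X) \<le> ?s * ?s * ?N + ?s / ?s * ?P + ?s / ?s * ?Z"
      by (rule bound_restrict[OF B adm _ A'(1,3,4) ab near]) (use A' q b in auto)
    have "2 * real (num_restricted adj A' (shift2 e q 1 b 1) X) \<le> 2 * ?N + ?P + ?Z"
      using b1 by simp
    moreover have "2 * real (num_restricted adj A' e ?X) \<le> 1 / 2 * ?N + ?P + ?Z"
      using b2 by simp
    moreover have "real (num_restricted adj (insert v A') e X) \<le>
        real (num_restricted adj A' (shift2 e q 1 b 1) X) + real (num_restricted adj A' e ?X)"
      using rec used by linarith
    ultimately show ?thesis
      by linarith
  qed
  show ?thesis
    unfolding wc using add_inverse_ge[OF lv] lv by (intro three_term_mono[OF x nn])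
qed

end

lemma divide_sqrt_2: "x / sqrt 2 = x * sqrt 2 / 2"
  by (simp add: field_simps)

context triangulation
begin

section \<open>Removing a light parent together with its leaf children\<close>

text \<open>When \<open>q\<close> and its leaf children disappear, an end \<open>y\<close> of the
  base of \<open>q\<close> has three options. If it was forced, \<open>sqrt 2\<close> covers the
  possible loss of a forced child \<open>q\<close>, and with \<open>q\<close> unforced any factor
  from 1 upwards is allowed. If it becomes forced, resulting weight 1 suffices. If it stays
  unforced, each unit added to \<open>e\<close> requires a factor \<open>sqrt 2\<close>.\<close>

definition scale_ok ::
    "nat \<Rightarrow> (nat \<Rightarrow> int) \<Rightarrow> (nat \<Rightarrow> real) \<Rightarrow> nat set \<Rightarrow> (nat \<Rightarrow> int) \<Rightarrow> nat set \<Rightarrow> nat \<Rightarrow> real \<Rightarrow> bool" where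
  "scale_ok q e l X e' X' y r \<longleftrightarrow>
     y \<in> X' \<and> y \<in> X \<and> (r = sqrt 2 \<or> q \<notin> X \<and> 1 \<le> r) \<or>
     y \<in> X' \<and> y \<notin> X \<and> 1 \<le> l y * r \<or>
     y \<notin> X' \<and> (r = sqrt 2 \<and> e' y = e y + 1 \<or> r = 2 \<and> e' y = e y + 2)"

lemma scale_okD:
  assumes "scale_ok q e l X e' X' y r" and adm: "admissible A e l X" and y: "y \<in> A'"
    and A': "A' \<subseteq> A" "finite A'" and X': "X \<subseteq> X'"
    and q: "\<And>c. c \<in> A \<Longrightarrow> c \<in> X \<Longrightarrow> c \<in> A' \<or> c = q"
  shows "y \<in> X' \<Longrightarrow> wp (- credit A' X' y) \<le> l y * r"
    and "y \<notin> X' \<Longrightarrow> 0 \<le> e' y \<and> wp (e' y) \<le> l y * r \<and> 7 / 6 \<le> l y * r"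
proof -
  have "y \<in> A"
    using y A' by auto
  assume "y \<in> X'"
  then consider "y \<in> X" "r = sqrt 2" | "y \<in> X" "q \<notin> X" "1 \<le> r" | "y \<notin> X" "1 \<le> l y * r"
    using assms(1) by (auto simp: scale_ok_def)
  then show "wp (- credit A' X' y) \<le> l y * r"
  proof cases
    case 1
    then show ?thesis
      using forced_scale[OF adm \<open>y \<in> A\<close> 1(1) A'(2) q] X' by blast
  next
    case 2
    have "credit A X y \<le> credit A' X' y"
      using 2(2) q X' A'(2) by (intro credit_mono) blast+
    then have "wp (- credit A' X' y) \<le> wp (- credit A X y)"
      by (intro wp_mono) simp
    also have "\<dots> \<le> l y"
      by (rule admissible_forced[OF adm \<open>y \<in> A\<close> 2(1)])
    also have "\<dots> \<le> l y * r"
      using 2(3) admissible_pos[OF adm \<open>y \<in> A\<close>] by simp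
    finally show ?thesis .
  next
    case 3
    then show ?thesis
      by (intro newly_forced_scale[OF adm \<open>y \<in> A\<close>])
  qed
next
  have "y \<in> A"
    using y A' by auto
  assume y': "y \<notin> X'"
  then have "y \<notin> X"
    using X' by blast
  note u = unforced_scale[OF adm \<open>y \<in> A\<close> this]
  have "r = sqrt 2 \<and> e' y = e y + 1 \<or> r = 2 \<and> e' y = e y + 2"
    using assms(1) y' by (simp add: scale_ok_def)
  then show "0 \<le> e' y \<and> wp (e' y) \<le> l y * r \<and> 7 / 6 \<le> l y * r"
    using u by (elim disjE conjE) simp_all
qed

lemma reduced_bound:
  assumes B: "bounded_by_weight A'"
    and adm: "admissible A e l X" and A': "A' \<subseteq> A" "finite A'"
    and ab: "p \<in> A'" "z \<in> A'" "adj p z"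
    and near: "\<And>y r. y \<in> A' \<Longrightarrow> r \<in> A \<Longrightarrow> r \<notin> A' \<Longrightarrow> adj y r \<Longrightarrow> y = p \<or> y = z"
    and q: "\<And>c. c \<in> A \<Longrightarrow> c \<in> X \<Longrightarrow> c \<in> A' \<or> c = q"
    and X': "X \<subseteq> X'" "X' \<inter> A' \<subseteq> X \<union> {p, z}"
    and e': "\<And>y. y \<in> A' \<Longrightarrow> y \<noteq> p \<Longrightarrow> y \<noteq> z \<Longrightarrow> e' y = e y"
    and ok: "scale_ok q e l X e' X' p r" "scale_ok q e l X e' X' z s"
  shows "2 * real (num_restricted adj A' e' X') \<le>
    r * s * weight_out adj A' l p z + s / r * weight_in adj A' l p + r / s * weight_in adj A' l z"
proof (rule bound_restrict[OF B adm A' ab near _ _ e'])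
  note p = scale_okD[OF ok(1) adm ab(1) A' X'(1) q]
  note z = scale_okD[OF ok(2) adm ab(2) A' X'(1) q]
  show "p \<in> X' \<Longrightarrow> wp (- credit A' X' p) \<le> l p * r"
    "p \<notin> X' \<Longrightarrow> 0 \<le> e' p \<and> wp (e' p) \<le> l p * r \<and> 7 / 6 \<le> l p * r"
    using p by blast+
  show "z \<in> X' \<Longrightarrow> wp (- credit A' X' z) \<le> l z * s"
    "z \<notin> X' \<Longrightarrow> 0 \<le> e' z \<and> wp (e' z) \<le> l z * s \<and> 7 / 6 \<le> l z * s"
    using z by blast+
qed (use X' in auto)

lemma weighted_count_one_leaf:
  assumes v: "leaf_at adj (insert q A') v q p" and q: "leaf_at adj A' q p z" and pz: "adj p z"
  shows "weighted_count adj (insert v (insert q A')) l =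
    (l q * (l v + 1 / l v) + l v / l q) * weight_out adj A' l p z +
    l q * l v * weight_in adj A' l p + l q * (l v + 1 / l v) * weight_in adj A' l z"
proof -
  have fin: "finite A'" "q \<notin> A'"
    using q by (auto simp: leaf_at_def)
  let ?h = "\<lambda>I. l v * 1 + (if q \<notin> I \<and> p \<notin> I then 1 / l v * 1 else 0)"
  have "weighted_count adj (insert v (insert q A')) l =
      (\<Sum>I\<in>indep_family adj (insert q A'). weight (insert q A') l I * ?h I)"
    unfolding weighted_count_def using sum_indep_leaf[OF v, of l "\<lambda>_. 1"] by simp
  also have "\<dots> = (\<Sum>I\<in>indep_family adj A'. weight A' l I *
      (l q * ?h I + (if p \<notin> I \<and> z \<notin> I then 1 / l q * ?h (insert q I) else 0)))"
    by (rule sum_indep_leaf[OF q])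
  also have "\<dots> = (\<Sum>I\<in>indep_family adj A'. weight A' l I *
      (if p \<in> I then l q * l v else if z \<in> I then l q * (l v + 1 / l v)
       else l q * (l v + 1 / l v) + l v / l q))"
  proof (rule sum.cong)
    fix I assume "I \<in> indep_family adj A'"
    then have "q \<notin> I"
      using fin by (auto simp: indep_family_def)
    then show "weight A' l I * (l q * ?h I + (if p \<notin> I \<and> z \<notin> I then 1 / l q * ?h (insert q I) else 0)) =
      weight A' l I * (if p \<in> I then l q * l v else if z \<in> I then l q * (l v + 1 / l v)
       else l q * (l v + 1 / l v) + l v / l q)"
      by simp
  qed simp
  finally show ?thesis
    using sum_indep_split[where E = adj, OF fin(1) pz] by simp
qed

text \<open>A set containing \<open>q\<close> excludes both leaves and both ends of the base, which
  yields the summand \<open>l v * l u / l q\<close>. Without \<open>q\<close>, each leaf is free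
  unless its other neighbour is chosen.\<close>

lemma weighted_count_two_leaves:
  assumes v: "leaf_at adj (insert u (insert q A')) v q p" and u: "leaf_at adj (insert q A') u q z"
    and q: "leaf_at adj A' q p z" and pz: "adj p z"
  shows "weighted_count adj (insert v (insert u (insert q A'))) l =
    (l q * ((l v + 1 / l v) * (l u + 1 / l u)) + l v * l u / l q) * weight_out adj A' l p z +
    l q * (l v * (l u + 1 / l u)) * weight_in adj A' l p +
    l q * ((l v + 1 / l v) * l u) * weight_in adj A' l z"
proof -
  have fin: "finite A'" "q \<notin> A'" "u \<noteq> p" "u \<noteq> q" "u \<notin> A'"
    using q u by (auto simp: leaf_at_def)
  let ?h = "\<lambda>I. l v * 1 + (if q \<notin> I \<and> p \<notin> I then 1 / l v * 1 else 0)"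
  let ?k = "\<lambda>I. l u * ?h I + (if q \<notin> I \<and> z \<notin> I then 1 / l u * ?h (insert u I) else 0)"
  have "weighted_count adj (insert v (insert u (insert q A'))) l =
      (\<Sum>I\<in>indep_family adj (insert u (insert q A')). weight (insert u (insert q A')) l I * ?h I)"
    unfolding weighted_count_def using sum_indep_leaf[OF v, of l "\<lambda>_. 1"] by simp
  also have "\<dots> = (\<Sum>I\<in>indep_family adj (insert q A'). weight (insert q A') l I * ?k I)"
    by (rule sum_indep_leaf[OF u])
  also have "\<dots> = (\<Sum>I\<in>indep_family adj A'. weight A' l I *
      (l q * ?k I + (if p \<notin> I \<and> z \<notin> I then 1 / l q * ?k (insert q I) else 0)))"
    by (rule sum_indep_leaf[OF q])
  also have "\<dots> = (\<Sum>I\<in>indep_family adj A'. weight A' l I *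
      (if p \<in> I then l q * (l v * (l u + 1 / l u)) else if z \<in> I then l q * ((l v + 1 / l v) * l u)
       else l q * ((l v + 1 / l v) * (l u + 1 / l u)) + l v * l u / l q))"
  proof (rule sum.cong)
    fix I assume I: "I \<in> indep_family adj A'"
    then have "q \<notin> I" "\<not> (p \<in> I \<and> z \<in> I)"
      using fin pz by (auto simp: indep_family_def)
    then show "weight A' l I * (l q * ?k I + (if p \<notin> I \<and> z \<notin> I then 1 / l q * ?k (insert q I) else 0)) =
      weight A' l I * (if p \<in> I then l q * (l v * (l u + 1 / l u)) else if z \<in> I then l q * ((l v + 1 / l v) * l u)
       else l q * ((l v + 1 / l v) * (l u + 1 / l u)) + l v * l u / l q)"
      using fin by (auto simp: algebra_simps)
  qed simp
  finally show ?thesis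
    using sum_indep_split[where E = adj, OF fin(1) pz] by simp
qed

lemma num_restricted_blocked_leaf:
  assumes "leaf_at E A v a b" "v \<in> X \<or> e v \<le> 1"
  shows "num_restricted E (insert v A) e X \<le> num_restricted E A (shift2 e a 1 b 1) X"
  using num_restricted_leaf[OF assms(1), of e X] card_leaf_used_eq_0[where E = E and e = e and X = X, OF assms] by simp

lemma num_restricted_leaf_2:
  assumes "leaf_at E A v a b" "e v = 2"
  shows "num_restricted E (insert v A) e X \<le>
    num_restricted E A (shift2 e a 1 b 1) X + num_restricted E A e (X \<union> {a, b})"
  using num_restricted_leaf[OF assms(1), of e X] card_leaf_used_le_forced[OF assms(1), of e X] assms(2)
  by simp

text \<open>Without \<open>v\<close>, the parent \<open>q\<close> is forced or has only one removed
  neighbour and cannot be used, so \<open>p\<close> gains two units and \<open>z\<close> one; this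
  is \<open>F\<close>. With \<open>v\<close>, both \<open>q\<close> and \<open>p\<close> are forced
  and \<open>z\<close> gains one unit; this is \<open>G\<close>. For \<open>l v\<close> at least 2
  and \<open>l q\<close> at least 1, the coefficients 9/2, 2, 5/2 are available.\<close>

lemma one_leaf_bound:
  assumes B: "bounded_by_weight A'"
    and leaf: "leaf_at adj (insert q A') v q p" "leaf_at adj A' q p z" and pz: "adj p z"
    and adm: "admissible (insert v (insert q A')) e l X"
    and v: "v \<notin> X" "e v = 2" and q: "1 \<le> l q" "q \<in> X \<or> e q = 0"
  shows "2 * real (num_restricted adj (insert v (insert q A')) e X) \<le>
    weighted_count adj (insert v (insert q A')) l"
proof -
  let ?A = "insert v (insert q A')"
  let ?N = "weight_out adj A' l p z" and ?P = "weight_in adj A' l p" and ?Z = "weight_in adj A' l z"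
  have A': "finite A'" "q \<notin> A'" "v \<notin> A'" "v \<noteq> q" "p \<in> A'" "z \<in> A'" "p \<noteq> z" "p \<noteq> q" "z \<noteq> q"
    using leaf by (auto simp: leaf_at_def)
  have pos: "\<forall>x\<in>A'. 0 < l x"
    using admissible_pos[OF adm] by auto
  have nn: "0 \<le> ?N" "0 \<le> ?P" "0 \<le> ?Z"
    using pos by (simp_all add: weight_out_nonneg weight_in_nonneg)
  have near: "y = p \<or> y = z" if "y \<in> A'" "r \<in> ?A" "r \<notin> A'" "adj y r" for y r
    using that leaf by (auto simp: leaf_at_def)
  have Xq: "c \<in> A' \<or> c = q" if "c \<in> ?A" "c \<in> X" for c
    using that v by auto
  note bound = reduced_bound[OF B adm _ A'(1) A'(5,6) pz near Xq]
  let ?F = "num_restricted adj A' (shift2 (shift2 e q 1 p 1) p 1 z 1) X"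
  let ?G = "num_restricted adj A' (shift2 e p 1 z 1) (X \<union> {q, p})"
  have "num_restricted adj ?A e X \<le>
      num_restricted adj (insert q A') (shift2 e q 1 p 1) X + num_restricted adj (insert q A') e (X \<union> {q, p})"
    by (rule num_restricted_leaf_2) (use leaf v in auto)
  also have "num_restricted adj (insert q A') (shift2 e q 1 p 1) X \<le> ?F"
    by (rule num_restricted_blocked_leaf) (use leaf q A' in \<open>auto simp: shift2_def\<close>)
  also have "num_restricted adj (insert q A') e (X \<union> {q, p}) \<le> ?G"
    by (rule num_restricted_blocked_leaf) (use leaf in auto)
  finally have rec: "real (num_restricted adj ?A e X) \<le> real ?F + real ?G"
    by simp
  have x: "2 * real (num_restricted adj ?A e X) \<le> 9 / 2 * ?N + 2 * ?P + 5 / 2 * ?Z"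
  proof (cases "p \<in> X")
    case True
    have "2 * real ?F \<le> sqrt 2 * sqrt 2 * ?N + sqrt 2 / sqrt 2 * ?P + sqrt 2 / sqrt 2 * ?Z"
      by (rule bound) (use True A' in \<open>auto simp: scale_ok_def shift2_def\<close>)
    moreover have "2 * real ?G \<le> sqrt 2 * sqrt 2 * ?N + sqrt 2 / sqrt 2 * ?P + sqrt 2 / sqrt 2 * ?Z"
      by (rule bound) (use True A' in \<open>auto simp: scale_ok_def shift2_def\<close>)
    ultimately show ?thesis
      using rec nn by simp
  next
    case False
    have "2 * real ?F \<le> 2 * sqrt 2 * ?N + sqrt 2 / 2 * ?P + 2 / sqrt 2 * ?Z"
      by (rule bound) (use False A' in \<open>auto simp: scale_ok_def shift2_def\<close>)
    then have F: "2 * real ?F \<le> 14143 / 5000 * ?N + 442 / 625 * ?P + 14143 / 10000 * ?Z"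
      by (rule three_term_mono[OF _ nn]) (use sqrt_2_bounds in \<open>simp_all add: divide_sqrt_2\<close>)
    \<comment> \<open>A newly forced \<open>p\<close> would tolerate the factor 1, but then
      \<open>F\<close> and \<open>G\<close> together exceed the coefficient 2 at P. The factor must
      be above about 1.094 because of P and below about 1.182 because of N.\<close>
    have "1 \<le> l p * (7 / 6)"
      using admissible_unforced(3)[OF adm _ False] A' by auto
    then have "2 * real ?G \<le> (7 / 6) * sqrt 2 * ?N + sqrt 2 / (7 / 6) * ?P + (7 / 6) / sqrt 2 * ?Z"
      by (intro bound) (use False A' in \<open>auto simp: scale_ok_def shift2_def\<close>)
    then have G: "2 * real ?G \<le> 16501 / 10000 * ?N + 12123 / 10000 * ?P + 8251 / 10000 * ?Z"
      by (rule three_term_mono[OF _ nn]) (use sqrt_2_bounds in \<open>simp_all add: divide_sqrt_2\<close>)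
    show ?thesis
      using rec F G nn by linarith
  qed
  have lv: "2 \<le> l v"
    using admissible_unforced(2)[OF adm _ v(1)] v(2) by (simp add: wp_numerals)
  note lv' = add_inverse_ge[OF lv]
  have "9 / 2 \<le> (5 / 2) * 1 + 2 / (1 :: real)"
    by simp
  also have "\<dots> \<le> (5 / 2) * l q + 2 / l q"
    using q by (intro add_scaled_inverse_mono) auto
  also have "\<dots> \<le> l q * (l v + 1 / l v) + l v / l q"
    using q lv lv' by (intro add_mono divide_right_mono) (auto simp: mult.commute)
  finally have "9 / 2 \<le> l q * (l v + 1 / l v) + l v / l q" .
  moreover have "2 \<le> l q * l v"
    using mult_mono[of 1 "l q" 2 "l v"] q lv by simp
  moreover have "5 / 2 \<le> l q * (l v + 1 / l v)"
    using mult_mono[of 1 "l q" "5 / 2" "l v + 1 / l v"] q lv' by simp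
  ultimately show ?thesis
    unfolding weighted_count_one_leaf[OF leaf pz] by (rule three_term_mono[OF x nn])
qed

text \<open>Deciding about \<open>v\<close>, \<open>u\<close> and \<open>q\<close> gives five
  families: \<open>T1\<close> uses none of them, \<open>T2\<close> only \<open>u\<close>,
  \<open>T3\<close> only \<open>v\<close>, \<open>T4\<close> both leaves, and \<open>T5\<close> only
  \<open>q\<close>, whose count \<open>e\<close> has then risen to 2 so that \<open>p\<close> and
  \<open>z\<close> become forced. The available coefficients are 41/4, 5, 5 for \<open>l q\<close> =
  1 and 1801/168, 35/6, 35/6 for \<open>l q\<close> = 7/6. If \<open>q\<close> is unforced and
  lighter than 7/6, the witnesses of \<open>v\<close> and \<open>u\<close> make \<open>p\<close> and
  \<open>z\<close> forced or heavy, and a heavy end contributes at most 36/49 of N.\<close>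

lemma two_leaves_bound_aux:
  assumes B: "bounded_by_weight A'"
    and leaf: "leaf_at adj (insert u (insert q A')) v q p" "leaf_at adj (insert q A') u q z"
      "leaf_at adj A' q p z" and pz: "adj p z"
    and adm: "admissible (insert v (insert u (insert q A'))) e l X"
    and v: "v \<notin> X" "e v = 2" and u: "u \<notin> X" "e u = 2"
    and q: "1 \<le> l q" "q \<in> X \<or> e q = 0"
    and order: "z \<in> X \<Longrightarrow> p \<in> X"
  shows "2 * real (num_restricted adj (insert v (insert u (insert q A'))) e X) \<le>
    weighted_count adj (insert v (insert u (insert q A'))) l"
proof -
  let ?A1 = "insert q A'"
  let ?A3 = "insert u ?A1"
  let ?A = "insert v ?A3"
  let ?N = "weight_out adj A' l p z" and ?P = "weight_in adj A' l p" and ?Z = "weight_in adj A' l z"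
  have A': "finite A'" "q \<notin> A'" "v \<notin> A'" "u \<notin> A'" "v \<noteq> q" "u \<noteq> q" "v \<noteq> u" "p \<in> A'" "z \<in> A'" "p \<noteq> z"
    "p \<noteq> q" "z \<noteq> q" "p \<noteq> u" "z \<noteq> u"
    using leaf by (auto simp: leaf_at_def)
  have pos: "\<forall>x\<in>A'. 0 < l x"
    using admissible_pos[OF adm] by auto
  have nn: "0 \<le> ?N" "0 \<le> ?P" "0 \<le> ?Z"
    using pos by (simp_all add: weight_out_nonneg weight_in_nonneg)
  have near: "y = p \<or> y = z" if "y \<in> A'" "r \<in> ?A" "r \<notin> A'" "adj y r" for y r
    using that leaf by (auto simp: leaf_at_def)
  have Xq: "c \<in> A' \<or> c = q" if "c \<in> ?A" "c \<in> X" for c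
    using that v u by auto
  note bound = reduced_bound[OF B adm _ A'(1) A'(8,9) pz near Xq]
  let ?e1 = "shift2 e q 1 p 1" and ?e2 = "shift2 e q 1 z 1"
  let ?e3 = "shift2 ?e1 q 1 z 1" and ?Xp = "X \<union> {q, p}"
  let ?T1 = "num_restricted adj A' (shift2 ?e3 p 1 z 1) X"
  let ?T2 = "num_restricted adj A' (shift2 ?e1 p 1 z 1) (X \<union> {q, z})"
  let ?T3 = "num_restricted adj A' (shift2 ?e2 p 1 z 1) ?Xp"
  let ?T4 = "num_restricted adj A' (shift2 e p 1 z 1) (?Xp \<union> {q, z})"
  let ?U5 = "num_restricted adj A' ?e3 (X \<union> {p, z})"
  let ?T5 = "if q \<in> X then 0 else ?U5"
  have "num_restricted adj ?A e X \<le> num_restricted adj ?A3 ?e1 X + num_restricted adj ?A3 e ?Xp"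
    by (rule num_restricted_leaf_2) (use leaf v in auto)
  also have "num_restricted adj ?A3 ?e1 X \<le> num_restricted adj ?A1 ?e3 X + num_restricted adj ?A1 ?e1 (X \<union> {q, z})"
    by (rule num_restricted_leaf_2) (use leaf u A' in \<open>auto simp: shift2_def\<close>)
  also have "num_restricted adj ?A3 e ?Xp \<le> num_restricted adj ?A1 ?e2 ?Xp + num_restricted adj ?A1 e (?Xp \<union> {q, z})"
    by (rule num_restricted_leaf_2) (use leaf u in auto)
  also have "num_restricted adj ?A1 ?e3 X \<le> ?T1 + ?T5"
  proof (cases "q \<in> X")
    case True
    then show ?thesis
      using num_restricted_blocked_leaf[OF leaf(3)] by simp
  next
    case False
    then have "?e3 q = 2"
      using q A' by (simp add: shift2_def)
    then show ?thesis
      using num_restricted_leaf_2[OF leaf(3)] False by simp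
  qed
  also have "num_restricted adj ?A1 ?e1 (X \<union> {q, z}) \<le> ?T2"
    by (rule num_restricted_blocked_leaf) (use leaf in auto)
  also have "num_restricted adj ?A1 ?e2 ?Xp \<le> ?T3"
    by (rule num_restricted_blocked_leaf) (use leaf in auto)
  also have "num_restricted adj ?A1 e (?Xp \<union> {q, z}) \<le> ?T4"
    by (rule num_restricted_blocked_leaf) (use leaf in auto)
  finally have rec: "real (num_restricted adj ?A e X) \<le> real ?T1 + real ?T5 + real ?T2 + (real ?T3 + real ?T4)"
    by (simp only: of_nat_add[symmetric] of_nat_le_iff add_mono)
  have lv: "2 \<le> l v" "2 \<le> l u"
    using admissible_unforced(2)[OF adm _ v(1)] v(2) admissible_unforced(2)[OF adm _ u(1)] u(2)
    by (simp_all add: wp_numerals)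
  note lv' = add_inverse_ge[OF lv(1)] add_inverse_ge[OF lv(2)]
  have prods: "25 / 4 \<le> (l v + 1 / l v) * (l u + 1 / l u)" "4 \<le> l v * l u"
    "5 \<le> l v * (l u + 1 / l u)" "5 \<le> (l v + 1 / l v) * l u"
    using mult_mono[of "5 / 2" "l v + 1 / l v" "5 / 2" "l u + 1 / l u"] mult_mono[of 2 "l v" 2 "l u"]
      mult_mono[of 2 "l v" "5 / 2" "l u + 1 / l u"] mult_mono[of "5 / 2" "l v + 1 / l v" 2 "l u"] lv lv'
    by auto
  \<comment> \<open>The numbers 25/4, 4 and 5 come from \<open>l v\<close> and \<open>l u\<close>
    being at least 2. The bounds increase with \<open>l q\<close>, so they may be evaluated at any
    real number between 1 and \<open>l q\<close>.\<close>
  have large: "25 / 4 * m + 4 / m \<le> l q * ((l v + 1 / l v) * (l u + 1 / l u)) + l v * l u / l q"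
    "5 * m \<le> l q * (l v * (l u + 1 / l u))" "5 * m \<le> l q * ((l v + 1 / l v) * l u)"
    if "1 \<le> m" "m \<le> l q" for m
  proof -
    have "25 / 4 * m + 4 / m \<le> 25 / 4 * l q + 4 / l q"
      using that by (intro add_scaled_inverse_mono) auto
    also have "\<dots> \<le> l q * ((l v + 1 / l v) * (l u + 1 / l u)) + l v * l u / l q"
      using prods q mult_left_mono[OF prods(1), of "l q"]
      by (intro add_mono divide_right_mono) (simp_all add: mult.commute)
    finally show "25 / 4 * m + 4 / m \<le> l q * ((l v + 1 / l v) * (l u + 1 / l u)) + l v * l u / l q" .
    show "5 * m \<le> l q * (l v * (l u + 1 / l u))" "5 * m \<le> l q * ((l v + 1 / l v) * l u)"
      using mult_mono[of m "l q" 5 "l v * (l u + 1 / l u)"] mult_mono[of m "l q" 5 "(l v + 1 / l v) * l u"] that prods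
      by auto
  qed
  note wc = weighted_count_two_leaves[OF leaf pz, of l]
  have finish: "2 * real (num_restricted adj ?A e X) \<le> weighted_count adj ?A l"
    if "2 * real (num_restricted adj ?A e X) \<le> (25 / 4 * m + 4 / m) * ?N + 5 * m * ?P + 5 * m * ?Z"
      "1 \<le> m" "m \<le> l q" for m
    unfolding wc by (rule three_term_mono[OF that(1) nn large[OF that(2,3)]])
  have finish_1: ?thesis if "2 * real (num_restricted adj ?A e X) \<le> 41 / 4 * ?N + 5 * ?P + 5 * ?Z"
    by (rule finish[of 1]) (use that q in simp_all)
  have finish_2: ?thesis if "2 * real (num_restricted adj ?A e X) \<le> 1801 / 168 * ?N + 35 / 6 * ?P + 35 / 6 * ?Z"
    "7 / 6 \<le> l q"
    by (rule finish[of "7 / 6"]) (use that in simp_all)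
  have lp: "1 \<le> l p" if "p \<notin> X"
    using admissible_unforced(3)[OF adm _ that] A' by auto
  have lz: "1 \<le> l z" if "z \<notin> X"
    using admissible_unforced(3)[OF adm _ that] A' by auto
  \<comment> \<open>The neighbours of \<open>v\<close> are \<open>q\<close> and \<open>p\<close>,
    those of \<open>u\<close> are \<open>q\<close> and \<open>z\<close>. As \<open>q\<close> is no
    witness here, \<open>p\<close> and \<open>z\<close> have to be.\<close>
  have wit: "p \<in> X \<or> 7 / 6 \<le> l p" "z \<in> X \<or> 7 / 6 \<le> l z" if "q \<notin> X" "l q < 7 / 6"
  proof -
    have "\<exists>t\<in>?A. adj v t \<and> (t \<in> X \<or> 7 / 6 \<le> l t)" "\<exists>t\<in>?A. adj u t \<and> (t \<in> X \<or> 7 / 6 \<le> l t)"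
      using adm v u by (auto simp: admissible_def)
    moreover have "t = q \<or> t = p" if "t \<in> ?A" "adj v t" for t
      using leaf(1) that by (auto simp: leaf_at_def)
    moreover have "t = q \<or> t = z" if "t \<in> ?A" "adj u t" for t
    proof -
      have "\<not> adj v u"
        using leaf A' by (auto simp: leaf_at_def)
      then have "t \<noteq> v"
        using that adj_sym by blast
      then show ?thesis
        using leaf(2) that by (auto simp: leaf_at_def)
    qed
    ultimately show "p \<in> X \<or> 7 / 6 \<le> l p" "z \<in> X \<or> 7 / 6 \<le> l z"
      using that by (metis not_le)+
  qed
  show ?thesis
  proof (cases "z \<in> X")
    case True
    then have X: "z \<in> X" "p \<in> X"
      using order by auto
    \<comment> \<open>With both ends forced, five times 2, 1, 1 gives 10, 5, 5, within 41/4, 5,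
      5.\<close>
    have b: "2 * real (num_restricted adj A' e' X') \<le> sqrt 2 * sqrt 2 * ?N + sqrt 2 / sqrt 2 * ?P + sqrt 2 / sqrt 2 * ?Z"
      if "X \<subseteq> X'" "X' \<inter> A' \<subseteq> X \<union> {p, z}" "\<And>y. y \<in> A' \<Longrightarrow> y \<noteq> p \<Longrightarrow> y \<noteq> z \<Longrightarrow> e' y = e y" for e' X'
      by (rule bound) (use that X A' in \<open>auto simp: scale_ok_def\<close>)
    have "2 * real ?T1 \<le> 2 * ?N + ?P + ?Z" "2 * real ?T2 \<le> 2 * ?N + ?P + ?Z" "2 * real ?T3 \<le> 2 * ?N + ?P + ?Z"
      "2 * real ?T4 \<le> 2 * ?N + ?P + ?Z"
      using A' by (auto intro!: order_trans[OF b] simp: shift2_def)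
    moreover have "2 * real ?T5 \<le> 2 * ?N + ?P + ?Z"
      using A' nn by (auto intro!: order_trans[OF b] simp: shift2_def)
    ultimately have "2 * real (num_restricted adj ?A e X) \<le> 41 / 4 * ?N + 5 * ?P + 5 * ?Z"
      using rec nn by simp
    then show ?thesis
      by (rule finish_1)
  next
    case z: False
    show ?thesis
    proof (cases "p \<in> X")
      case p: True
      \<comment> \<open>The forced \<open>p\<close> gets \<open>sqrt 2\<close> for the possible loss
        of \<open>q\<close>; the unforced \<open>z\<close> gains two units, hence the factor
        2.\<close>
      have T1: "2 * real ?T1 \<le> sqrt 2 * 2 * ?N + 2 / sqrt 2 * ?P + sqrt 2 / 2 * ?Z"
        by (rule bound) (use p z A' in \<open>auto simp: scale_ok_def shift2_def\<close>)
      have T1: "2 * real ?T1 \<le> 14143 / 5000 * ?N + 14143 / 10000 * ?P + 442 / 625 * ?Z"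
        by (rule three_term_mono[OF T1 nn]) (use sqrt_2_bounds in \<open>simp_all add: divide_sqrt_2\<close>)
      have T3: "2 * real ?T3 \<le> sqrt 2 * 2 * ?N + 2 / sqrt 2 * ?P + sqrt 2 / 2 * ?Z"
        by (rule bound) (use p z A' in \<open>auto simp: scale_ok_def shift2_def\<close>)
      have T3: "2 * real ?T3 \<le> 14143 / 5000 * ?N + 14143 / 10000 * ?P + 442 / 625 * ?Z"
        by (rule three_term_mono[OF T3 nn]) (use sqrt_2_bounds in \<open>simp_all add: divide_sqrt_2\<close>)
      show ?thesis
      proof (cases "q \<in> X \<or> 7 / 6 \<le> l q")
        case True
        have b: "2 * real (num_restricted adj A' e' X') \<le> 14143 / 10000 * ?N + 442 / 625 * ?P + 14143 / 10000 * ?Z"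
          if "X \<subseteq> X'" "z \<in> X'" "X' \<inter> A' \<subseteq> X \<union> {p, z}" "\<And>y. y \<in> A' \<Longrightarrow> y \<noteq> p \<Longrightarrow> y \<noteq> z \<Longrightarrow> e' y = e y" for e' X'
        proof -
          have "2 * real (num_restricted adj A' e' X') \<le> sqrt 2 * 1 * ?N + 1 / sqrt 2 * ?P + sqrt 2 / 1 * ?Z"
            by (rule bound) (use that p z lz A' in \<open>auto simp: scale_ok_def\<close>)
          then show ?thesis
            by (rule three_term_mono[OF _ nn]) (use sqrt_2_bounds in \<open>simp_all add: divide_sqrt_2\<close>)
        qed
        have T2: "2 * real ?T2 \<le> 14143 / 10000 * ?N + 442 / 625 * ?P + 14143 / 10000 * ?Z"
          by (rule b) (use A' in \<open>auto simp: shift2_def\<close>)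
        have T4: "2 * real ?T4 \<le> 14143 / 10000 * ?N + 442 / 625 * ?P + 14143 / 10000 * ?Z"
          by (rule b) (use A' in \<open>auto simp: shift2_def\<close>)
        have U5: "2 * real ?U5 \<le> 14143 / 10000 * ?N + 442 / 625 * ?P + 14143 / 10000 * ?Z"
          by (rule b) (use A' in \<open>auto simp: shift2_def\<close>)
        have T5: "2 * real ?T5 \<le> 14143 / 10000 * ?N + 442 / 625 * ?P + 14143 / 10000 * ?Z" if "q \<notin> X"
          using U5 that by (simp only: if_False)
        show ?thesis
        \<comment> \<open>A forced \<open>q\<close> removes the fifth family. Otherwise that family
          raises the coefficient of Z to about 5.66, above 5 but below 35/6, which
          \<open>7 / 6 \<le> l q\<close> makes available.\<close>
        proof (cases "q \<in> X")
          case True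
          have "2 * real (num_restricted adj ?A e X) \<le> 41 / 4 * ?N + 5 * ?P + 5 * ?Z"
            using rec T1 T2 T3 T4 nn True by (simp only: if_True of_nat_0 add_0_right, linarith?)
          then show ?thesis
            by (rule finish_1)
        next
          case qX: False
          have "2 * real (num_restricted adj ?A e X) \<le> 1801 / 168 * ?N + 35 / 6 * ?P + 35 / 6 * ?Z"
            using rec T1 T2 T3 T4 T5[OF qX] nn by linarith
          then show ?thesis
            by (rule finish_2) (use True qX in auto)
        qed
      next
        case False
        then have qX: "q \<notin> X" "l q < 7 / 6"
          by auto
        then have lz: "7 / 6 \<le> l z"
          using wit z by auto
        have b: "2 * real (num_restricted adj A' e' X') \<le> 36 / 35 * ?N + 5 / 7 * ?P + 7 / 5 * ?Z"
          if "X \<subseteq> X'" "z \<in> X'" "X' \<inter> A' \<subseteq> X \<union> {p, z}" "\<And>y. y \<in> A' \<Longrightarrow> y \<noteq> p \<Longrightarrow> y \<noteq> z \<Longrightarrow> e' y = e y" for e' X'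
        proof -
          \<comment> \<open>Weight 7/6 lets the newly forced \<open>z\<close> be scaled by 6/7. At
            \<open>p\<close>, which loses no credit with the unforced \<open>q\<close>, the factor
            6/5 keeps the total coefficient of P, about 2 sqrt 2 + 15/7, below 5. The excess of Z
            over 5 is paid out of N, since Z is at most 36/49 N.\<close>
          have "2 * real (num_restricted adj A' e' X') \<le> (6 / 5) * (6 / 7) * ?N + (6 / 7) / (6 / 5) * ?P + (6 / 5) / (6 / 7) * ?Z"
            by (rule bound) (use that p z lz A' qX in \<open>auto simp: scale_ok_def\<close>)
          then show ?thesis
            by simp
        qed
        have T2: "2 * real ?T2 \<le> 36 / 35 * ?N + 5 / 7 * ?P + 7 / 5 * ?Z"
          by (rule b) (use A' in \<open>auto simp: shift2_def\<close>)
        have T4: "2 * real ?T4 \<le> 36 / 35 * ?N + 5 / 7 * ?P + 7 / 5 * ?Z"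
          by (rule b) (use A' in \<open>auto simp: shift2_def\<close>)
        have U5: "2 * real ?U5 \<le> 36 / 35 * ?N + 5 / 7 * ?P + 7 / 5 * ?Z"
          by (rule b) (use A' in \<open>auto simp: shift2_def\<close>)
        have T5: "2 * real ?T5 \<le> 36 / 35 * ?N + 5 / 7 * ?P + 7 / 5 * ?Z"
          using U5 qX(1) by (simp only: if_False)
        have "weight_in adj A' l z \<le> 1 / (7 / 6)\<^sup>2 * weight_out adj A' l z p"
          by (rule weight_in_le_out) (use A' pz adj_sym lz pos in auto)
        then have "?Z \<le> 36 / 49 * ?N"
          by (simp add: weight_out_def power2_eq_square conj_commute)
        then have "2 * real (num_restricted adj ?A e X) \<le> 41 / 4 * ?N + 5 * ?P + 5 * ?Z"
          using rec T1 T2 T3 T4 T5 nn \<open>?Z \<le> 36 / 49 * ?N\<close> by linarith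
        then show ?thesis
          by (rule finish_1)
      qed
    next
      case p: False
      \<comment> \<open>In \<open>T1\<close> both ends gain two units. In \<open>T2\<close> and
        \<open>T3\<close> only the end that stays unforced does, while the newly forced one, of
        weight at least 1, is left unscaled.\<close>
      have T1: "2 * real ?T1 \<le> 2 * 2 * ?N + 2 / 2 * ?P + 2 / 2 * ?Z"
        by (rule bound) (use p z A' in \<open>auto simp: scale_ok_def shift2_def\<close>)
      have T2: "2 * real ?T2 \<le> 2 * 1 * ?N + 1 / 2 * ?P + 2 / 1 * ?Z"
        by (rule bound) (use p z A' lz in \<open>auto simp: scale_ok_def shift2_def\<close>)
      have T3: "2 * real ?T3 \<le> 1 * 2 * ?N + 2 / 1 * ?P + 1 / 2 * ?Z"
        by (rule bound) (use p z A' lp in \<open>auto simp: scale_ok_def shift2_def\<close>)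
      show ?thesis
      proof (cases "q \<in> X \<or> 7 / 6 \<le> l q")
        case True
        have T4: "2 * real ?T4 \<le> 1 * 1 * ?N + 1 / 1 * ?P + 1 / 1 * ?Z"
          by (rule bound) (use p z A' lp lz in \<open>auto simp: scale_ok_def shift2_def\<close>)
        have U5: "2 * real ?U5 \<le> 1 * 1 * ?N + 1 / 1 * ?P + 1 / 1 * ?Z"
          by (rule bound) (use p z A' lp lz in \<open>auto simp: scale_ok_def shift2_def\<close>)
        have T5: "2 * real ?T5 \<le> 1 * 1 * ?N + 1 / 1 * ?P + 1 / 1 * ?Z" if "q \<notin> X"
          using U5 that by (simp only: if_False)
        show ?thesis
        proof (cases "q \<in> X")
          case True
          have "2 * real (num_restricted adj ?A e X) \<le> 41 / 4 * ?N + 5 * ?P + 5 * ?Z"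
            using rec T1 T2 T3 T4 nn True by (simp only: if_True of_nat_0 add_0_right, linarith?)
          then show ?thesis
            by (rule finish_1)
        next
          case qX: False
          have "2 * real (num_restricted adj ?A e X) \<le> 1801 / 168 * ?N + 35 / 6 * ?P + 35 / 6 * ?Z"
            using rec T1 T2 T3 T4 T5[OF qX] nn by linarith
          then show ?thesis
            by (rule finish_2) (use True qX in auto)
        qed
      next
        case False
        then have qX: "q \<notin> X" "l q < 7 / 6"
          by auto
        then have l: "7 / 6 \<le> l z" "7 / 6 \<le> l p"
          using wit z p by auto
        have b: "2 * real (num_restricted adj A' e' X') \<le> 36 / 49 * ?N + 1 * ?P + 1 * ?Z"
          if "X \<subseteq> X'" "p \<in> X'" "z \<in> X'" "X' \<inter> A' \<subseteq> X \<union> {p, z}" "\<And>y. y \<in> A' \<Longrightarrow> y \<noteq> p \<Longrightarrow> y \<noteq> z \<Longrightarrow> e' y = e y" for e' X'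
        proof -
          \<comment> \<open>Both ends weigh at least 7/6 and can be scaled by 6/7 on becoming
            forced. The five families then need 8 + 72/49, 11/2, 11/2; the excess of 1/2 at P and at
            Z amounts to at most 36/49 N, which fits below 41/4.\<close>
          have "2 * real (num_restricted adj A' e' X') \<le> (6 / 7) * (6 / 7) * ?N + (6 / 7) / (6 / 7) * ?P + (6 / 7) / (6 / 7) * ?Z"
            by (rule bound) (use that p z A' l in \<open>auto simp: scale_ok_def\<close>)
          then show ?thesis
            by simp
        qed
        have T4: "2 * real ?T4 \<le> 36 / 49 * ?N + 1 * ?P + 1 * ?Z"
          by (rule b) (use A' in \<open>auto simp: shift2_def\<close>)
        have U5: "2 * real ?U5 \<le> 36 / 49 * ?N + 1 * ?P + 1 * ?Z"
          by (rule b) (use A' in \<open>auto simp: shift2_def\<close>)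
        have T5: "2 * real ?T5 \<le> 36 / 49 * ?N + 1 * ?P + 1 * ?Z"
          using U5 qX(1) by (simp only: if_False)
        have "weight_in adj A' l z \<le> 1 / (7 / 6)\<^sup>2 * weight_out adj A' l z p"
          by (rule weight_in_le_out) (use A' pz adj_sym l pos in auto)
        then have Z: "?Z \<le> 36 / 49 * ?N"
          by (simp add: weight_out_def power2_eq_square conj_commute)
        have "weight_in adj A' l p \<le> 1 / (7 / 6)\<^sup>2 * weight_out adj A' l p z"
          by (rule weight_in_le_out) (use A' pz l pos in auto)
        then have P: "?P \<le> 36 / 49 * ?N"
          by (simp add: power2_eq_square)
        have "2 * real (num_restricted adj ?A e X) \<le> 41 / 4 * ?N + 5 * ?P + 5 * ?Z"
          using rec T1 T2 T3 T4 T5 nn P Z by linarith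
        then show ?thesis
          by (rule finish_1)
      qed
    qed
  qed
qed

end

lemma leaf_at_commute: "leaf_at E A v a b \<longleftrightarrow> leaf_at E A v b a"
  by (auto simp: leaf_at_def)

lemma leaf_at_subset:
  "leaf_at E (insert w A) v a b \<Longrightarrow> a \<in> A \<Longrightarrow> b \<in> A \<Longrightarrow> leaf_at E A v a b"
  unfolding leaf_at_def finite_insert by blast

lemma leaf_at_insert:
  "leaf_at E A v a b \<Longrightarrow> w \<notin> A \<Longrightarrow> w \<noteq> v \<Longrightarrow> \<not> E v w \<Longrightarrow> \<not> E w v \<Longrightarrow> leaf_at E (insert w A) v a b"
  unfolding leaf_at_def by blast

lemma add_divide_swap_ge_2:
  fixes a b :: real
  assumes "0 < a" "0 < b"
  shows "2 \<le> b / a + a / b"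
proof -
  have "0 \<le> (a - b)\<^sup>2"
    by simp
  then have "2 * (a * b) \<le> b * b + a * a"
    by (simp add: power2_eq_square algebra_simps)
  also have "\<dots> = (b / a + a / b) * (a * b)"
    using assms by (simp add: field_simps)
  finally show ?thesis
    using assms by simp
qed

context triangulation
begin

text \<open>The situation is symmetric under exchanging \<open>v\<close>, \<open>p\<close> with
  \<open>u\<close>, \<open>z\<close>, so it may be assumed that \<open>z\<close> is forced only if
  \<open>p\<close> is.\<close>

lemma two_leaves_bound:
  assumes B: "bounded_by_weight A'"
    and leaf: "leaf_at adj (insert u (insert q A')) v q p" "leaf_at adj (insert q A') u q z"
      "leaf_at adj A' q p z" and pz: "adj p z"
    and adm: "admissible (insert v (insert u (insert q A'))) e l X"
    and v: "v \<notin> X" "e v = 2" and u: "u \<notin> X" "e u = 2"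
    and q: "1 \<le> l q" "q \<in> X \<or> e q = 0"
  shows "2 * real (num_restricted adj (insert v (insert u (insert q A'))) e X) \<le>
    weighted_count adj (insert v (insert u (insert q A'))) l"
proof (cases "z \<in> X \<longrightarrow> p \<in> X")
  case True
  show ?thesis
    by (rule two_leaves_bound_aux[OF assms]) (use True in blast)
next
  case False
  have v': "v \<notin> insert u (insert q A')" "q \<in> insert q A'" "p \<in> insert q A'"
    using leaf(1,3) unfolding leaf_at_def by blast+
  have u': "u \<notin> insert q A'"
    using leaf(2) by (simp add: leaf_at_def)
  have nadj: "\<not> adj u v" "\<not> adj v u"
    using leaf(1) v' u' unfolding leaf_at_def by blast+
  have 1: "leaf_at adj (insert v (insert q A')) u q z"
    by (rule leaf_at_insert[OF leaf(2)]) (use v' nadj in auto)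
  have 2: "leaf_at adj (insert q A') v q p"
    using leaf_at_subset[OF leaf(1)] v' by blast
  have 3: "leaf_at adj A' q z p"
    using leaf(3) leaf_at_commute[of adj A' q p z] by simp
  have eq: "insert v (insert u (insert q A')) = insert u (insert v (insert q A'))"
    by (rule insert_commute)
  show ?thesis
    unfolding eq
    by (rule two_leaves_bound_aux[OF B 1 2 3 adj_sym[OF pz] adm[unfolded eq] u v q]) (use False in blast)
qed

section \<open>The root edge and the root triangle\<close>

text \<open>An end of a single edge has at most one outside neighbour, hence can be used only if
  \<open>e\<close> is at least 3. The summands account for the four subsets of the edge.\<close>

lemma num_restricted_edge_le:
  "num_restricted adj {0, m} e X \<le>
     1 + of_bool (0 \<notin> X \<and> 3 \<le> e 0) + of_bool (m \<notin> X \<and> 3 \<le> e m) +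
     of_bool ((0 \<notin> X \<and> 3 \<le> e 0) \<and> (m \<notin> X \<and> 3 \<le> e m))"
proof -
  let ?P = "0 \<notin> X \<and> 3 \<le> e 0" and ?Q = "m \<notin> X \<and> 3 \<le> e m"
  have "restricted_family adj {0, m} e X \<subseteq>
      {{}} \<union> (if ?P then {{0}} else {}) \<union> (if ?Q then {{m}} else {}) \<union> (if ?P \<and> ?Q then {{0, m}} else {})"
  proof
    fix U assume U: "U \<in> restricted_family adj {0, m} e X"
    then have U': "U \<subseteq> {0, m} - X" "\<And>u. u \<in> U \<Longrightarrow> 4 \<le> e u + int (card {w \<in> {0, m} - U. adj u w})"
      by (auto simp: restricted_family_def)
    have card1: "card {w \<in> {0, m} - U. adj u w} \<le> 1" if "u \<in> U" for u
    proof -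
      have "card {w \<in> {0, m} - U. adj u w} \<le> card ({0, m} - {u})"
        by (rule card_mono) (use that in auto)
      also have "\<dots> \<le> 1"
        using U'(1) that m_pos by auto
      finally show ?thesis .
    qed
    have ge: "3 \<le> e u" if "u \<in> U" for u
      using U'(2)[OF that] card1[OF that] by linarith
    have "U = {} \<or> U = {0} \<or> U = {m} \<or> U = {0, m}"
      using U'(1) by blast
    then show "U \<in> {{}} \<union> (if ?P then {{0}} else {}) \<union> (if ?Q then {{m}} else {}) \<union> (if ?P \<and> ?Q then {{0, m}} else {})"
      using U'(1) ge by (elim disjE) auto
  qed
  then have "num_restricted adj {0, m} e X \<le>
      card ({{}} \<union> (if ?P then {{0}} else {}) \<union> (if ?Q then {{m}} else {}) \<union> (if ?P \<and> ?Q then {{0, m}} else {}))"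
    by (intro card_mono) auto
  also have "\<dots> \<le> 1 + of_bool ?P + of_bool ?Q + of_bool (?P \<and> ?Q)"
    by (intro order_trans[OF card_Un_le] add_mono) auto
  finally show ?thesis .
qed

lemma adj_0_m: "adj 0 m"
  by (simp add: adj_def child_def)

lemma edge_weights:
  shows "weight_out adj {0, m} l 0 m = l 0 * l m"
    and "weight_in adj {0, m} l 0 = l m / l 0"
    and "weight_in adj {0, m} l m = l 0 / l m"
proof -
  have irrefl: "\<not> adj 0 0" "\<not> adj m m"
    using adj_neq by blast+
  have fam: "indep_family adj {0, m} = {{}, {0}, {m}}"
  proof
    show "indep_family adj {0, m} \<subseteq> {{}, {0}, {m}}"
    proof
      fix I assume I: "I \<in> indep_family adj {0, m}"
      then have "I = {} \<or> I = {0} \<or> I = {m} \<or> I = {0, m}"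
        unfolding indep_family_def by blast
      then show "I \<in> {{}, {0}, {m}}"
        using I adj_0_m by (auto simp: indep_family_def)
    qed
    show "{{}, {0}, {m}} \<subseteq> indep_family adj {0, m}"
      using irrefl by (auto simp: indep_family_def)
  qed
  have sets: "{I \<in> {{}, {0}, {m}}. 0 \<notin> I \<and> m \<notin> I} = {{}}" "{I \<in> {{}, {0}, {m}}. 0 \<in> I} = {{0}}"
    "{I \<in> {{}, {0}, {m}}. m \<in> I} = {{m}}"
    using m_pos by auto
  show "weight_out adj {0, m} l 0 m = l 0 * l m"
    unfolding weight_out_def fam sets using m_pos by (simp add: weight_def)
  show "weight_in adj {0, m} l 0 = l m / l 0" "weight_in adj {0, m} l m = l 0 / l m"
    unfolding weight_in_def fam sets using m_pos by (simp_all add: weight_def)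
qed

text \<open>When only the ends of the root edge may be forced, 0 has no forced child and
  \<open>m\<close> has at most one, namely 0.\<close>

lemma edge_weight_bounds:
  assumes adm: "admissible A e l X" and A: "{0, m} \<subseteq> A" "\<And>c. c \<in> A \<Longrightarrow> c \<in> X \<Longrightarrow> c = 0 \<or> c = m"
  shows "1 \<le> l 0" "sqrt 2 / 2 \<le> l m"
proof -
  show "1 \<le> l 0"
  proof (cases "0 \<in> X")
    case True
    have "\<not> child 0 0" "\<not> child m 0"
      using m_pos by (auto simp: child_def)
    then have "{c \<in> A \<inter> X. child c 0} = {}"
      using A(2) by blast
    then have "credit A X 0 = 0"
      unfolding credit_def by (simp only: card.empty of_nat_0)
    then show ?thesis
      using admissible_forced[OF adm _ True] A by simp
  next
    case False
    then show ?thesis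
      using admissible_unforced(3)[OF adm] A by simp
  qed
  show "sqrt 2 / 2 \<le> l m"
  proof (cases "m \<in> X")
    case True
    have "\<not> child m m"
      using child_neq by blast
    then have "card {c \<in> A \<inter> X. child c m} \<le> card {0 :: nat}"
      using A(2) by (intro card_mono) blast+
    then have "wp (- 1) \<le> wp (- credit A X m)"
      unfolding credit_def by (intro wp_mono) auto
    then show ?thesis
      using admissible_forced[OF adm _ True] A by (simp add: wp_numerals)
  next
    case False
    have "sqrt 2 / 2 \<le> 1"
      using sqrt_2_bounds by simp
    then show ?thesis
      using admissible_unforced(3)[OF adm _ False] A by simp
  qed
qed

text \<open>The two sets containing one end have total weight at least 2, which pays for the empty
  set with its factor 2. A usable end pushes \<open>l 0 * l m\<close> up to at least 2, in the
  tightest case as 2 sqrt 2 times sqrt 2 / 2, and two usable ends push it up to 8.\<close>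

lemma bounded_by_weight_edge: "bounded_by_weight {0, m}"
  unfolding bounded_by_weight_def
proof (intro allI impI)
  fix e l X assume adm: "admissible {0, m} e l X"
  let ?P = "0 \<notin> X \<and> 3 \<le> e 0" and ?Q = "m \<notin> X \<and> 3 \<le> e m"
  note l = edge_weight_bounds[OF adm, simplified]
  have pos: "0 < l 0" "0 < l m"
    using admissible_pos[OF adm] by auto
  have wc: "weighted_count adj {0, m} l = l 0 * l m + (l m / l 0 + l 0 / l m)"
    using weighted_count_split[of "{0, m}" adj 0 m l] adj_0_m by (simp add: edge_weights)
  have P: "2 * sqrt 2 \<le> l 0" if ?P
    using wp_mono[of 3 "e 0"] admissible_unforced(2)[OF adm, of 0] that by (auto simp: wp_numerals)
  have Q: "2 * sqrt 2 \<le> l m" if ?Q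
    using wp_mono[of 3 "e m"] admissible_unforced(2)[OF adm, of m] that by (auto simp: wp_numerals)
  have "2 * real (num_restricted adj {0, m} e X) \<le> l 0 * l m + 2"
  proof (cases ?P; cases ?Q)
    assume *: ?P ?Q
    then have "2 * sqrt 2 * (2 * sqrt 2) \<le> l 0 * l m"
      using P Q pos by (intro mult_mono) auto
    then have "8 \<le> l 0 * l m"
      by simp
    then show ?thesis
      using num_restricted_edge_le[of e X] * by simp
  next
    assume *: ?P "\<not> ?Q"
    then have "2 * sqrt 2 * (sqrt 2 / 2) \<le> l 0 * l m"
      using P l pos by (intro mult_mono) auto
    then have "2 \<le> l 0 * l m"
      by simp
    then show ?thesis
      using num_restricted_edge_le[of e X] * by simp
  next
    assume *: "\<not> ?P" ?Q
    then have "1 * (2 * sqrt 2) \<le> l 0 * l m"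
      using Q l pos by (intro mult_mono) auto
    then have "2 \<le> l 0 * l m"
      using sqrt_2_bounds by simp
    then show ?thesis
      using num_restricted_edge_le[of e X] * by simp
  next
    assume *: "\<not> ?P" "\<not> ?Q"
    then have "num_restricted adj {0, m} e X \<le> 1"
      using num_restricted_edge_le[of e X] by (simp only: * simp_thms of_bool_eq add_0_right)
    moreover have "0 \<le> l 0 * l m"
      using pos by simp
    ultimately show ?thesis
      by simp
  qed
  also have "\<dots> \<le> weighted_count adj {0, m} l"
    unfolding wc using add_divide_swap_ge_2[OF pos] by simp
  finally show "2 * real (num_restricted adj {0, m} e X) \<le> weighted_count adj {0, m} l" .
qed

text \<open>The vertex 0 belongs to the root edge and cannot be removed together with
  \<open>k\<close>, so a light 0 is treated by direct counting: either 0 is forced or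
  \<open>e 0\<close> is at most 0, and apart from \<open>k\<close> only \<open>m\<close> can be
  used.\<close>

lemma triangle_bound:
  assumes leaf: "leaf_at adj {0, m} k 0 m" and adm: "admissible (insert k {0, m}) e l X"
    and k: "k \<notin> X" "e k = 2"
  shows "2 * real (num_restricted adj (insert k {0, m}) e X) \<le> weighted_count adj (insert k {0, m}) l"
proof (cases "sqrt 2 \<le> l 0")
  case True
  then show ?thesis
    using heavy_parent_bound[OF bounded_by_weight_edge leaf _ adm k] by (simp add: child_def)
next
  case False
  have l: "1 \<le> l 0" "sqrt 2 / 2 \<le> l m"
    using edge_weight_bounds[OF adm] k by auto
  have pos: "0 < l 0" "0 < l m"
    using admissible_pos[OF adm] by auto
  have lk: "2 \<le> l k"
    using admissible_unforced(2)[OF adm _ k(1)] k(2) by (simp add: wp_numerals)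
  have e0: "e 0 \<le> 0" if "0 \<notin> X"
  proof (rule ccontr)
    assume "\<not> e 0 \<le> 0"
    then have "wp 1 \<le> wp (e 0)"
      by (intro wp_mono) auto
    then show False
      using admissible_unforced(2)[OF adm _ that] False by (simp add: wp_numerals)
  qed
  define Q where "Q \<longleftrightarrow> m \<notin> X \<and> 2 \<le> e m"
  have "num_restricted adj (insert k {0, m}) e X \<le>
      num_restricted adj {0, m} (shift2 e 0 1 m 1) X + num_restricted adj {0, m} e (X \<union> {0, m})"
    by (rule num_restricted_leaf_2) fact+
  also have "num_restricted adj {0, m} e (X \<union> {0, m}) \<le> 1"
    using num_restricted_edge_le[of e "X \<union> {0, m}"] by simp
  also have "num_restricted adj {0, m} (shift2 e 0 1 m 1) X \<le> 1 + of_bool Q"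
  proof -
    have "\<not> (0 \<notin> X \<and> 3 \<le> shift2 e 0 1 m 1 0)" "m \<notin> X \<and> 3 \<le> shift2 e 0 1 m 1 m \<longleftrightarrow> Q"
      using e0 m_pos by (auto simp: shift2_def Q_def)
    then show ?thesis
      using num_restricted_edge_le[of "shift2 e 0 1 m 1" X] by (simp only: simp_thms of_bool_eq add_0_right)
  qed
  finally have nr: "2 * real (num_restricted adj (insert k {0, m}) e X) \<le> 4 + 2 * of_bool Q"
    by (cases Q) simp_all
  have "4 + 2 * of_bool Q \<le> 5 / 2 * (l 0 * l m) + 4"
  proof (cases Q)
    case True
    then have "2 \<le> l m"
      using wp_mono[of 2 "e m"] admissible_unforced(2)[OF adm, of m] by (auto simp: wp_numerals Q_def)
    then have "1 * 2 \<le> l 0 * l m"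
      using l by (intro mult_mono) auto
    then show ?thesis
      using True by simp
  next
    case False
    then show ?thesis
      using pos by simp
  qed
  also have "\<dots> \<le> (l k + 1 / l k) * (l 0 * l m) + l k * (l m / l 0 + l 0 / l m)"
    using add_inverse_ge[OF lk] lk add_divide_swap_ge_2[OF pos] pos
      mult_mono[of 2 "l k" 2 "l m / l 0 + l 0 / l m"]
    by (intro add_mono mult_right_mono) auto
  also have "\<dots> = weighted_count adj (insert k {0, m}) l"
    using weighted_count_leaf[where E = adj, OF leaf adj_0_m] by (simp add: edge_weights algebra_simps)
  finally show ?thesis
    using nr by linarith
qed

section \<open>Choosing the part to remove\<close>

text \<open>The base of \<open>c\<close> is a side of the triangle at \<open>q\<close> or of the
  triangle at \<open>lo c\<close>, which has the same right end \<open>q\<close>. Following the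
  second alternative to the left ends at the first.\<close>

lemma interval_nested_hi:
  assumes "0 < c" "c < m" "hi c = q" "q < m"
  shows "lo q \<le> lo c"
  using assms
proof (induction c rule: less_induct)
  case (less c)
  then consider "0 < lo c" "hi (lo c) = q" | "lo q = lo c"
    using base_edge[of c] by auto
  then show ?case
  proof cases
    case 1
    then show ?thesis
      using less.IH[of "lo c"] lo_less[of c] lo_less[of "lo c"] less.prems by fastforce
  qed simp
qed

lemma interval_nested_lo:
  assumes "0 < c" "c < m" "lo c = q" "0 < q"
  shows "hi c \<le> hi q"
  using assms
proof (induction "m - c" arbitrary: c rule: less_induct)
  case less
  then consider "hi c < m" "lo (hi c) = q" | "hi q = hi c"
    using base_edge[of c] by auto
  then show ?case
  proof cases
    case 1
    then show ?thesis
      using less.hyps[of "hi c"] hi_gt[of c] hi_gt[of "hi c"] less.prems by fastforce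
  qed simp
qed

text \<open>If every leaf is unforced with \<open>e\<close> equal to 2, consider a non-leaf
  \<open>q\<close> with shortest base interval. All its children are leaves, at most one on each
  side of its triangle. If \<open>q\<close> has weight at least \<open>sqrt 2\<close>, one child is
  removed; otherwise \<open>q\<close> goes together with all its children.\<close>

lemma closed_bounded: "closed_set A \<Longrightarrow> bounded_by_weight A"
proof (induction "card A" arbitrary: A rule: less_induct)
  case less
  note A = less.prems
  have fin: "finite A"
    using A by (rule closed_finite)
  have A0: "0 \<in> A" "m \<in> A" "A \<subseteq> {0..m}" "\<And>x. x \<in> A \<Longrightarrow> 0 < x \<Longrightarrow> x < m \<Longrightarrow> lo x \<in> A \<and> hi x \<in> A"
    using A unfolding closed_set_def by blast+
  have IH: "bounded_by_weight A'" if "closed_set A'" "A' \<subset> A" for A'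
    using less.hyps[OF psubset_card_mono[OF fin that(2)] that(1)] .
  define leaf where "leaf = (\<lambda>x. x \<in> A \<and> 0 < x \<and> x < m \<and> (\<forall>c\<in>A. \<not> child c x))"
  have leaf: "closed_set (A - {x})" "leaf_at adj (A - {x}) x (lo x) (hi x)" "insert x (A - {x}) = A"
    "bounded_by_weight (A - {x})" if "leaf x" for x
  proof -
    have x: "x \<in> A" "0 < x" "x < m" "\<forall>c\<in>A. \<not> child c x"
      using that by (auto simp: leaf_def)
    show *: "closed_set (A - {x})" "leaf_at adj (A - {x}) x (lo x) (hi x)"
      using leaf_facts[OF A x] by auto
    show "insert x (A - {x}) = A"
      using x by auto
    show "bounded_by_weight (A - {x})"
      using x by (intro IH[OF *(1)]) auto
  qed
  show "bounded_by_weight A"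
    unfolding bounded_by_weight_def
  proof (intro allI impI)
    fix e l X assume adm: "admissible A e l X"
    show "2 * real (num_restricted adj A e X) \<le> weighted_count adj A l"
    proof (cases "\<exists>v. leaf v \<and> (v \<in> X \<or> e v \<noteq> 2)")
      case True
      then obtain v where v: "leaf v" "v \<in> X \<or> e v \<noteq> 2"
        by blast
      note lv = leaf[OF v(1)]
      show ?thesis
        using easy_leaf_bound[OF lv(4,2), of e l X] adj_lo_hi[of v] adm v unfolding lv(3) by (auto simp: leaf_def)
    next
      case False
      then have hard: "v \<notin> X" "e v = 2" if "leaf v" for v
        using that by auto
      define node where "node = (\<lambda>x. x \<in> A \<and> 0 < x \<and> x < m \<and> \<not> leaf x)"
      show ?thesis
      proof (cases "\<exists>q. node q")
        case True
        obtain q where q: "node q" and qmin: "\<And>x. node x \<Longrightarrow> hi q - lo q \<le> hi x - lo x"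
          using ex_has_least_nat[of node _ "\<lambda>x. hi x - lo x"] True by blast
        have q': "q \<in> A" "0 < q" "q < m" "lo q < q" "q < hi q" "hi q \<le> m"
          using q lo_less hi_gt hi_le by (auto simp: node_def)
        have not_node: "\<not> node x" if "lo q \<le> lo x" "hi x \<le> hi q" "lo x < x" "x < hi x" "lo q < lo x \<or> hi x < hi q" for x
        proof
          assume "node x"
          then have "hi q - lo q \<le> hi x - lo x"
            by (rule qmin)
          then show False
            using that by linarith
        qed
        \<comment> \<open>Such a \<open>c\<close> spans a shorter interval than \<open>q\<close>, so
          it is a leaf by minimality. If its base did not start at \<open>lo q\<close>, then
          \<open>lo c\<close> would be a non-leaf, having the child \<open>c\<close>, and its
          interval would be shorter than that of \<open>q\<close>.\<close>
        have left: "leaf c \<and> lo c = lo q" if c: "c \<in> A" "0 < c" "c < m" "hi c = q" for c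
        proof
          have le: "lo q \<le> lo c"
            using interval_nested_hi[OF c(2-4) q'(3)] .
          have "\<not> node c"
            using le c q' lo_less[OF c(2,3)] hi_gt[OF c(2,3)] by (intro not_node) auto
          then show "leaf c"
            using c by (auto simp: node_def)
          show "lo c = lo q"
          proof (rule ccontr)
            assume ne: "lo c \<noteq> lo q"
            then have x: "0 < lo c" "hi (lo c) = q"
              using base_edge[OF c(2,3)] c q' by auto
            have "lo c < m" "lo c \<in> A"
              using lo_less[OF c(2,3)] c A0(4)[OF c(1-3)] by auto
            have "lo q \<le> lo (lo c)"
              using interval_nested_hi[OF x(1) \<open>lo c < m\<close> x(2) q'(3)] .
            then have "\<not> node (lo c)"
              using x q' lo_less[OF x(1) \<open>lo c < m\<close>] hi_gt[OF x(1) \<open>lo c < m\<close>] lo_less[OF c(2,3)] c by (intro not_node) auto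
            moreover have "child c (lo c)"
              using c by (simp add: child_def)
            ultimately show False
              using \<open>lo c \<in> A\<close> \<open>lo c < m\<close> x c by (auto simp: node_def leaf_def)
          qed
        qed
        have right: "leaf c \<and> hi c = hi q" if c: "c \<in> A" "0 < c" "c < m" "lo c = q" for c
        proof
          have le: "hi c \<le> hi q"
            using interval_nested_lo[OF c(2-4) q'(2)] .
          have "\<not> node c"
            using le c q' lo_less[OF c(2,3)] hi_gt[OF c(2,3)] by (intro not_node) auto
          then show "leaf c"
            using c by (auto simp: node_def)
          show "hi c = hi q"
          proof (rule ccontr)
            assume ne: "hi c \<noteq> hi q"
            then have x: "hi c < m" "lo (hi c) = q"
              using base_edge[OF c(2,3)] c q' by auto
            have "0 < hi c" "hi c \<in> A"
              using hi_gt[OF c(2,3)] c A0(4)[OF c(1-3)] by auto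
            have "hi (hi c) \<le> hi q"
              using interval_nested_lo[OF \<open>0 < hi c\<close> x q'(2)] .
            then have "\<not> node (hi c)"
              using x q' hi_gt[OF \<open>0 < hi c\<close> x(1)] lo_less[OF \<open>0 < hi c\<close> x(1)] hi_gt[OF c(2,3)] c by (intro not_node) auto
            moreover have "child c (hi c)"
              using c by (simp add: child_def)
            ultimately show False
              using \<open>hi c \<in> A\<close> \<open>0 < hi c\<close> x c by (auto simp: node_def leaf_def)
          qed
        qed
        have childq: "c \<in> A \<Longrightarrow> child c q \<longleftrightarrow> 0 < c \<and> c < m \<and> (hi c = q \<or> lo c = q)" for c
          using q' by (auto simp: child_def)
        obtain c0 where c0: "c0 \<in> A" "child c0 q"
          using q by (auto simp: node_def leaf_def)
        have pz: "adj (lo q) (hi q)"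
          using adj_lo_hi q' by blast
        show ?thesis
        proof (cases "sqrt 2 \<le> l q")
          case True
          have c: "leaf c0" "hi c0 = q \<and> lo c0 = lo q \<or> lo c0 = q \<and> hi c0 = hi q"
            using left right c0 childq by blast+
          note lc = leaf[OF c(1)]
          obtain b where b: "leaf_at adj (A - {c0}) c0 q b" "child q b"
          proof (cases "hi c0 = q")
            case True
            then have "leaf_at adj (A - {c0}) c0 q (lo q)" "child q (lo q)"
              using lc(2) c(2) leaf_at_commute[of adj _ c0 q] q' by (auto simp: child_def)
            then show ?thesis
              by (rule that)
          next
            case False
            then have "leaf_at adj (A - {c0}) c0 q (hi q)" "child q (hi q)"
              using lc(2) c(2) q' by (auto simp: child_def)
            then show ?thesis
              by (rule that)
          qed
          show ?thesis
            using heavy_parent_bound[OF lc(4) b, unfolded lc(3), OF adm hard[OF c(1)] True] .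
        next
          case False
          \<comment> \<open>The children of \<open>q\<close> are leaves and thus unforced here; a
            forced \<open>q\<close> has no credit, so its weight is still at least 1.\<close>
          have no_forced: "{c \<in> A \<inter> X. child c q} = {}"
            using childq left right hard by blast
          have lq: "1 \<le> l q"
          proof (cases "q \<in> X")
            case True
            have "credit A X q = 0"
              unfolding credit_def no_forced by simp
            then show ?thesis
              using admissible_forced[OF adm q'(1) True] by simp
          next
            case False
            then show ?thesis
              using admissible_unforced[OF adm q'(1)] by simp
          qed
          \<comment> \<open>An unforced \<open>q\<close> with positive \<open>e q\<close> would have
            weight at least \<open>sqrt 2\<close>.\<close>
          have eq: "q \<in> X \<or> e q = 0"
          proof (rule ccontr)
            assume "\<not> ?thesis"
            then have "q \<notin> X" "1 \<le> e q"
              using admissible_unforced(1)[OF adm q'(1)] by force+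
            then have "wp 1 \<le> l q"
              using wp_mono[of 1 "e q"] admissible_unforced(2)[OF adm q'(1)] by force
            then show False
              using False by (simp add: wp_numerals)
          qed
          have remove_q: "bounded_by_weight (B - {q})" "leaf_at adj (B - {q}) q (lo q) (hi q)" "insert q (B - {q}) = B"
            if "closed_set B" "B \<subseteq> A" "q \<in> B" "\<And>c. c \<in> B \<Longrightarrow> \<not> child c q" for B
          proof -
            have *: "closed_set (B - {q})" "leaf_at adj (B - {q}) q (lo q) (hi q)"
              using leaf_facts[OF that(1,3) q'(2,3)] that(4) by auto
            show "leaf_at adj (B - {q}) q (lo q) (hi q)"
              by fact
            show "bounded_by_weight (B - {q})"
              using that q' by (intro IH[OF *(1)]) auto
            show "insert q (B - {q}) = B"
              using that by auto
          qed
          have neq: "v \<noteq> q" if "leaf v" for v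
            using that q by (auto simp: node_def)
          have uniq: "c = d" if "leaf c" "leaf d" "lo c = lo d" "hi c = hi d" for c d
            using that base_inj by (auto simp: leaf_def)
          have "(\<exists>v\<in>A. 0 < v \<and> v < m \<and> hi v = q) \<or> (\<exists>u\<in>A. 0 < u \<and> u < m \<and> lo u = q)"
            using c0 childq by blast
          then consider (L) v where "leaf v" "hi v = q" "\<And>u. u \<in> A \<Longrightarrow> 0 < u \<Longrightarrow> u < m \<Longrightarrow> lo u \<noteq> q"
            | (R) u where "leaf u" "lo u = q" "\<And>v. v \<in> A \<Longrightarrow> 0 < v \<Longrightarrow> v < m \<Longrightarrow> hi v \<noteq> q"
            | (LR) v u where "leaf v" "hi v = q" "leaf u" "lo u = q"
            using left right by blast
          then show ?thesis
          proof cases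
            case L
            have lov: "lo v = lo q"
              using left L by (auto simp: leaf_def)
            have nc: "\<not> child c q" if "c \<in> A - {v}" for c
            proof
              assume "child c q"
              then have c: "c \<in> A" "0 < c" "c < m" "hi c = q"
                using that childq[of c] L(3)[of c] by auto
              then have "c = v"
                using uniq[of c v] left[OF c] lov L(1,2) c by auto
              then show False
                using that by simp
            qed
            note lv = leaf[OF L(1)]
            have "q \<in> A - {v}"
              using q' neq[OF L(1)] by auto
            then have rq: "bounded_by_weight (A - {v} - {q})" "leaf_at adj (A - {v} - {q}) q (lo q) (hi q)"
              "insert q (A - {v} - {q}) = A - {v}"
              using remove_q[OF lv(1) Diff_subset _ nc] by blast+
            have "leaf_at adj (A - {v}) v q (lo q)"
              using lv(2) lov L(2) leaf_at_commute[of adj _ v q] by simp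
            then show ?thesis
              using one_leaf_bound[OF rq(1) _ rq(2) pz, unfolded rq(3), where v = v, unfolded lv(3), OF _ adm hard[OF L(1)] lq eq]
              by blast
          next
            case R
            have hiu: "hi u = hi q"
              using right R by (auto simp: leaf_def)
            have nc: "\<not> child c q" if "c \<in> A - {u}" for c
            proof
              assume "child c q"
              then have c: "c \<in> A" "0 < c" "c < m" "lo c = q"
                using that childq[of c] R(3)[of c] by auto
              then have "c = u"
                using uniq[of c u] right[OF c] hiu R(1,2) c by auto
              then show False
                using that by simp
            qed
            note lu = leaf[OF R(1)]
            have "q \<in> A - {u}"
              using q' neq[OF R(1)] by auto
            then have rq: "bounded_by_weight (A - {u} - {q})" "leaf_at adj (A - {u} - {q}) q (lo q) (hi q)"
              "insert q (A - {u} - {q}) = A - {u}"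
              using remove_q[OF lu(1) Diff_subset _ nc] by blast+
            have "leaf_at adj (A - {u}) u q (hi q)"
              using lu(2) hiu R(2) by simp
            moreover have rq2: "leaf_at adj (A - {u} - {q}) q (hi q) (lo q)"
              using rq(2) leaf_at_commute[of adj _ q "hi q"] by simp
            ultimately show ?thesis
              using one_leaf_bound[OF rq(1) _ rq2 adj_sym[OF pz], unfolded rq(3), where v = u, unfolded lu(3), OF _ adm hard[OF R(1)] lq eq]
              by blast
          next
            case LR
            have lov: "lo v = lo q" and hiu: "hi u = hi q"
              using left right LR by (auto simp: leaf_def)
            have "u \<noteq> v"
              using LR lo_less[of u] hi_gt[of u] by (auto simp: leaf_def)
            note lv = leaf[OF LR(1)] and lu = leaf[OF LR(3)]
            have u: "u \<in> A - {v}" "0 < u" "u < m" "\<forall>c\<in>A - {v}. \<not> child c u"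
              using LR(3) \<open>u \<noteq> v\<close> by (auto simp: leaf_def)
            note fu = leaf_facts[OF lv(1) u]
            have nc: "\<not> child c q" if "c \<in> A - {v} - {u}" for c
            proof
              assume "child c q"
              then have c: "c \<in> A" "0 < c" "c < m" "hi c = q \<or> lo c = q"
                using that childq[of c] by auto
              from c(4) have "c = v \<or> c = u"
              proof
                assume h: "hi c = q"
                have "c = v"
                  using uniq[of c v] left[OF c(1-3) h] lov LR h by auto
                then show ?thesis ..
              next
                assume h: "lo c = q"
                have "c = u"
                  using uniq[of c u] right[OF c(1-3) h] hiu LR h by auto
                then show ?thesis ..
              qed
              then show False
                using that by auto
            qed
            have "q \<in> A - {v} - {u}" "A - {v} - {u} \<subseteq> A"
              using q' neq LR by auto
            then have rq: "bounded_by_weight (A - {v} - {u} - {q})" "leaf_at adj (A - {v} - {u} - {q}) q (lo q) (hi q)"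
              "insert q (A - {v} - {u} - {q}) = A - {v} - {u}"
              using remove_q[OF fu(1) _ _ nc] by blast+
            have iu: "insert u (A - {v} - {u}) = A - {v}"
              using u by auto
            have "leaf_at adj (A - {v}) v q (lo q)"
              using lv(2) lov LR(2) leaf_at_commute[of adj _ v q] by simp
            moreover have "leaf_at adj (A - {v} - {u}) u q (hi q)"
              using fu(2) hiu LR(4) by simp
            ultimately show ?thesis
              using two_leaves_bound[OF rq(1) _ _ rq(2) pz, unfolded rq(3), where u = u, unfolded iu, where v = v,
                  unfolded lv(3), OF _ _ adm hard[OF LR(1)] hard[OF LR(3)] lq eq]
              by blast
          qed
        qed
      next
        case no_node: False
        show ?thesis
        proof (cases "A = {0, m}")
          case True
          then show ?thesis
            using bounded_by_weight_edge adm by (simp add: bounded_by_weight_def)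
        next
          case False
          then obtain k where "k \<in> A" "k \<noteq> 0" "k \<noteq> m"
            using A0(1,2) by blast
          then have k: "k \<in> A" "0 < k" "k < m"
            using A0(3) by force+
          \<comment> \<open>When all interior vertices are leaves, none of them is an end of a base,
            so every base is the root edge, and this carries only one triangle.\<close>
          have leafs: "leaf x \<and> lo x = 0 \<and> hi x = m" if x: "x \<in> A" "0 < x" "x < m" for x
          proof -
            have "leaf x"
              using no_node x by (auto simp: node_def)
            have "lo x \<in> A" "hi x \<in> A" "child x (lo x)" "child x (hi x)"
              using A0(4)[OF x] x by (auto simp: child_def)
            moreover from this have "\<not> leaf (lo x)" "\<not> leaf (hi x)"
              using x by (auto simp: leaf_def)
            moreover have "leaf y" if "y \<in> A" "0 < y" "y < m" for y
              using no_node that by (auto simp: node_def)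
            ultimately have "\<not> 0 < lo x" "\<not> hi x < m"
              using lo_less[OF x(2,3)] hi_gt[OF x(2,3)] x by (meson less_trans)+
            then have "lo x = 0" "hi x = m"
              using hi_le[OF x(2,3)] by auto
            then show ?thesis
              using \<open>leaf x\<close> by blast
          qed
          have Ak: "A - {k} = {0, m}"
          proof
            show "A - {k} \<subseteq> {0, m}"
            proof
              fix x assume x: "x \<in> A - {k}"
              show "x \<in> {0, m}"
              proof (rule ccontr)
                assume "x \<notin> {0, m}"
                then have "0 < x" "x < m"
                  using x A0(3) by force+
                then have "x = k"
                  using base_inj[of x k] leafs[of x] leafs[of k] x k by auto
                then show False
                  using x by simp
              qed
            qed
            show "{0, m} \<subseteq> A - {k}"
              using A0 k by auto
          qed
          have lk: "leaf k" "lo k = 0" "hi k = m"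
            using leafs[OF k] by auto
          have "leaf_at adj {0, m} k 0 m" and eqA: "insert k {0, m} = A"
            using leaf(2,3)[OF lk(1)] unfolding lk(2,3) Ak by blast+
          then show ?thesis
            using triangle_bound[of k, unfolded eqA, OF _ adm hard[OF lk(1)]] by blast
        qed
      qed
    qed
  qed
qed

end

section \<open>Arcs in the plane\<close>

text \<open>Arcs are treated as point sets with named ends, so that joining, reversing and
  regrouping them needs no parametrisation.\<close>

definition arc_between :: "complex \<Rightarrow> complex \<Rightarrow> complex set \<Rightarrow> bool" where
  "arc_between a b S \<longleftrightarrow>
     (\<exists>g. arc g \<and> pathstart g = a \<and> pathfinish g = b \<and> path_image g = S)"

lemma arc_between_ends:
  assumes "arc_between a b S"
  shows "a \<in> S" "b \<in> S" "a \<noteq> b"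
  using assms arc_distinct_ends pathstart_in_path_image pathfinish_in_path_image
  unfolding arc_between_def by metis+

lemma arc_between_compact:
  assumes "arc_between a b S"
  shows "compact S"
  using assms compact_arc_image unfolding arc_between_def by blast

lemma arc_between_closed: "arc_between a b S \<Longrightarrow> closed S"
  by (simp add: arc_between_compact compact_imp_closed)

lemma arc_between_closed_Un: "arc_between a b S \<Longrightarrow> arc_between a' b' T \<Longrightarrow> closed (S \<union> T)"
  by (simp add: arc_between_closed closed_Un)

lemma arc_between_sym: "arc_between a b S \<Longrightarrow> arc_between b a S"
  unfolding arc_between_def
  by (metis arc_reversepath path_image_reversepath pathfinish_reversepath pathstart_reversepath)

lemma arc_between_join:
  assumes "arc_between a b S" "arc_between b c T" "S \<inter> T \<subseteq> {b}"
  shows "arc_between a c (S \<union> T)"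
proof -
  obtain g h where "arc g" "pathstart g = a" "pathfinish g = b" "path_image g = S"
    and "arc h" "pathstart h = b" "pathfinish h = c" "path_image h = T"
    using assms(1,2) unfolding arc_between_def by blast
  then show ?thesis
    unfolding arc_between_def using assms(3)
    by (intro exI[of _ "g +++ h"]) (auto simp: arc_join path_image_join)
qed

lemma arc_between_image:
  assumes "arc_between a b S" "continuous_on S f" "inj_on f S"
  shows "arc_between (f a) (f b) (f ` S)"
proof -
  obtain g where g: "arc g" "pathstart g = a" "pathfinish g = b" "path_image g = S"
    using assms(1) unfolding arc_between_def by blast
  have "arc (f \<circ> g)"
    using g assms(2,3) by (simp add: arc_def path_continuous_image comp_inj_on path_image_def)
  then show ?thesis
    unfolding arc_between_def using g
    by (intro exI[of _ "f \<circ> g"]) (auto simp: pathstart_compose pathfinish_compose path_image_compose)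
qed

lemma arc_between_interior:
  assumes "arc_between a b S"
  shows "connected (S - {a, b})" "S - {a, b} \<noteq> {}" "S \<subseteq> closure (S - {a, b})"
proof -
  obtain g where g: "arc g" "pathstart g = a" "pathfinish g = b" "path_image g = S"
    using assms unfolding arc_between_def by blast
  then have sp: "simple_path g"
    by (simp add: arc_imp_simple_path)
  show "connected (S - {a, b})" "S - {a, b} \<noteq> {}"
    using connected_simple_path_endless[OF sp] nonempty_simple_path_endless[OF sp] g by auto
  have "g ` closure {0<..<1} \<subseteq> closure (g ` {0<..<1})"
    using arc_imp_path[OF g(1)] by (intro continuous_image_closure_subset[of "{0..1}"]) (auto simp: path_def)
  moreover have "g ` {0<..<1} = S - {a, b}"
    using simple_path_endless[OF sp] g by simp
  ultimately show "S \<subseteq> closure (S - {a, b})"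
    using g(4) by (simp add: path_image_def)
qed

lemma jordan_two_arcs:
  assumes "arc_between a b S" "arc_between a b T" "S \<inter> T \<subseteq> {a, b}"
  shows "inside (S \<union> T) \<noteq> {}" "open (inside (S \<union> T))" "connected (inside (S \<union> T))"
    "connected (outside (S \<union> T))"
proof -
  obtain g h where g: "arc g" "pathstart g = a" "pathfinish g = b" "path_image g = S"
    and h: "arc h" "pathstart h = b" "pathfinish h = a" "path_image h = T"
    using assms(1) arc_between_sym[OF assms(2)] unfolding arc_between_def by blast
  have "simple_path (g +++ h)"
    using g h assms(3) by (intro simple_path_join_loop) auto
  from Jordan_inside_outside[OF this]
  show "inside (S \<union> T) \<noteq> {}" "open (inside (S \<union> T))" "connected (inside (S \<union> T))"
    "connected (outside (S \<union> T))"
    using g h by (auto simp: path_image_join)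
qed

lemma split_inside:
  assumes "arc_between a b S" "arc_between a b T" "arc_between a b U"
    and "S \<inter> T \<subseteq> {a, b}" "S \<inter> U \<subseteq> {a, b}" "T \<inter> U \<subseteq> {a, b}"
    and "U \<inter> inside (S \<union> T) \<noteq> {}"
  shows "inside (S \<union> U) \<inter> inside (T \<union> U) = {}"
    "inside (S \<union> U) \<union> inside (T \<union> U) \<union> (U - {a, b}) = inside (S \<union> T)"
proof -
  note ends = arc_between_ends[OF assms(1)] arc_between_ends[OF assms(2)]
    arc_between_ends[OF assms(3)]
  obtain g h k where g: "arc g" "pathstart g = a" "pathfinish g = b" "path_image g = S"
    and h: "arc h" "pathstart h = a" "pathfinish h = b" "path_image h = T"
    and k: "arc k" "pathstart k = a" "pathfinish k = b" "path_image k = U"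
    using assms(1-3) unfolding arc_between_def by blast
  have meet: "S \<inter> T = {a, b}" "S \<inter> U = {a, b}" "T \<inter> U = {a, b}"
    using assms(4-6) ends by auto
  have sp: "simple_path g" "simple_path h" "simple_path k"
    using g(1) h(1) k(1) by (simp_all add: arc_imp_simple_path)
  obtain "inside (path_image g \<union> path_image k) \<inter> inside (path_image h \<union> path_image k) = {}"
      "inside (path_image g \<union> path_image k) \<union> inside (path_image h \<union> path_image k) \<union>
        (path_image k - {a, b}) = inside (path_image g \<union> path_image h)"
  proof (rule split_inside_simple_closed_curve[OF sp(1) g(2,3) sp(2) h(2,3) sp(3) k(2,3) ends(3)])
    show "path_image k \<inter> inside (path_image g \<union> path_image h) \<noteq> {}"
      using assms(7) by (simp only: g(4) h(4) k(4) not_False_eq_True)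
  qed (simp_all only: g(4) h(4) k(4) meet)
  then show "inside (S \<union> U) \<inter> inside (T \<union> U) = {}"
    "inside (S \<union> U) \<union> inside (T \<union> U) \<union> (U - {a, b}) = inside (S \<union> T)"
    by (simp_all only: g(4) h(4) k(4))
qed

lemma connected_inside_or_outside:
  assumes "connected T" "T \<inter> S = {}" "T \<inter> inside S \<noteq> {}"
  shows "T \<subseteq> inside S"
  using inside_outside_intersect_connected[OF assms(1), of S] assms(2,3) inside_Un_outside[of S]
  by blast

lemma connected_outside_or_inside:
  assumes "connected T" "T \<inter> S = {}" "T \<inter> outside S \<noteq> {}"
  shows "T \<subseteq> outside S"
  using inside_outside_intersect_connected[OF assms(1), of S] assms(2,3) inside_Un_outside[of S]
  by blast

lemma connected_disjoint_open:
  fixes S :: "complex set"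
  assumes "connected S" "S \<subseteq> A \<union> B" "open A" "open B" "A \<inter> B = {}"
  shows "S \<subseteq> A \<or> S \<subseteq> B"
  using connectedD[OF assms(1,3,4)] assms(2,5) by blast

text \<open>The image of the punctured inside is connected and unbounded, hence lies outside the
  image curve. The image of the outside, completed by 0 as the image of infinity, is connected and
  misses that curve. It meets the nonempty inside of the image curve, because the points there can
  have no other origin.\<close>

lemma inversion_connected_outside:
  fixes J :: "complex set" and w :: complex
  defines "\<phi> \<equiv> \<lambda>z. inverse (z - w)"
  assumes J: "arc_between a b S" "arc_between a b T" "S \<inter> T \<subseteq> {a, b}" "J = S \<union> T"
    and w: "w \<in> inside J"
  shows "\<phi> ` outside J \<subseteq> inside (\<phi> ` J)"
proof -
  have cJ: "compact J"
    using J arc_between_compact by auto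
  then have clJ: "closed J"
    by (rule compact_imp_closed)
  have wJ: "w \<notin> J" "w \<notin> outside J"
    using w inside_no_overlap[of J] inside_Int_outside[of J] by blast+
  have cont: "continuous_on A \<phi>" if "w \<notin> A" for A
    unfolding \<phi>_def using that by (intro continuous_intros) auto
  have inj: "inj \<phi>"
    by (auto simp: inj_on_def \<phi>_def)
  have cK: "compact (\<phi> ` J)"
    using cJ cont[OF wJ(1)] by (rule compact_continuous_image[rotated])
  have in_out: "\<phi> ` (inside J - {w}) \<subseteq> outside (\<phi> ` J)"
  proof (rule connected_outside_or_inside)
    show "connected (\<phi> ` (inside J - {w}))"
      using jordan_two_arcs(2,3)[OF J(1-3)] J(4)
      by (intro connected_continuous_image cont connected_open_delete) auto
    show "\<phi> ` (inside J - {w}) \<inter> \<phi> ` J = {}"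
      using inside_no_overlap[of J] injD[OF inj] by blast
    obtain B where B: "0 < B" "\<forall>y \<in> - outside (\<phi> ` J). norm y \<le> B"
      using cobounded_outside[OF compact_imp_bounded[OF cK]] unfolding bounded_pos by blast
    obtain e where e: "0 < e" "ball w e \<subseteq> inside J"
      using jordan_two_arcs(2)[OF J(1-3)] J(4) w open_contains_ball by blast
    \<comment> \<open>Since \<open>t\<close> is less than \<open>e\<close>, the point stays inside
      the curve; since \<open>t\<close> is at most 1/(2 B), its image has norm beyond
      \<open>B\<close>.\<close>
    define t where "t = min (e / 2) (1 / (2 * B))"
    have t: "0 < t" "t < e" "t \<le> 1 / (2 * B)"
      using e(1) B(1) by (auto simp: t_def)
    have "B < 1 / t"
    proof -
      have "2 * (B * t) \<le> 1"
        using t(3) B(1) by (simp add: field_simps)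
      then have "B * t < 1"
        by linarith
      then show ?thesis
        using t(1) by (simp add: field_simps)
    qed
    moreover have "norm (\<phi> (w + of_real t)) = 1 / t"
      using t(1) by (simp add: \<phi>_def norm_divide inverse_eq_divide)
    ultimately have "\<phi> (w + of_real t) \<in> outside (\<phi> ` J)"
      using B(2) by (metis ComplI linorder_not_less)
    moreover have "w + of_real t \<in> inside J - {w}"
      using e(2) t by (auto simp: dist_norm subset_iff)
    ultimately show "\<phi> ` (inside J - {w}) \<inter> outside (\<phi> ` J) \<noteq> {}"
      by blast
  qed
  have "0 \<in> closure (\<phi> ` outside J)"
    unfolding closure_approachable
  proof (intro allI impI)
    fix e :: real assume e: "0 < e"
    have "\<not> bounded (outside J)"
      using cJ by (simp add: compact_imp_bounded unbounded_outside)
    then have "\<not> outside J \<subseteq> cball w (1 / e)"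
      using bounded_cball bounded_subset by blast
    then obtain z where z: "z \<in> outside J" "1 / e < norm (z - w)"
      by (auto simp: dist_norm norm_minus_commute subset_iff)
    then have "norm (\<phi> z) < e"
      using e less_imp_inverse_less[OF z(2)] by (simp add: \<phi>_def norm_inverse)
    then show "\<exists>y\<in>\<phi> ` outside J. dist y 0 < e"
      using z(1) by auto
  qed
  then have clos: "insert 0 (\<phi> ` outside J) \<subseteq> closure (\<phi> ` outside J)"
    by (simp add: closure_subset)
  have "connected (\<phi> ` outside J)"
    using jordan_two_arcs(4)[OF J(1-3)] unfolding J(4)[symmetric]
    by (rule connected_continuous_image[OF cont[OF wJ(2)]])
  then have "connected (insert 0 (\<phi> ` outside J))"
    using clos by (rule connected_intermediate_closure[OF _ subset_insertI])
  moreover have "insert 0 (\<phi> ` outside J) \<inter> \<phi> ` J = {}"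
  proof -
    have "0 \<notin> \<phi> ` J"
      using wJ(1) by (auto simp: \<phi>_def)
    then show ?thesis
      using outside_no_overlap[of J] injD[OF inj] by blast
  qed
  moreover have "insert 0 (\<phi> ` outside J) \<inter> inside (\<phi> ` J) \<noteq> {}"
  proof -
    have "inside (\<phi> ` J) \<noteq> {}"
    proof -
      have "\<phi> ` S \<inter> \<phi> ` T \<subseteq> {\<phi> a, \<phi> b}"
        using J(3) injD[OF inj] by blast
      moreover have "w \<notin> S" "w \<notin> T"
        using wJ(1) J(4) by auto
      ultimately show ?thesis
        using jordan_two_arcs(1)[OF arc_between_image[OF J(1) cont] arc_between_image[OF J(2) cont]]
          inj J(4) by (auto simp: image_Un inj_on_def)
    qed
    then obtain y where y: "y \<in> inside (\<phi> ` J)"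
      by blast
    show ?thesis
    proof (cases "y = 0")
      case False
      define z where "z = w + inverse y"
      have z: "\<phi> z = y" "z \<noteq> w"
        using False by (auto simp: z_def \<phi>_def)
      have "z \<notin> J"
        using y z inside_no_overlap[of "\<phi> ` J"] by blast
      moreover have "z \<notin> inside J"
        using in_out y z inside_Int_outside[of "\<phi> ` J"] by blast
      ultimately have "z \<in> outside J"
        using inside_Un_outside[of J] by blast
      then show ?thesis
        using y z(1) by blast
    qed (use y in blast)
  qed
  ultimately show ?thesis
    using connected_inside_or_outside by blast
qed

section \<open>Arcs with inner points on the outer face\<close>

text \<open>Otherwise \<open>U\<close> runs outside the closed curve formed by \<open>S\<close> and
  \<open>T\<close>. Inversion moves this side to the inside, where the image of \<open>U\<close>
  separates it into a half bordered by \<open>S\<close> and a half bordered by \<open>T\<close>. The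
  image of the outer face is connected and lies in one half, so it cannot approach both
  \<open>x\<close> and \<open>y\<close>.\<close>

lemma theta_inside:
  assumes arcs: "arc_between a b S" "arc_between a b T" "arc_between a b U"
    and meet: "S \<inter> T \<subseteq> {a, b}" "S \<inter> U \<subseteq> {a, b}" "T \<inter> U \<subseteq> {a, b}"
    and K: "compact K" "S \<union> T \<union> U \<subseteq> K"
    and x: "x \<in> S - {a, b}" "x \<in> closure (outside K)"
    and y: "y \<in> T - {a, b}" "y \<in> closure (outside K)"
  shows "U \<inter> inside (S \<union> T) \<noteq> {}"
proof
  assume none: "U \<inter> inside (S \<union> T) = {}"
  define J where "J = S \<union> T"
  note J = arcs(1,2) meet(1) J_def
  obtain w where w: "w \<in> inside J"
    using jordan_two_arcs(1)[OF J(1-3)] J_def by blast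
  define \<phi> where "\<phi> = (\<lambda>z. inverse (z - w))"
  have clJ: "closed J"
    using arcs arc_between_closed by (auto simp: J_def)
  have wJ: "w \<notin> J" "w \<notin> outside J"
    using w inside_no_overlap[of J] inside_Int_outside[of J] by blast+
  have wU: "w \<notin> U"
    using w none J_def by blast
  have cont: "continuous_on A \<phi>" if "w \<notin> A" for A
    unfolding \<phi>_def using that by (intro continuous_intros) auto
  have inj: "inj \<phi>"
    by (auto simp: inj_on_def \<phi>_def)
  have out_in: "\<phi> ` outside J \<subseteq> inside (\<phi> ` J)"
    using inversion_connected_outside[OF J w] unfolding \<phi>_def .
  have arcs': "arc_between (\<phi> a) (\<phi> b) (\<phi> ` S)" "arc_between (\<phi> a) (\<phi> b) (\<phi> ` T)"
    "arc_between (\<phi> a) (\<phi> b) (\<phi> ` U)"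
    using arcs wJ wU inj by (auto intro!: arc_between_image cont simp: J_def inj_on_def)
  have meet': "\<phi> ` S \<inter> \<phi> ` T \<subseteq> {\<phi> a, \<phi> b}" "\<phi> ` S \<inter> \<phi> ` U \<subseteq> {\<phi> a, \<phi> b}"
    "\<phi> ` T \<inter> \<phi> ` U \<subseteq> {\<phi> a, \<phi> b}"
    using meet injD[OF inj] by blast+
  obtain u where u: "u \<in> U - {a, b}"
    using arc_between_interior(2)[OF arcs(3)] by blast
  have "u \<in> outside J"
    using u none meet(2,3) inside_Un_outside[of "S \<union> T"] unfolding J_def by blast
  then have "\<phi> ` U \<inter> inside (\<phi> ` S \<union> \<phi> ` T) \<noteq> {}"
    using out_in u by (auto simp: J_def image_Un)
  note split = split_inside[OF arcs' meet' this]
  have W: "outside K \<subseteq> outside J"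
    using K(2) by (intro outside_mono) (auto simp: J_def)
  have "closure (outside K) \<subseteq> - inside J"
  proof (rule closure_minimal)
    show "outside K \<subseteq> - inside J"
      using W inside_Int_outside[of J] by blast
    show "closed (- inside J)"
      using clJ by (simp add: closed_Compl open_inside)
  qed
  then have wW: "w \<notin> closure (outside K)"
    using w by blast
  \<comment> \<open>Limit points of the outer face are sent into the half containing its image or
    onto the boundary curve of that half.\<close>
  have lim: "\<phi> z \<in> inside Z \<union> Z" if "\<phi> ` outside K \<subseteq> inside Z" "closed Z" "z \<in> closure (outside K)" for z Z
  proof -
    have "\<phi> z \<in> closure (\<phi> ` outside K)"
      using continuous_image_closure_subset[OF cont[OF wW] subset_refl] that(3) by blast
    also have "\<dots> \<subseteq> closure (inside Z)"
      using that(1) by (rule closure_mono)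
    also have "\<dots> \<subseteq> inside Z \<union> Z"
      using closure_inside_subset[OF that(2)] by blast
    finally show ?thesis .
  qed
  have off: "\<phi> z \<notin> inside (\<phi> ` S \<union> \<phi> ` T)" if "z \<in> J" for z
    using that inside_no_overlap[of "\<phi> ` S \<union> \<phi> ` T"] unfolding J_def by blast
  have opens: "open (inside (\<phi> ` S \<union> \<phi> ` U))" "open (inside (\<phi> ` T \<union> \<phi> ` U))"
    using arcs' arc_between_closed_Un open_inside by blast+
  have "outside K \<inter> K = {}"
    by simp
  then have "\<phi> ` outside K \<inter> \<phi> ` U = {}"
    using K(2) injD[OF inj] by blast
  then have sub: "\<phi> ` outside K \<subseteq> inside (\<phi> ` S \<union> \<phi> ` U) \<union> inside (\<phi> ` T \<union> \<phi> ` U)"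
    using subset_trans[OF image_mono[OF W] out_in] split(2) unfolding J_def image_Un by blast
  have "connected (\<phi> ` outside K)"
    using W wJ K(1) by (intro connected_continuous_image cont connected_outside)
      (auto simp: compact_imp_bounded)
  from connected_disjoint_open[OF this sub opens split(1)] show False
  proof
    assume sub: "\<phi> ` outside K \<subseteq> inside (\<phi> ` S \<union> \<phi> ` U)"
    have "\<phi> y \<in> inside (\<phi> ` S \<union> \<phi> ` U) \<union> (\<phi> ` S \<union> \<phi> ` U)"
      using lim[OF sub arc_between_closed_Un[OF arcs'(1,3)] y(2)] .
    moreover have "\<phi> y \<notin> \<phi> ` S \<union> \<phi> ` U"
      using y(1) meet injD[OF inj] by blast
    ultimately show False
      using off[of y] y(1) split(2) J_def by blast
  next
    assume sub: "\<phi> ` outside K \<subseteq> inside (\<phi> ` T \<union> \<phi> ` U)"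
    have "\<phi> x \<in> inside (\<phi> ` T \<union> \<phi> ` U) \<union> (\<phi> ` T \<union> \<phi> ` U)"
      using lim[OF sub arc_between_closed_Un[OF arcs'(2,3)] x(2)] .
    moreover have "\<phi> x \<notin> \<phi> ` T \<union> \<phi> ` U"
      using x(1) meet injD[OF inj] by blast
    ultimately show False
      using off[of x] x(1) split(2) J_def by blast
  qed
qed

text \<open>By \<open>theta_inside\<close> the third arc runs inside the closed curve formed by the
  other two, where no point is a limit of the outer face.\<close>

lemma no_outer_theta:
  assumes arcs: "arc_between a b S" "arc_between a b T" "arc_between a b U"
    and meet: "S \<inter> T \<subseteq> {a, b}" "S \<inter> U \<subseteq> {a, b}" "T \<inter> U \<subseteq> {a, b}"
    and K: "compact K" "S \<union> T \<union> U \<subseteq> K"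
    and x: "x \<in> S - {a, b}" "x \<in> closure (outside K)"
    and y: "y \<in> T - {a, b}" "y \<in> closure (outside K)"
    and z: "z \<in> U - {a, b}" "z \<in> closure (outside K)"
  shows False
proof -
  have "(U - {a, b}) \<inter> inside (S \<union> T) \<noteq> {}"
    using theta_inside[OF arcs meet K x y] inside_no_overlap[of "S \<union> T"] arc_between_ends[OF arcs(1)]
    by blast
  moreover have "(U - {a, b}) \<inter> (S \<union> T) = {}"
    using meet by blast
  ultimately have "z \<in> inside (S \<union> T)"
    using connected_inside_or_outside[OF arc_between_interior(1)[OF arcs(3)]] z(1) by blast
  moreover have "inside (S \<union> T) \<inter> outside K = {}"
    using outside_mono[of "S \<union> T" K] K(2) inside_Int_outside[of "S \<union> T"] by blast
  ultimately show False
    using z(2) jordan_two_arcs(2)[OF arcs(1,2) meet(1)] by (metis disjoint_iff open_Int_closure_eq_empty)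
qed

text \<open>One closed curve is cut both at \<open>a\<close>, \<open>c\<close> and at
  \<open>b\<close>, \<open>d\<close>, so \<open>theta_inside\<close> puts both chords inside it. The
  chord \<open>U\<close> splits the inside into halves bordered by \<open>S\<close> and by
  \<open>T\<close>. The disjoint chord \<open>U'\<close> stays within one half, although its end
  \<open>b\<close> lies on \<open>S\<close> and its end \<open>d\<close> on
  \<open>T\<close>.\<close>

lemma no_outer_crossing:
  assumes arcs: "arc_between a c S" "arc_between a c T" "arc_between a c U"
    and arcs': "arc_between b d S'" "arc_between b d T'" "arc_between b d U'"
    and same: "S' \<union> T' = S \<union> T"
    and meet: "S \<inter> T \<subseteq> {a, c}" "S \<inter> U \<subseteq> {a, c}" "T \<inter> U \<subseteq> {a, c}"
    and meet': "S' \<inter> T' \<subseteq> {b, d}" "S' \<inter> U' \<subseteq> {b, d}" "T' \<inter> U' \<subseteq> {b, d}"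
    and disj: "U \<inter> U' = {}"
    and K: "compact K" "S \<union> T \<union> U \<union> U' \<subseteq> K"
    and mem: "b \<in> S" "d \<in> T" "a \<in> S'" "c \<in> T'"
    and outer: "{a, b, c, d} \<subseteq> closure (outside K)"
  shows False
proof -
  have "a \<notin> U'" "c \<notin> U'" "b \<notin> U" "d \<notin> U"
    using disj arc_between_ends(1,2)[OF arcs(3)] arc_between_ends(1,2)[OF arcs'(3)]
    unfolding disjoint_iff by metis+
  then have neq: "a \<notin> {b, d}" "c \<notin> {b, d}" and bd: "b \<notin> U" "d \<notin> U"
    using arc_between_ends(1,2)[OF arcs'(3)] by auto
  have int: "b \<in> S - {a, c}" "d \<in> T - {a, c}" "a \<in> S' - {b, d}" "c \<in> T' - {b, d}"
    using mem neq by auto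
  have sub: "S \<union> T \<union> U \<subseteq> K" "S' \<union> T' \<union> U' \<subseteq> K"
    unfolding same using K(2) by blast+
  have out: "a \<in> closure (outside K)" "b \<in> closure (outside K)" "c \<in> closure (outside K)"
    "d \<in> closure (outside K)"
    using outer by auto
  have "U \<inter> inside (S \<union> T) \<noteq> {}"
    using theta_inside[OF arcs meet K(1) sub(1) int(1) out(2) int(2) out(4)] .
  note split = split_inside[OF arcs meet this]
  have "U' \<inter> inside (S' \<union> T') \<noteq> {}"
    using theta_inside[OF arcs' meet' K(1) sub(2) int(3) out(1) int(4) out(3)] .
  then have "(U' - {b, d}) \<inter> inside (S' \<union> T') \<noteq> {}"
    using inside_no_overlap[of "S' \<union> T'"] arc_between_ends(1,2)[OF arcs'(1)] by blast
  moreover have "(U' - {b, d}) \<inter> (S' \<union> T') = {}"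
    using meet'(2,3) by blast
  ultimately have "U' - {b, d} \<subseteq> inside (S \<union> T)"
    unfolding same[symmetric]
    using connected_inside_or_outside[OF arc_between_interior(1)[OF arcs'(3)]] by simp
  then have sub: "U' - {b, d} \<subseteq> inside (S \<union> U) \<union> inside (T \<union> U)"
    using split(2) disj by blast
  have clos: "closed (S \<union> U)" "closed (T \<union> U)"
    using arcs arc_between_closed_Un by blast+
  have off: "z \<notin> inside (S \<union> T)" if "z \<in> S \<union> T" for z
    using that inside_no_overlap[of "S \<union> T"] by blast
  have ends: "b \<in> closure (U' - {b, d})" "d \<in> closure (U' - {b, d})"
    using arc_between_interior(3)[OF arcs'(3)] arc_between_ends(1,2)[OF arcs'(3)] by blast+
  from connected_disjoint_open[OF arc_between_interior(1)[OF arcs'(3)] sub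
      open_inside[OF clos(1)] open_inside[OF clos(2)] split(1)]
  show False
  proof
    assume "U' - {b, d} \<subseteq> inside (S \<union> U)"
    then have "d \<in> inside (S \<union> U) \<union> (S \<union> U)"
      using closure_mono[of "U' - {b, d}" "inside (S \<union> U)"] closure_inside_subset[OF clos(1)] ends(2)
      by blast
    moreover have "d \<notin> S \<union> U"
      using int(2) meet(1) bd(2) by blast
    ultimately show False
      using off[of d] mem(2) split(2) by blast
  next
    assume "U' - {b, d} \<subseteq> inside (T \<union> U)"
    then have "b \<in> inside (T \<union> U) \<union> (T \<union> U)"
      using closure_mono[of "U' - {b, d}" "inside (T \<union> U)"] closure_inside_subset[OF clos(2)] ends(1)
      by blast
    moreover have "b \<notin> T \<union> U"
      using int(1) meet(1) bd(1) by blast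
    ultimately show False
      using off[of b] mem(1) split(2) by blast
  qed
qed

section \<open>Outerplanar drawings\<close>

text \<open>Unordered pairs are collected because they index the curves of a drawing.\<close>

fun edges_of :: "'a list \<Rightarrow> 'a set set" where
  "edges_of (x # y # zs) = insert {x, y} (edges_of (y # zs))"
| "edges_of _ = {}"

lemma edges_of_append: "edges_of (xs @ x # ys) = edges_of (xs @ [x]) \<union> edges_of (x # ys)"
  by (induction xs rule: edges_of.induct) (cases ys; auto)+

lemma edges_of_subset: "e \<in> edges_of xs \<Longrightarrow> e \<subseteq> set xs"
  by (induction xs rule: edges_of.induct) auto

text \<open>Two paths that meet only in \<open>a\<close> and \<open>b\<close> could share no edge
  other than \<open>a b\<close>; this excludes that edge too, so their curves meet only in the two
  ends.\<close>

lemma ends_notin_edges_of: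
  assumes "distinct (a # P @ [b])" "P \<noteq> []"
  shows "{a, b} \<notin> edges_of (a # P @ [b])"
proof -
  obtain x xs where P: "P = x # xs"
    using assms(2) by (cases P) auto
  have "{a, b} \<notin> edges_of (x # xs @ [b])"
    using edges_of_subset[of "{a, b}" "x # xs @ [b]"] assms(1) P by auto
  then show ?thesis
    using assms(1) P by (auto simp: doubleton_eq_iff)
qed

locale plane_drawing =
  fixes G :: "'a pair_pre_digraph" and p c
  assumes graph: "pair_graph G" and embedding: "plane_embedding G p c"
begin

abbreviation E :: "'a \<Rightarrow> 'a \<Rightarrow> bool" where
  "E u v \<equiv> (u, v) \<in> parcs G"

abbreviation V :: "'a set" where
  "V \<equiv> pverts G"

definition trace :: "'a list \<Rightarrow> complex set" where
  "trace xs = (\<Union>e\<in>edges_of xs. path_image (c e))"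

lemma E_sym: "E u v \<Longrightarrow> E v u"
proof -
  interpret pair_graph G
    by (rule graph)
  show "E u v \<Longrightarrow> E v u"
    using sym_arcs by (auto simp: symmetric_def with_proj_simps dest: symD)
qed

lemma E_irrefl: "\<not> E u u"
proof -
  interpret pair_graph G
    by (rule graph)
  show ?thesis
    using pair_no_loops[of "(u, u)"] by auto
qed

lemma E_verts: "E u v \<Longrightarrow> u \<in> V" "E u v \<Longrightarrow> v \<in> V"
proof -
  interpret pair_graph G
    by (rule graph)
  show "E u v \<Longrightarrow> u \<in> V" "E u v \<Longrightarrow> v \<in> V"
    using arc_fst_in_verts[of "(u, v)"] arc_snd_in_verts[of "(u, v)"] by auto
qed

lemma finite_V: "finite V" and finite_arcs: "finite (parcs G)"
proof -
  interpret pair_graph G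
    by (rule graph)
  show "finite V" "finite (parcs G)"
    by (rule pair_finite_verts, rule pair_finite_arcs)
qed

lemma inj_p: "inj_on p V"
  using embedding by (simp add: plane_embedding_def)

lemma p_eq: "u \<in> V \<Longrightarrow> v \<in> V \<Longrightarrow> p u = p v \<longleftrightarrow> u = v"
  using inj_p by (auto dest: inj_onD)

lemma edge_arc:
  assumes "E u v"
  shows "arc_between (p u) (p v) (path_image (c {u, v}))"
    "path_image (c {u, v}) \<inter> p ` V = {p u, p v}"
proof -
  have e: "arc (c {u, v})" "{pathstart (c {u, v}), pathfinish (c {u, v})} = {p u, p v}"
      "path_image (c {u, v}) \<inter> p ` V = {p u, p v}"
    using embedding assms unfolding plane_embedding_def by blast+
  have "arc_between (pathstart (c {u, v})) (pathfinish (c {u, v})) (path_image (c {u, v}))"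
    using e(1) unfolding arc_between_def by blast
  then show "arc_between (p u) (p v) (path_image (c {u, v}))"
    using e(2) arc_between_sym by (metis doubleton_eq_iff)
  show "path_image (c {u, v}) \<inter> p ` V = {p u, p v}"
    by (rule e(3))
qed

lemma edge_meet:
  assumes "E u v" "E x y" "{u, v} \<noteq> {x, y}"
  shows "path_image (c {u, v}) \<inter> path_image (c {x, y}) \<subseteq> p ` ({u, v} \<inter> {x, y})"
proof -
  have all: "\<forall>(u, v) \<in> parcs G. \<forall>(x, y) \<in> parcs G. {u, v} \<noteq> {x, y} \<longrightarrow>
      path_image (c {u, v}) \<inter> path_image (c {x, y}) \<subseteq> p ` V"
    using embedding unfolding plane_embedding_def by (elim conjE)
  have "path_image (c {u, v}) \<inter> path_image (c {x, y}) \<subseteq> p ` V"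
    using bspec[OF bspec[OF all assms(1), unfolded prod.case] assms(2), unfolded prod.case] assms(3)
    by (rule mp)
  then have "path_image (c {u, v}) \<inter> path_image (c {x, y}) \<subseteq> p ` {u, v} \<inter> p ` {x, y}"
    using edge_arc(2)[OF assms(1)] edge_arc(2)[OF assms(2)] by auto
  also have "\<dots> = p ` ({u, v} \<inter> {x, y})"
    using E_verts assms(1,2) by (intro inj_on_image_Int[OF inj_p, symmetric]) auto
  finally show ?thesis .
qed

lemma edges_of_E:
  assumes "successively E xs" "e \<in> edges_of xs"
  obtains u v where "E u v" "e = {u, v}"
  using assms by (induction xs rule: edges_of.induct) auto

lemma trace_meet:
  assumes "successively E xs" "successively E ys" "edges_of xs \<inter> edges_of ys = {}"
  shows "trace xs \<inter> trace ys \<subseteq> p ` (set xs \<inter> set ys)"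
proof
  fix z assume "z \<in> trace xs \<inter> trace ys"
  then obtain e f where ef: "e \<in> edges_of xs" "f \<in> edges_of ys" "z \<in> path_image (c e)" "z \<in> path_image (c f)"
    by (auto simp: trace_def)
  obtain u v where uv: "E u v" "e = {u, v}"
    using edges_of_E[OF assms(1) ef(1)] .
  obtain x y where xy: "E x y" "f = {x, y}"
    using edges_of_E[OF assms(2) ef(2)] .
  have "e \<noteq> f"
    using ef(1,2) assms(3) by blast
  then have "{u, v} \<noteq> {x, y}"
    using uv(2) xy(2) by simp
  then have "z \<in> p ` (e \<inter> f)"
    using edge_meet[OF uv(1) xy(1)] ef(3,4) unfolding uv(2) xy(2) by blast
  then show "z \<in> p ` (set xs \<inter> set ys)"
    using edges_of_subset[OF ef(1)] edges_of_subset[OF ef(2)] by blast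
qed

lemma trace_verts:
  assumes "successively E xs" "2 \<le> length xs" "v \<in> set xs"
  shows "p v \<in> trace xs"
  using assms
proof (induction xs rule: edges_of.induct)
  case (1 x y zs)
  have ends: "p x \<in> path_image (c {x, y})" "p y \<in> path_image (c {x, y})"
    using edge_arc(2)[of x y] "1.prems"(1) by auto
  show ?case
  proof (cases "v = x \<or> v = y")
    case True
    then show ?thesis
      using ends by (auto simp: trace_def)
  next
    case False
    then have "p v \<in> trace (y # zs)"
      using "1.IH" "1.prems" by (cases zs) auto
    then show ?thesis
      by (auto simp: trace_def)
  qed
qed auto

lemma trace_arc:
  assumes "distinct xs" "successively E xs" "2 \<le> length xs"
  shows "arc_between (p (hd xs)) (p (last xs)) (trace xs)"
  using assms
proof (induction xs rule: edges_of.induct)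
  case (1 x y zs)
  have E: "E x y"
    using "1.prems"(2) by simp
  show ?case
  proof (cases "zs = []")
    case True
    then show ?thesis
      using edge_arc(1)[OF E] by (simp add: trace_def)
  next
    case False
    then have *: "arc_between (p y) (p (last zs)) (trace (y # zs))"
      using "1.IH" "1.prems" by (cases zs) auto
    have "{x, y} \<notin> edges_of (y # zs)"
      using edges_of_subset[of "{x, y}" "y # zs"] "1.prems"(1) by auto
    then have "trace [x, y] \<inter> trace (y # zs) \<subseteq> p ` (set [x, y] \<inter> set (y # zs))"
      using "1.prems"(2) by (intro trace_meet) auto
    moreover have "set [x, y] \<inter> set (y # zs) = {y}"
      using "1.prems"(1) by auto
    ultimately have "trace [x, y] \<inter> trace (y # zs) \<subseteq> {p y}"
      by (simp only: image_insert image_empty)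
    moreover have "trace [x, y] = path_image (c {x, y})"
      by (simp add: trace_def)
    ultimately have "path_image (c {x, y}) \<inter> trace (y # zs) \<subseteq> {p y}"
      by (simp only:)
    then show ?thesis
      using arc_between_join[OF edge_arc(1)[OF E] *] False by (simp add: trace_def)
  qed
qed auto

lemma trace_drawing:
  assumes "successively E xs"
  shows "trace xs \<subseteq> drawing G p c"
proof
  fix z assume "z \<in> trace xs"
  then obtain e where e: "e \<in> edges_of xs" "z \<in> path_image (c e)"
    by (auto simp: trace_def)
  obtain u v where "E u v" "e = {u, v}"
    using edges_of_E[OF assms e(1)] .
  then show "z \<in> drawing G p c"
    using e(2) unfolding drawing_def by blast
qed

lemma compact_drawing: "compact (drawing G p c)"
proof -
  have "compact (path_image (c {u, v}))" if "E u v" for u v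
    using edge_arc(1)[OF that] by (rule arc_between_compact)
  then show ?thesis
    unfolding drawing_def
    by (intro compact_Un compact_UN finite_arcs finite_imp_compact[OF finite_imageI[OF finite_V]]) auto
qed

lemma trace_meet_ends:
  assumes xs: "xs = a # P @ [b]" and "P \<noteq> []" and "successively E xs" "successively E ys"
    and "distinct xs" and "set xs \<inter> set ys \<subseteq> {a, b}"
  shows "trace xs \<inter> trace ys \<subseteq> {p a, p b}"
proof -
  have "e \<notin> edges_of ys" if e: "e \<in> edges_of xs" for e
  proof
    assume ys: "e \<in> edges_of ys"
    obtain u v where uv: "E u v" "e = {u, v}"
      using edges_of_E[OF assms(3) e] .
    have "e \<subseteq> {a, b}"
      using edges_of_subset[OF e] edges_of_subset[OF ys] assms(6) by blast
    then have "e = {a, b}"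
      using uv E_irrefl by auto
    then show False
      using ends_notin_edges_of[of a P b] assms(2,5) e unfolding xs by blast
  qed
  then have "edges_of xs \<inter> edges_of ys = {}"
    by blast
  then have "trace xs \<inter> trace ys \<subseteq> p ` (set xs \<inter> set ys)"
    by (rule trace_meet[OF assms(3,4)])
  also have "\<dots> \<subseteq> p ` {a, b}"
    using assms(6) by (rule image_mono)
  finally show ?thesis
    by simp
qed

lemma successively_split:
  "successively Q (w # xs @ x # ys) \<longleftrightarrow> successively Q (w # xs @ [x]) \<and> successively Q (x # ys)"
  by (induction xs arbitrary: w) auto

context
  assumes outer: "p ` V \<subseteq> frontier (outside (drawing G p c))"
begin

lemma outer_closure: "v \<in> V \<Longrightarrow> p v \<in> closure (outside (drawing G p c))"
  using outer by (auto simp: frontier_def)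

text \<open>Each of the three paths has an inner vertex, and every vertex touches the outer face, so
  the traces of the paths are arcs of the kind excluded by \<open>no_outer_theta\<close>.\<close>

lemma drawing_theta_free: "theta_free E V"
  unfolding theta_free_def
proof (intro allI impI notI; elim conjE)
  fix a b P Q R
  assume ne: "P \<noteq> []" "Q \<noteq> []" "R \<noteq> []" and dist: "distinct (a # b # P @ Q @ R)"
    and V: "set (a # b # P @ Q @ R) \<subseteq> V"
    and P: "successively E (a # P @ [b])" and Q: "successively E (a # Q @ [b])"
    and R: "successively E (a # R @ [b])"
  have arc: "arc_between (p a) (p b) (trace (a # X @ [b]))"
    if "successively E (a # X @ [b])" "distinct (a # X @ [b])" for X
    using trace_arc[OF that(2,1)] by simp
  have dists: "distinct (a # P @ [b])" "distinct (a # Q @ [b])" "distinct (a # R @ [b])"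
    using dist by auto
  have sets: "set (a # P @ [b]) \<inter> set (a # Q @ [b]) \<subseteq> {a, b}"
    "set (a # P @ [b]) \<inter> set (a # R @ [b]) \<subseteq> {a, b}"
    "set (a # Q @ [b]) \<inter> set (a # R @ [b]) \<subseteq> {a, b}"
    using dist by auto
  have inner: "\<exists>z. z \<in> trace (a # X @ [b]) - {p a, p b} \<and> z \<in> closure (outside (drawing G p c))"
    if X: "X \<noteq> []" "successively E (a # X @ [b])" "distinct (a # X @ [b])" "set (a # X @ [b]) \<subseteq> V" for X
  proof -
    obtain x where x: "x \<in> set X"
      using X(1) by (cases X) auto
    have "p x \<in> trace (a # X @ [b])"
      using X(2) x by (intro trace_verts) auto
    moreover have "x \<in> V" "a \<in> V" "b \<in> V" "x \<noteq> a" "x \<noteq> b"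
      using X(3,4) x by auto
    ultimately show ?thesis
      using outer_closure p_eq by blast
  qed
  have Vs: "set (a # P @ [b]) \<subseteq> V" "set (a # Q @ [b]) \<subseteq> V" "set (a # R @ [b]) \<subseteq> V"
    using V by auto
  obtain x where x: "x \<in> trace (a # P @ [b]) - {p a, p b}" "x \<in> closure (outside (drawing G p c))"
    using inner[OF ne(1) P dists(1) Vs(1)] by blast
  obtain y where y: "y \<in> trace (a # Q @ [b]) - {p a, p b}" "y \<in> closure (outside (drawing G p c))"
    using inner[OF ne(2) Q dists(2) Vs(2)] by blast
  obtain z where z: "z \<in> trace (a # R @ [b]) - {p a, p b}" "z \<in> closure (outside (drawing G p c))"
    using inner[OF ne(3) R dists(3) Vs(3)] by blast
  have sub: "trace (a # P @ [b]) \<union> trace (a # Q @ [b]) \<union> trace (a # R @ [b]) \<subseteq> drawing G p c"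
    using P Q R by (intro Un_least trace_drawing)
  show False
    by (rule no_outer_theta[OF arc[OF P dists(1)] arc[OF Q dists(2)] arc[OF R dists(3)]
          trace_meet_ends[OF refl ne(1) P Q dists(1) sets(1)]
          trace_meet_ends[OF refl ne(1) P R dists(1) sets(2)]
          trace_meet_ends[OF refl ne(2) Q R dists(2) sets(3)]
          compact_drawing sub x y z])
qed

text \<open>The cycle is cut at \<open>w\<close>, \<open>y\<close> into \<open>S\<close>,
  \<open>T\<close> and at \<open>x\<close>, \<open>z\<close> into \<open>S'\<close>,
  \<open>T'\<close>; both pairs consist of the same four pieces and hence have the same
  trace.\<close>

lemma drawing_crossing_free: "crossing_free E V"
  unfolding crossing_free_def
proof (intro allI impI notI; elim conjE)
  fix w x y z A B C D
  assume dist: "distinct (w # A @ x # B @ y # C @ z # D)"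
    and V: "set (w # A @ x # B @ y # C @ z # D) \<subseteq> V"
    and succ: "successively E (w # A @ x # B @ y # C @ z # D @ [w])"
    and wy: "E w y" and xz: "E x z"
  define S where "S = w # (A @ x # B) @ [y]"
  define T where "T = y # (C @ z # D) @ [w]"
  define S' where "S' = z # (D @ w # A) @ [x]"
  define T' where "T' = x # (B @ y # C) @ [z]"
  have 1: "successively E (w # A @ [x])" "successively E (x # B @ y # C @ z # D @ [w])"
    using iffD1[OF successively_split[of E w A x] succ] by blast+
  have 2: "successively E (x # B @ [y])" "successively E (y # C @ z # D @ [w])"
    using iffD1[OF successively_split[of E x B y] 1(2)] by blast+
  have 3: "successively E (y # C @ [z])" "successively E (z # D @ [w])"
    using iffD1[OF successively_split[of E y C z] 2(2)] by blast+
  have glue: "successively E (u # (X @ v # Y) @ [t])"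
    if "successively E (u # X @ [v])" "successively E (v # Y @ [t])" for u v t X Y
    using iffD2[OF successively_split[of E u X v "Y @ [t]"] conjI[OF that]] by simp
  have succs: "successively E S" "successively E T" "successively E S'" "successively E T'"
    unfolding S_def T_def S'_def T'_def
    by (rule glue[OF 1(1) 2(1)], rule glue[OF 3], rule glue[OF 3(2) 1(1)], rule glue[OF 2(1) 3(1)])
  have diag: "successively E [w, y]" "successively E [x, z]"
    using wy xz by simp_all
  have dists: "distinct S" "distinct T" "distinct S'" "distinct T'"
    using dist by (auto simp: S_def T_def S'_def T'_def)
  have arcs: "arc_between (p w) (p y) (trace S)" "arc_between (p w) (p y) (trace T)"
    "arc_between (p w) (p y) (trace [w, y])"
    "arc_between (p x) (p z) (trace S')" "arc_between (p x) (p z) (trace T')"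
    "arc_between (p x) (p z) (trace [x, z])"
    using edge_arc(1)[OF wy] edge_arc(1)[OF xz] trace_arc[OF dists(1) succs(1)] arc_between_sym[OF trace_arc[OF dists(2) succs(2)]]
      arc_between_sym[OF trace_arc[OF dists(3) succs(3)]] trace_arc[OF dists(4) succs(4)]
    by (simp_all add: S_def T_def S'_def T'_def trace_def)
  have edges: "edges_of S = edges_of (w # A @ [x]) \<union> edges_of (x # B @ [y])"
    "edges_of T = edges_of (y # C @ [z]) \<union> edges_of (z # D @ [w])"
    "edges_of S' = edges_of (z # D @ [w]) \<union> edges_of (w # A @ [x])"
    "edges_of T' = edges_of (x # B @ [y]) \<union> edges_of (y # C @ [z])"
    using edges_of_append[of "w # A" x "B @ [y]"] edges_of_append[of "y # C" z "D @ [w]"]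
      edges_of_append[of "z # D" w "A @ [x]"] edges_of_append[of "x # B" y "C @ [z]"]
    by (simp_all add: S_def T_def S'_def T'_def)
  have same: "trace S' \<union> trace T' = trace S \<union> trace T"
    unfolding trace_def edges by blast
  have sets: "set S \<inter> set T \<subseteq> {w, y}" "set S \<inter> set [w, y] \<subseteq> {w, y}"
    "set T \<inter> set [w, y] \<subseteq> {y, w}"
    "set S' \<inter> set T' \<subseteq> {z, x}" "set S' \<inter> set [x, z] \<subseteq> {z, x}"
    "set T' \<inter> set [x, z] \<subseteq> {x, z}"
    using dist by (auto simp: S_def T_def S'_def T'_def)
  have ne: "A @ x # B \<noteq> []" "C @ z # D \<noteq> []" "D @ w # A \<noteq> []" "B @ y # C \<noteq> []"
    by simp_all
  note meet = trace_meet_ends[OF S_def ne(1) succs(1) succs(2) dists(1) sets(1)]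
    trace_meet_ends[OF S_def ne(1) succs(1) diag(1) dists(1) sets(2)]
    trace_meet_ends[OF T_def ne(2) succs(2) diag(1) dists(2) sets(3), unfolded insert_commute[of "p y" "p w"]]
    trace_meet_ends[OF S'_def ne(3) succs(3) succs(4) dists(3) sets(4), unfolded insert_commute[of "p z" "p x"]]
    trace_meet_ends[OF S'_def ne(3) succs(3) diag(2) dists(3) sets(5), unfolded insert_commute[of "p z" "p x"]]
    trace_meet_ends[OF T'_def ne(4) succs(4) diag(2) dists(4) sets(6)]
  have "edges_of [w, y] \<inter> edges_of [x, z] = {}" "set [w, y] \<inter> set [x, z] = {}"
    using dist by (auto simp: doubleton_eq_iff)
  then have disj: "trace [w, y] \<inter> trace [x, z] = {}"
    using trace_meet[OF diag] by (metis image_empty subset_empty)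
  have sub: "trace S \<union> trace T \<union> trace [w, y] \<union> trace [x, z] \<subseteq> drawing G p c"
    using succs diag by (intro Un_least trace_drawing)
  have mem: "p x \<in> trace S" "p z \<in> trace T" "p w \<in> trace S'" "p y \<in> trace T'"
    using trace_verts[OF succs(1), of x] trace_verts[OF succs(2), of z]
      trace_verts[OF succs(3), of w] trace_verts[OF succs(4), of y]
    by (simp_all add: S_def T_def S'_def T'_def)
  have out: "{p w, p x, p y, p z} \<subseteq> closure (outside (drawing G p c))"
    using V outer_closure by auto
  show False
    by (rule no_outer_crossing[OF arcs same meet disj compact_drawing sub mem out])
qed

end

end

section \<open>Back from the triangulated polygon to the graph\<close>

text \<open>Numbering the vertices along the order turns the graph into a subgraph of a triangulated
  polygon on 0 to \<open>m\<close>. Extra edges only add outside neighbours, so complements of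
  4-dominating sets survive, and they only destroy independent sets. The weighted bound is used with
  \<open>e\<close> = 0, all weights 1 and nothing forced.\<close>

lemma num_dominating_le:
  fixes G :: "'a pair_pre_digraph"
  assumes graph: "pair_graph G" and nc: "noncrossing (\<lambda>u v. (u, v) \<in> parcs G) (pverts G) pos"
    and card: "card (pverts G) = Suc m" "0 < m"
  shows "2 * num_dominating_sets 4 G \<le> num_independent_sets G"
proof -
  interpret pair_graph G
    by (rule graph)
  have sym: "(v, u) \<in> parcs G" if "(u, v) \<in> parcs G" for u v
    using that sym_arcs by (auto simp: symmetric_def with_proj_simps dest: symD)
  have fin: "finite (pverts G)"
    by (rule pair_finite_verts)
  have inj: "inj_on pos (pverts G)"
    using noncrossingD(1)[OF nc] .
  have "finite (pos ` pverts G)" "card (pos ` pverts G) = Suc m"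
    using fin card(1) card_image[OF inj] by auto
  then obtain h where h: "bij_betw h {..<Suc m} (pos ` pverts G)" "strict_mono_on {..<Suc m} h"
    by (metis ex_bij_betw_strict_mono_card)
  define \<psi> where "\<psi> = inv_into (pverts G) pos \<circ> h"
  have bij: "bij_betw \<psi> {0..m} (pverts G)"
    unfolding \<psi>_def atLeast0AtMost lessThan_Suc_atMost[symmetric]
    by (rule bij_betw_trans[OF h(1) bij_betw_inv_into[OF inj_on_imp_bij_betw[OF inj]]])
  have mem: "\<psi> i \<in> pverts G" if "i \<le> m" for i
    using bij that by (auto simp: bij_betw_def)
  have pos: "pos (\<psi> i) = h i" if "i \<le> m" for i
  proof -
    have "h i \<in> pos ` pverts G"
      using h(1) that by (auto dest: bij_betwE)
    then show ?thesis
      by (simp add: \<psi>_def f_inv_into_f)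
  qed
  have less: "pos (\<psi> i) < pos (\<psi> j)" if "i < j" "j \<le> m" for i j
    using h(2) that by (auto simp: pos strict_mono_on_def)
  define R where "R i j \<longleftrightarrow> i \<le> m \<and> j \<le> m \<and> (\<psi> i, \<psi> j) \<in> parcs G" for i j
  have "\<exists>lo hi. triangulates R 0 m lo hi"
  proof (rule triangulation_exists[OF _ card(2)])
    fix a b c d :: nat
    assume "a < b" "b < c" "c < d" "R a c"
    show "\<not> R b d"
    proof
      assume "R b d"
      have le: "a \<le> m" "b \<le> m" "c \<le> m" "d \<le> m"
        using \<open>R a c\<close> \<open>R b d\<close> by (simp_all add: R_def)
      show False
        by (rule noncrossingD(2)[OF nc mem[OF le(1)] mem[OF le(2)] mem[OF le(3)] mem[OF le(4)]
              less[OF \<open>a < b\<close> le(2)] less[OF \<open>b < c\<close> le(3)] less[OF \<open>c < d\<close> le(4)]])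
          (use \<open>R a c\<close> \<open>R b d\<close> in \<open>simp_all add: R_def\<close>)
    qed
  qed
  then obtain lo hi where tri: "triangulates R 0 m lo hi"
    by blast
  note tri' = tri[unfolded triangulates_def]
  have loc: "lo x < x \<and> x < hi x \<and> hi x \<le> m \<and>
      (lo x = 0 \<and> hi x = m \<or> 0 < lo x \<and> hi (lo x) = hi x \<or> hi x < m \<and> lo (hi x) = lo x)"
    if "0 < x" "x < m" for x
    using conjunct1[OF tri'] that by blast
  have uniq: "x = y" if "0 < x" "x < m" "0 < y" "y < m" "lo x = lo y" "hi x = hi y" for x y
    using conjunct1[OF conjunct2[OF tri']] that by blast
  have edge: "x = 0 \<and> y = m \<or> 0 < y \<and> y < m \<and> x = lo y \<or> 0 < x \<and> x < m \<and> y = hi x"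
    if "x < y" "y \<le> m" "R x y" for x y
    using conjunct2[OF conjunct2[OF tri']] that by blast
  interpret T: triangulation m lo hi
    by (rule triangulation.intro) (use card(2) loc uniq in blast)+
  have adj: "T.adj i j" if "R i j" for i j
  proof -
    have less: "T.adj i j" if "R i j" "i < j" for i j
    proof -
      have "i = 0 \<and> j = m \<or> 0 < j \<and> j < m \<and> i = lo j \<or> 0 < i \<and> i < m \<and> j = hi i"
        using edge[OF that(2) _ that(1)] that(1) by (simp add: R_def)
      then show ?thesis
        by (auto simp: T.adj_def T.child_def)
    qed
    have "i \<noteq> j" "R j i"
      using that pair_no_loops[of "(\<psi> i, \<psi> j)"] sym[of "\<psi> i" "\<psi> j"] by (auto simp: R_def)
    then show ?thesis
      using less[of i j] less[of j i] that T.adj_sym by (cases i j rule: linorder_cases) auto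
  qed
  have "lo x \<le> m \<and> hi x \<le> m" if "0 < x" "x < m" for x
    using T.lo_less[OF that] T.hi_le[OF that] that by linarith
  then have closed: "T.closed_set {0..m}"
    by (simp add: T.closed_set_def)
  have adm: "T.admissible {0..m} (\<lambda>_. 0) (\<lambda>_. 1) {}"
    by (simp add: T.admissible_def)
  have "2 * real (num_restricted T.adj {0..m} (\<lambda>_. 0) {}) \<le> weighted_count T.adj {0..m} (\<lambda>_. 1)"
    by (rule T.closed_bounded[OF closed, unfolded T.bounded_by_weight_def, rule_format, OF adm])
  also have "weighted_count T.adj {0..m} (\<lambda>_. 1) = real (card (indep_family T.adj {0..m}))"
  proof -
    have "weight {0..m} (\<lambda>_. 1) I = 1" for I
      unfolding weight_def by (rule prod.neutral) auto
    then show ?thesis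
      by (simp add: weighted_count_def)
  qed
  finally have bound: "2 * num_restricted T.adj {0..m} (\<lambda>_. 0) {} \<le> card (indep_family T.adj {0..m})"
    by linarith
  have "num_dominating_sets 4 G \<le> num_restricted T.adj {0..m} (\<lambda>_. 0) {}"
    unfolding num_dominating_sets_def
  proof (rule card_inj_on_le)
    let ?f = "\<lambda>D. {i \<in> {0..m}. \<psi> i \<notin> D}"
    show "inj_on ?f {D. dominating_set 4 G D}"
    proof (rule inj_onI)
      fix D D' assume D: "D \<in> {D. dominating_set 4 G D}" "D' \<in> {D. dominating_set 4 G D}" "?f D = ?f D'"
      have "D \<subseteq> \<psi> ` {0..m}" "D' \<subseteq> \<psi> ` {0..m}"
        using D(1,2) bij by (auto simp: dominating_set_def bij_betw_def)
      then show "D = D'"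
        using D(3) by blast
    qed
    show "?f ` {D. dominating_set 4 G D} \<subseteq> restricted_family T.adj {0..m} (\<lambda>_. 0) {}"
    proof (rule image_subsetI)
      fix D assume "D \<in> {D. dominating_set 4 G D}"
      then have D: "D \<subseteq> pverts G" "\<And>v. v \<in> pverts G - D \<Longrightarrow> 4 \<le> card {u \<in> D. (v, u) \<in> parcs G}"
        by (auto simp: dominating_set_def)
      have "4 \<le> card {j \<in> {0..m} - ?f D. T.adj i j}" if "i \<in> ?f D" for i
      proof -
        have "4 \<le> card {u \<in> D. (\<psi> i, u) \<in> parcs G}"
          using that mem by (intro D(2)) auto
        also have "\<dots> \<le> card (\<psi> ` {j \<in> {0..m} - ?f D. T.adj i j})"
        proof (rule card_mono)
          show "{u \<in> D. (\<psi> i, u) \<in> parcs G} \<subseteq> \<psi> ` {j \<in> {0..m} - ?f D. T.adj i j}"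
          proof
            fix u assume u: "u \<in> {u \<in> D. (\<psi> i, u) \<in> parcs G}"
            then have "u \<in> \<psi> ` {0..m}"
              using D(1) bij by (auto simp: bij_betw_def)
            then obtain j where "j \<le> m" "u = \<psi> j"
              by auto
            then show "u \<in> \<psi> ` {j \<in> {0..m} - ?f D. T.adj i j}"
              using u that adj[of i j] by (auto simp: R_def)
          qed
        qed simp
        also have "\<dots> \<le> card {j \<in> {0..m} - ?f D. T.adj i j}"
          by (rule card_image_le) simp
        finally show ?thesis .
      qed
      then show "?f D \<in> restricted_family T.adj {0..m} (\<lambda>_. 0) {}"
        by (auto simp: restricted_family_def)
    qed
    show "finite (restricted_family T.adj {0..m} (\<lambda>_. 0) {})"
      by (rule finite_subset[of _ "Pow {0..m}"]) (auto simp: restricted_family_def)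
  qed
  moreover have "card (indep_family T.adj {0..m}) \<le> num_independent_sets G"
    unfolding num_independent_sets_def
  proof (rule card_inj_on_le[of "image \<psi>"])
    have "inj_on (image \<psi>) (Pow {0..m})"
      using bij by (intro inj_on_image_Pow) (auto simp: bij_betw_def)
    then show "inj_on (image \<psi>) (indep_family T.adj {0..m})"
      by (rule inj_on_subset) (auto simp: indep_family_def)
    show "image \<psi> ` indep_family T.adj {0..m} \<subseteq> {S. independent_set G S}"
    proof (rule image_subsetI, rule CollectI)
      fix I assume "I \<in> indep_family T.adj {0..m}"
      then have I: "I \<subseteq> {0..m}" "\<And>i j. i \<in> I \<Longrightarrow> j \<in> I \<Longrightarrow> \<not> T.adj i j"
        by (auto simp: indep_family_def)
      show "independent_set G (\<psi> ` I)"
        unfolding independent_set_def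
      proof (intro conjI ballI)
        show "\<psi> ` I \<subseteq> pverts G"
          using I(1) mem by auto
        fix u v assume "u \<in> \<psi> ` I" "v \<in> \<psi> ` I"
        then obtain i j where ij: "i \<in> I" "j \<in> I" "u = \<psi> i" "v = \<psi> j"
          by blast
        have "i \<le> m" "j \<le> m"
          using ij(1,2) I(1) by auto
        then show "(u, v) \<notin> parcs G"
          using I(2)[OF ij(1,2)] adj[of i j] unfolding ij(3,4) R_def by blast
      qed
    qed
    show "finite {S. independent_set G S}"
      by (rule finite_subset[of _ "Pow (pverts G)"]) (auto simp: independent_set_def fin)
  qed
  ultimately show ?thesis
    using bound by linarith
qed

theorem theorem1:
  fixes G :: "'a pair_pre_digraph"
  assumes "pair_graph G"
    and "pverts G \<noteq> {}"
    and "outerplanar G"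
  shows "num_independent_sets G > num_dominating_sets 4 G"
proof -
  obtain p c where emb: "plane_embedding G p c"
    and outer: "p ` pverts G \<subseteq> frontier (outside (drawing G p c))"
    using assms(3) unfolding outerplanar_def by blast
  note D = plane_drawing.intro[OF assms(1) emb]
  note fin = plane_drawing.finite_V[OF D]
  have fin_ind: "finite {S. independent_set G S}"
    by (rule finite_subset[of _ "Pow (pverts G)"]) (auto simp: independent_set_def fin)
  have fin_dom: "finite {D. dominating_set 4 G D}"
    by (rule finite_subset[of _ "Pow (pverts G)"]) (auto simp: dominating_set_def fin)
  show ?thesis
  \<comment> \<open>A single vertex leaves no room for a root edge and is counted directly: one
    4-dominating set against two independent sets.\<close>
  proof (cases "card (pverts G) = 1")
    case True
    then obtain v where v: "pverts G = {v}"
      by (rule card_1_singletonE)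
    have "D = {v}" if "dominating_set 4 G D" for D
    proof -
      have "D \<subseteq> {v}" "v \<notin> D \<Longrightarrow> 4 \<le> card {u \<in> D. (v, u) \<in> parcs G}"
        using that unfolding dominating_set_def v by auto
      moreover have "D = {}" if "v \<notin> D"
        using that \<open>D \<subseteq> {v}\<close> by auto
      ultimately show ?thesis
        by (cases "v \<in> D") auto
    qed
    then have "num_dominating_sets 4 G \<le> card {{v}}"
      unfolding num_dominating_sets_def by (intro card_mono) auto
    moreover have "card {{}, {v}} \<le> num_independent_sets G"
      unfolding num_independent_sets_def
      using plane_drawing.E_irrefl[OF D] by (intro card_mono fin_ind) (auto simp: independent_set_def v)
    ultimately show ?thesis
      by simp
  next
    case False
    moreover have "0 < card (pverts G)"
      using assms(2) fin by (simp add: card_gt_0_iff)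
    ultimately obtain m where m: "card (pverts G) = Suc m" "0 < m"
      by (metis Suc_pred One_nat_def neq0_conv)
    obtain pos where pos: "noncrossing (\<lambda>u v. (u, v) \<in> parcs G) (pverts G) pos"
      using noncrossing_exists[OF fin plane_drawing.E_sym[OF D] plane_drawing.E_irrefl[OF D]
        plane_drawing.drawing_theta_free[OF D outer] plane_drawing.drawing_crossing_free[OF D outer]]
      by blast
    have "2 * num_dominating_sets 4 G \<le> num_independent_sets G"
      by (rule num_dominating_le[OF assms(1) pos m])
    \<comment> \<open>Strictness comes from the factor 2, as the full vertex set makes the smaller
      count positive.\<close>
    moreover have "dominating_set 4 G (pverts G)"
      by (simp add: dominating_set_def)
    then have "0 < num_dominating_sets 4 G"
      using fin_dom unfolding num_dominating_sets_def card_gt_0_iff by blast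
    ultimately show ?thesis
      by linarith
  qed
qed

end
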